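(* Let $n \geq 1$ and let $L$ be a Lie subalgebra of $\mathbb{W}_n$ with $\mathrm{GKdim}(L) = n$. Then $U(L)$ is not noetherian.
   Context: $\Bbbk$ is a field of characteristic zero. $\mathbb{W}_n = \mathrm{Der}(\Bbbk[x_1,\dots,x_n]) = \sum_{i=1}^n \Bbbk[x_1,\dots,x_n]\partial_i$ with $\partial_i = \partial/\partial x_i$. $\mathrm{GKdim}$ denotes the Gelfand--Kirillov dimension of a Lie algebra (the supremum over finitely generated subalgebras $L'$, generated by a finite-dimensional subspace $V$, of the growth rate $\limsup_k \log\dim(V + C_1(V)+\dots+C_k(V))/\log k$, where $C_0(V)=V$ and $C_k(V) = [C_{k-1}(V),V]$). Noetherian means left and right noetherian. *)

theory Defs
  imports "HOL-Library.Poly_Mapping" "HOL-Library.Extended_Real" "HOL-Library.Liminf_Limsup" "HOL-Library.Function_Algebras"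
          "HOL-Algebra.QuotRing"
begin

text \<open>Polynomials over k in the variables x_0, x_1, ...: finitely supported maps from
  monomials (finitely supported exponent vectors) to coefficients; multiplication is the
  library's convolution product. The polynomial ring in n variables is the set of
  polynomials whose monomials only involve variables with index below n.\<close>

type_synonym 'k mpoly = "(nat \<Rightarrow>\<^sub>0 nat) \<Rightarrow>\<^sub>0 'k"

definition pscale :: "'k::field \<Rightarrow> 'k mpoly \<Rightarrow> 'k mpoly" where
  "pscale c p = Poly_Mapping.map (\<lambda>a. c * a) p"

definition Pn :: "nat \<Rightarrow> 'k::field mpoly set" where
  "Pn n = {p. \<forall>m\<in>Poly_Mapping.keys p. \<forall>i\<in>Poly_Mapping.keys m. i < n}"

text \<open>k-linear derivations of k[x_1..x_n], as maps on mpoly that vanish outside Pn n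
  (so that each derivation is represented uniquely).\<close>

definition derivation :: "nat \<Rightarrow> ('k::field mpoly \<Rightarrow> 'k mpoly) \<Rightarrow> bool" where
  "derivation n D \<longleftrightarrow>
     (\<forall>p. p \<notin> Pn n \<longrightarrow> D p = 0) \<and>
     (\<forall>p\<in>Pn n. D p \<in> Pn n) \<and>
     (\<forall>p\<in>Pn n. \<forall>q\<in>Pn n. D (p + q) = D p + D q) \<and>
     (\<forall>c. \<forall>p\<in>Pn n. D (pscale c p) = pscale c (D p)) \<and>
     (\<forall>p\<in>Pn n. \<forall>q\<in>Pn n. D (p * q) = p * D q + D p * q)"

definition Wn :: "nat \<Rightarrow> ('k::field mpoly \<Rightarrow> 'k mpoly) set" where
  "Wn n = {D. derivation n D}"

definition dscale :: "'k::field \<Rightarrow> ('k mpoly \<Rightarrow> 'k mpoly) \<Rightarrow> ('k mpoly \<Rightarrow> 'k mpoly)" where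
  "dscale c D = (\<lambda>p. pscale c (D p))"

definition lie_bracket :: "('k::field mpoly \<Rightarrow> 'k mpoly) \<Rightarrow> ('k mpoly \<Rightarrow> 'k mpoly)
    \<Rightarrow> ('k mpoly \<Rightarrow> 'k mpoly)" where
  "lie_bracket D E = (\<lambda>p. D (E p) - E (D p))"

abbreviation dspan :: "('k::field mpoly \<Rightarrow> 'k mpoly) set \<Rightarrow> ('k mpoly \<Rightarrow> 'k mpoly) set" where
  "dspan \<equiv> module.span dscale"

abbreviation ddim :: "('k::field mpoly \<Rightarrow> 'k mpoly) set \<Rightarrow> nat" where
  "ddim \<equiv> vector_space.dim dscale"

definition lie_subalgebra_Wn :: "nat \<Rightarrow> ('k::field mpoly \<Rightarrow> 'k mpoly) set \<Rightarrow> bool" where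
  "lie_subalgebra_Wn n L \<longleftrightarrow> L \<subseteq> Wn n \<and> module.subspace dscale L \<and>
     (\<forall>a\<in>L. \<forall>b\<in>L. lie_bracket a b \<in> L)"

definition brackets :: "('k::field mpoly \<Rightarrow> 'k mpoly) set \<Rightarrow> ('k mpoly \<Rightarrow> 'k mpoly) set
    \<Rightarrow> ('k mpoly \<Rightarrow> 'k mpoly) set" where
  "brackets A B = {lie_bracket a b | a b. a \<in> A \<and> b \<in> B}"

fun Cseq :: "('k::field mpoly \<Rightarrow> 'k mpoly) set \<Rightarrow> nat \<Rightarrow> ('k mpoly \<Rightarrow> 'k mpoly) set" where
  "Cseq V 0 = V"
| "Cseq V (Suc k) = dspan (brackets (Cseq V k) V)"

definition growth_space :: "('k::field mpoly \<Rightarrow> 'k mpoly) set \<Rightarrow> nat \<Rightarrow> ('k mpoly \<Rightarrow> 'k mpoly) set" where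
  "growth_space V k = dspan (\<Union>j\<le>k. Cseq V j)"

definition gk_growth :: "('k::field mpoly \<Rightarrow> 'k mpoly) set \<Rightarrow> ereal" where
  "gk_growth V = limsup (\<lambda>k. ereal (ln (real (ddim (growth_space V k))) / ln (real k)))"

definition GKdim :: "('k::field mpoly \<Rightarrow> 'k mpoly) set \<Rightarrow> ereal" where
  "GKdim L = (SUP B\<in>{B. finite B \<and> B \<subseteq> L}. gk_growth (dspan B))"

text \<open>Free associative k-algebra on the set L (noncommutative polynomials in letters from L),
  and U(L) as its quotient by the two-sided ideal generated by the relations making the
  generators k-linear in L together with x y - y x - [x,y].\<close>

definition fa_mult :: "('d list \<Rightarrow>\<^sub>0 'k::field) \<Rightarrow> ('d list \<Rightarrow>\<^sub>0 'k) \<Rightarrow> ('d list \<Rightarrow>\<^sub>0 'k)" where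
  "fa_mult a b = (\<Sum>u\<in>Poly_Mapping.keys a. \<Sum>v\<in>Poly_Mapping.keys b. Poly_Mapping.single (u @ v) (Poly_Mapping.lookup a u * Poly_Mapping.lookup b v))"

definition fa_gen :: "'d \<Rightarrow> ('d list \<Rightarrow>\<^sub>0 'k::field)" where
  "fa_gen x = Poly_Mapping.single [x] 1"

definition free_alg :: "'d set \<Rightarrow> ('d list \<Rightarrow>\<^sub>0 'k::field) ring" where
  "free_alg L = \<lparr>carrier = {a. Poly_Mapping.keys a \<subseteq> lists L}, monoid.mult = fa_mult,
     one = Poly_Mapping.single [] 1, zero = 0, add = (+)\<rparr>"

definition UE_rels :: "('k::field mpoly \<Rightarrow> 'k mpoly) set
    \<Rightarrow> (('k mpoly \<Rightarrow> 'k mpoly) list \<Rightarrow>\<^sub>0 'k) set" where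
  "UE_rels L =
     {fa_gen (x + y) - fa_gen x - fa_gen y | x y. x \<in> L \<and> y \<in> L} \<union>
     {fa_gen (dscale c x) - Poly_Mapping.single [x] c | c x. x \<in> L} \<union>
     {fa_mult (fa_gen x) (fa_gen y) - fa_mult (fa_gen y) (fa_gen x) - fa_gen (lie_bracket x y)
        | x y. x \<in> L \<and> y \<in> L}"

definition UE :: "('k::field mpoly \<Rightarrow> 'k mpoly) set
    \<Rightarrow> (('k mpoly \<Rightarrow> 'k mpoly) list \<Rightarrow>\<^sub>0 'k) set ring" where
  "UE L = free_alg L Quot genideal (free_alg L) (UE_rels L)"

definition left_ideal :: "'a set \<Rightarrow> ('a, 'b) ring_scheme \<Rightarrow> bool" where
  "left_ideal I R \<longleftrightarrow> additive_subgroup I R \<and> (\<forall>a\<in>I. \<forall>x\<in>carrier R. x \<otimes>\<^bsub>R\<^esub> a \<in> I)"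

definition right_ideal :: "'a set \<Rightarrow> ('a, 'b) ring_scheme \<Rightarrow> bool" where
  "right_ideal I R \<longleftrightarrow> additive_subgroup I R \<and> (\<forall>a\<in>I. \<forall>x\<in>carrier R. a \<otimes>\<^bsub>R\<^esub> x \<in> I)"

definition left_noetherian :: "('a, 'b) ring_scheme \<Rightarrow> bool" where
  "left_noetherian R \<longleftrightarrow> (\<forall>C :: nat \<Rightarrow> 'a set. (\<forall>i. left_ideal (C i) R) \<and> (\<forall>i. C i \<subseteq> C (Suc i))
      \<longrightarrow> (\<exists>N. \<forall>m\<ge>N. C m = C N))"

definition right_noetherian :: "('a, 'b) ring_scheme \<Rightarrow> bool" where
  "right_noetherian R \<longleftrightarrow> (\<forall>C :: nat \<Rightarrow> 'a set. (\<forall>i. right_ideal (C i) R) \<and> (\<forall>i. C i \<subseteq> C (Suc i))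
      \<longrightarrow> (\<exists>N. \<forall>m\<ge>N. C m = C N))"

definition noetherian :: "('a, 'b) ring_scheme \<Rightarrow> bool" where
  "noetherian R \<longleftrightarrow> left_noetherian R \<and> right_noetherian R"

end

theory Submission
  imports Defs "HOL-Library.Product_Plus" "HOL-Computational_Algebra.Polynomial"
begin

text \<open>
  A derivation \<open>D = \<Sum> d\<^sub>m \<partial>\<^sub>m\<close> is replaced by its symbol \<open>f = \<Sum> \<eta>\<^sub>m d\<^sub>m\<close> on the cotangent space, on
  which it acts as a Hamiltonian vector field. Prolonged to the tangent bundle of the cotangent space, this
  action involves the derivatives of \<open>f\<close> of order at most two, and it can be deformed to first order by
  the third derivative \<open>\<partial>\<^sub>w\<^sup>3 f\<close> of \<open>f\<close> in the tangent direction \<open>w\<close>, which is a 1-cocycle (the Lie derivative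
  of the flat symplectic connection). If a symmetric tensor \<open>\<Sum> f\<^sub>i \<otimes> g\<^sub>i\<close> of symbols vanishes to order 6
  along the diagonal, then the element \<open>\<Sum> f\<^sub>i g\<^sub>i\<close> of the enveloping algebra acts, to second order in the
  deformation parameter, as multiplication by \<open>q = \<Sum> \<partial>\<^sub>w\<^sup>3 f\<^sub>i \<partial>\<^sub>w\<^sup>3 g\<^sub>i\<close>. The operators that vanish to second order
  and map the constant function 1 into a given space at second order form a right ideal, because the
  undeformed action kills constants; hence right noetherianity confines all these \<open>q\<close> to
  one finite-dimensional space.

  This is impossible by counting. By symmetry, \<open>q = 0\<close> raises the order of the tensor from 6 to 8, and applying a
  fixed Hamiltonian field \<open>X\<close> to both factors lowers it to 6 again. So a bounded number of linear
  conditions per step makes the tensor vanish along the flow of \<open>X\<close>. Since the subalgebra has growth close to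
  \<open>n\<close>, some nonzero tensor satisfies all these conditions; its leading term along a hyperplane transversal to
  \<open>X\<close> shows that it does not vanish along the flow.
\<close>

section \<open>Sums over the support of a finitely supported map\<close>

lemma poly_mapping_sum_single:
  "p = (\<Sum>m\<in>Poly_Mapping.keys p. Poly_Mapping.single m (Poly_Mapping.lookup p m))"
proof (rule poly_mapping_eqI)
  fix k
  have "Poly_Mapping.lookup (\<Sum>m\<in>Poly_Mapping.keys p. Poly_Mapping.single m (Poly_Mapping.lookup p m)) k
      = (\<Sum>m\<in>Poly_Mapping.keys p. if m = k then Poly_Mapping.lookup p m else 0)"
    unfolding lookup_sum by (intro sum.cong refl) (auto simp: lookup_single)
  also have "\<dots> = Poly_Mapping.lookup p k"
    by (auto simp: sum.delta in_keys_iff)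
  finally show "Poly_Mapping.lookup p k = Poly_Mapping.lookup
      (\<Sum>m\<in>Poly_Mapping.keys p. Poly_Mapping.single m (Poly_Mapping.lookup p m)) k" by simp
qed

lemma poly_mapping_single_induct [case_names zero single add]:
  fixes p :: "'a \<Rightarrow>\<^sub>0 'b::comm_monoid_add"
  assumes "P 0" "\<And>m a. P (Poly_Mapping.single m a)" "\<And>p q. P p \<Longrightarrow> P q \<Longrightarrow> P (p + q)"
  shows "P p"
proof -
  have "P (\<Sum>m\<in>S. Poly_Mapping.single m (Poly_Mapping.lookup p m))" if "finite S" for S
    using that by induction (use assms in auto)
  from this[of "Poly_Mapping.keys p"] show ?thesis
    using poly_mapping_sum_single[of p] by simp
qed

lemma sum_keys_add:
  fixes h :: "'a \<Rightarrow> 'b::comm_monoid_add \<Rightarrow> 'c::comm_monoid_add"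
  assumes "\<And>m. h m 0 = 0" "\<And>m a b. h m (a + b) = h m a + h m b"
  shows "(\<Sum>m\<in>Poly_Mapping.keys (p + q). h m (Poly_Mapping.lookup (p + q) m))
    = (\<Sum>m\<in>Poly_Mapping.keys p. h m (Poly_Mapping.lookup p m))
    + (\<Sum>m\<in>Poly_Mapping.keys q. h m (Poly_Mapping.lookup q m))"
  using assms by (intro setsum_keys_plus_distrib) auto

lemma sum_keys_single:
  fixes h :: "'a \<Rightarrow> 'b::zero \<Rightarrow> 'c::comm_monoid_add"
  assumes "\<And>m. h m 0 = 0"
  shows "(\<Sum>m\<in>Poly_Mapping.keys (Poly_Mapping.single k a).
      h m (Poly_Mapping.lookup (Poly_Mapping.single k a) m)) = h k a"
  using assms by (cases "a = 0") auto

subsection \<open>The free algebra\<close>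

lemma fa_mult_add_left: "fa_mult (a + b) c = fa_mult a c + fa_mult b c"
  unfolding fa_mult_def
  by (rule sum_keys_add[where h = "\<lambda>u x. \<Sum>v\<in>Poly_Mapping.keys c.
      Poly_Mapping.single (u @ v) (x * Poly_Mapping.lookup c v)"])
     (simp_all add: single_add distrib_right sum.distrib)

lemma fa_mult_add_right: "fa_mult c (a + b) = fa_mult c a + fa_mult c b"
proof -
  have "fa_mult c d = (\<Sum>v\<in>Poly_Mapping.keys d. \<Sum>u\<in>Poly_Mapping.keys c.
      Poly_Mapping.single (u @ v) (Poly_Mapping.lookup c u * Poly_Mapping.lookup d v))" for d
    unfolding fa_mult_def by (rule sum.swap)
  then show ?thesis
    by (simp only: sum_keys_add[where h = "\<lambda>v x. \<Sum>u\<in>Poly_Mapping.keys c.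
      Poly_Mapping.single (u @ v) (Poly_Mapping.lookup c u * x)"] single_add distrib_left sum.distrib
      mult_zero_right single_zero sum.neutral_const)
qed

lemma fa_mult_zero [simp]: "fa_mult 0 a = 0" "fa_mult a 0 = 0"
  by (simp_all add: fa_mult_def)

lemma fa_mult_single:
  "fa_mult (Poly_Mapping.single u a) (Poly_Mapping.single v b) = Poly_Mapping.single (u @ v) (a * b)"
  by (cases "a = 0"; cases "b = 0") (auto simp: fa_mult_def)

lemma fa_mult_assoc: "fa_mult (fa_mult a b) c = fa_mult a (fa_mult b c)"
proof (induction a rule: poly_mapping_single_induct)
  case (single u x)
  show ?case
  proof (induction b rule: poly_mapping_single_induct)
    case (single v y)
    show ?case
      by (induction c rule: poly_mapping_single_induct)
         (simp_all add: fa_mult_single fa_mult_add_right mult.assoc)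
  qed (simp_all add: fa_mult_add_left fa_mult_add_right)
qed (simp_all add: fa_mult_add_left)

lemma fa_mult_one:
  "fa_mult (Poly_Mapping.single [] 1) a = a" "fa_mult a (Poly_Mapping.single [] 1) = a"
  by (induction a rule: poly_mapping_single_induct;
      simp add: fa_mult_single fa_mult_add_left fa_mult_add_right)+

lemma keys_fa_mult: "Poly_Mapping.keys (fa_mult a b)
    \<subseteq> {u @ v | u v. u \<in> Poly_Mapping.keys a \<and> v \<in> Poly_Mapping.keys b}"
proof -
  have "Poly_Mapping.keys (fa_mult a b) \<subseteq> (\<Union>u\<in>Poly_Mapping.keys a. \<Union>v\<in>Poly_Mapping.keys b.
      Poly_Mapping.keys (Poly_Mapping.single (u @ v) (Poly_Mapping.lookup a u * Poly_Mapping.lookup b v)))"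
    unfolding fa_mult_def by (rule order_trans[OF keys_sum]) (intro UN_mono order_refl keys_sum)
  also have "\<dots> \<subseteq> {u @ v | u v. u \<in> Poly_Mapping.keys a \<and> v \<in> Poly_Mapping.keys b}"
    by (auto split: if_splits)
  finally show ?thesis .
qed

lemma free_alg_simps [simp]:
  "carrier (free_alg L) = {a. Poly_Mapping.keys a \<subseteq> lists L}"
  "monoid.mult (free_alg L) = fa_mult" "one (free_alg L) = Poly_Mapping.single [] 1"
  "zero (free_alg L) = 0" "add (free_alg L) = (+)"
  by (simp_all add: free_alg_def)

lemma ring_free_alg: "ring (free_alg L :: ('d list \<Rightarrow>\<^sub>0 'k::field) ring)"
proof (rule ringI)
  show "abelian_group (free_alg L :: ('d list \<Rightarrow>\<^sub>0 'k) ring)"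
  proof (rule abelian_groupI)
    fix x y :: "'d list \<Rightarrow>\<^sub>0 'k"
    assume *: "x \<in> carrier (free_alg L)"
    then show "\<exists>y\<in>carrier (free_alg L). y \<oplus>\<^bsub>free_alg L\<^esub> x = \<zero>\<^bsub>free_alg L\<^esub>"
      by (intro bexI[of _ "- x"]) auto
    assume "y \<in> carrier (free_alg L)"
    with * show "x \<oplus>\<^bsub>free_alg L\<^esub> y \<in> carrier (free_alg L)"
      using keys_add[of x y] by auto
  qed (auto simp: add_ac)
  show "monoid (free_alg L :: ('d list \<Rightarrow>\<^sub>0 'k) ring)"
  proof (rule monoidI)
    fix x y :: "'d list \<Rightarrow>\<^sub>0 'k"
    assume "x \<in> carrier (free_alg L)" "y \<in> carrier (free_alg L)"
    then show "x \<otimes>\<^bsub>free_alg L\<^esub> y \<in> carrier (free_alg L)"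
      using keys_fa_mult[of x y] by fastforce
  qed (auto simp: fa_mult_assoc fa_mult_one)
qed (auto simp: fa_mult_add_left fa_mult_add_right)

lemma uminus_free_alg:
  assumes "a \<in> carrier (free_alg L)"
  shows "\<ominus>\<^bsub>free_alg L\<^esub> a = - (a :: 'd list \<Rightarrow>\<^sub>0 'k::field)"
proof -
  interpret ring "free_alg L :: ('d list \<Rightarrow>\<^sub>0 'k) ring" by (rule ring_free_alg)
  show ?thesis using assms by (intro minus_equality) auto
qed

subsection \<open>Representations of the enveloping algebra\<close>

locale lie_rep = vector_space sc
  for sc :: "'k::field \<Rightarrow> 'v::ab_group_add \<Rightarrow> 'v" +
  fixes L :: "('k mpoly \<Rightarrow> 'k mpoly) set" and \<rho> :: "('k mpoly \<Rightarrow> 'k mpoly) \<Rightarrow> 'v \<Rightarrow> 'v"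
  assumes L_add: "x \<in> L \<Longrightarrow> y \<in> L \<Longrightarrow> x + y \<in> L"
    and L_scale: "x \<in> L \<Longrightarrow> dscale c x \<in> L"
    and L_bracket: "x \<in> L \<Longrightarrow> y \<in> L \<Longrightarrow> lie_bracket x y \<in> L"
    and rho_add: "x \<in> L \<Longrightarrow> \<rho> x (v + w) = \<rho> x v + \<rho> x w"
    and rho_scale: "x \<in> L \<Longrightarrow> \<rho> x (sc c v) = sc c (\<rho> x v)"
    and rho_add': "x \<in> L \<Longrightarrow> y \<in> L \<Longrightarrow> \<rho> (x + y) v = \<rho> x v + \<rho> y v"
    and rho_scale': "x \<in> L \<Longrightarrow> \<rho> (dscale c x) v = sc c (\<rho> x v)"
    and rho_bracket: "x \<in> L \<Longrightarrow> y \<in> L \<Longrightarrow> \<rho> (lie_bracket x y) v = \<rho> x (\<rho> y v) - \<rho> y (\<rho> x v)"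
begin

text \<open>The head of a word acts last, so that concatenation of words becomes composition of
  operators.\<close>

definition act :: "(('k mpoly \<Rightarrow> 'k mpoly) list \<Rightarrow>\<^sub>0 'k) \<Rightarrow> 'v \<Rightarrow> 'v" where
  "act a v = (\<Sum>u\<in>Poly_Mapping.keys a. sc (Poly_Mapping.lookup a u) (foldr \<rho> u v))"

lemma act_zero [simp]: "act 0 v = 0"
  by (simp add: act_def)

lemma act_single: "act (Poly_Mapping.single u c) v = sc c (foldr \<rho> u v)"
  unfolding act_def by (rule sum_keys_single) simp

lemma act_add: "act (a + b) v = act a v + act b v"
  unfolding act_def by (rule sum_keys_add) (simp_all add: scale_left_distrib)

lemma act_uminus: "act (- a) v = - act a v"
  using act_add[of a "- a" v] by (simp add: eq_neg_iff_add_eq_0 add.commute)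

lemma act_diff: "act (a - b) v = act a v - act b v"
  using act_add[of a "- b" v] by (simp add: act_uminus)

lemma foldr_rho_add: "u \<in> lists L \<Longrightarrow> foldr \<rho> u (v + w) = foldr \<rho> u v + foldr \<rho> u w"
  by (induction u) (simp_all add: rho_add)

lemma foldr_rho_scale: "u \<in> lists L \<Longrightarrow> foldr \<rho> u (sc c v) = sc c (foldr \<rho> u v)"
  by (induction u) (simp_all add: rho_scale)

lemma foldr_rho_zero: "u \<in> lists L \<Longrightarrow> foldr \<rho> u 0 = 0"
  using foldr_rho_scale[of u 0 0] by simp

lemma foldr_rho_sum: "u \<in> lists L \<Longrightarrow> foldr \<rho> u (\<Sum>i\<in>S. h i) = (\<Sum>i\<in>S. foldr \<rho> u (h i))"
  by (induction S rule: infinite_finite_induct) (simp_all add: foldr_rho_add foldr_rho_zero)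

lemma act_add_arg: "a \<in> carrier (free_alg L) \<Longrightarrow> act a (v + w) = act a v + act a w"
  unfolding act_def sum.distrib[symmetric]
  by (intro sum.cong refl) (auto simp: foldr_rho_add scale_right_distrib subset_iff)

lemma act_scale_arg: "a \<in> carrier (free_alg L) \<Longrightarrow> act a (sc c v) = sc c (act a v)"
  unfolding act_def scale_sum_right
  by (intro sum.cong refl) (auto simp: foldr_rho_scale mult.commute subset_iff)

lemma act_mult:
  assumes "a \<in> carrier (free_alg L)" "b \<in> carrier (free_alg L)"
  shows "act (fa_mult a b) v = act a (act b v)"
proof -
  have act_sum: "act (\<Sum>i\<in>S. h i) w = (\<Sum>i\<in>S. act (h i) w)"
    for S :: "('k mpoly \<Rightarrow> 'k mpoly) list set" and h w
    by (induction S rule: infinite_finite_induct) (simp_all add: act_add)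
  have "act (fa_mult a b) v = (\<Sum>u\<in>Poly_Mapping.keys a. \<Sum>w\<in>Poly_Mapping.keys b.
      sc (Poly_Mapping.lookup a u * Poly_Mapping.lookup b w) (foldr \<rho> u (foldr \<rho> w v)))"
    unfolding fa_mult_def act_sum act_single by simp
  also have "\<dots> = (\<Sum>u\<in>Poly_Mapping.keys a. sc (Poly_Mapping.lookup a u)
      (foldr \<rho> u (\<Sum>w\<in>Poly_Mapping.keys b. sc (Poly_Mapping.lookup b w) (foldr \<rho> w v))))"
    using assms
    by (intro sum.cong refl) (auto simp: foldr_rho_sum scale_sum_right foldr_rho_scale subset_iff)
  finally show ?thesis by (simp add: act_def)
qed

lemma ideal_annihilator:
  "ideal {a \<in> carrier (free_alg L). \<forall>v. act a v = 0} (free_alg L)" (is "ideal ?I _")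
proof (rule idealI)
  interpret ring "free_alg L :: (('k mpoly \<Rightarrow> 'k mpoly) list \<Rightarrow>\<^sub>0 'k) ring" by (rule ring_free_alg)
  show "ring (free_alg L :: (('k mpoly \<Rightarrow> 'k mpoly) list \<Rightarrow>\<^sub>0 'k) ring)" by (rule ring_free_alg)
  show "subgroup ?I (add_monoid (free_alg L))"
  proof (rule add.subgroupI)
    show "?I \<noteq> {}" by (auto intro: exI[of _ 0])
  qed (use keys_add in \<open>fastforce simp: act_add act_uminus uminus_free_alg[unfolded a_inv_def]
         uminus_free_alg\<close>)+
  fix a x :: "('k mpoly \<Rightarrow> 'k mpoly) list \<Rightarrow>\<^sub>0 'k"
  assume a: "a \<in> ?I" and x: "x \<in> carrier (free_alg L)"
  have "act x 0 = 0" using act_scale_arg[OF x, of 0 0] by simp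
  then show "x \<otimes>\<^bsub>free_alg L\<^esub> a \<in> ?I" "a \<otimes>\<^bsub>free_alg L\<^esub> x \<in> ?I"
    using a x m_closed[of x a] m_closed[of a x] act_mult[of x a] act_mult[of a x] by auto
qed

text \<open>The elements acting as zero form a two-sided ideal that contains the defining relations.
  Hence the operator of an element depends only on its class in \<open>UE L\<close>.\<close>

lemma act_UE_ideal:
  assumes "a \<in> genideal (free_alg L) (UE_rels L)"
  shows "act a v = 0"
proof -
  interpret ring "free_alg L :: (('k mpoly \<Rightarrow> 'k mpoly) list \<Rightarrow>\<^sub>0 'k) ring" by (rule ring_free_alg)
  have "r \<in> carrier (free_alg L) \<and> (\<forall>v. act r v = 0)" if "r \<in> UE_rels L" for r
  proof -
    have gen: "fa_gen x \<in> carrier (free_alg L)" "act (fa_gen x) v = \<rho> x v" if "x \<in> L" for x v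
      using that by (auto simp: fa_gen_def act_single)
    have sg: "Poly_Mapping.single [x] c \<in> carrier (free_alg L)" if "x \<in> L" for x c
      using that by auto
    have diff: "p - q \<in> carrier (free_alg L)"
      if "p \<in> carrier (free_alg L)" "q \<in> carrier (free_alg L)"
      for p q :: "('k mpoly \<Rightarrow> 'k mpoly) list \<Rightarrow>\<^sub>0 'k"
      using that keys_diff[of p q] by auto
    from that show ?thesis
      unfolding UE_rels_def
      using m_closed
      by (auto simp del: free_alg_simps(1) simp: act_diff act_mult gen sg L_add L_scale L_bracket
          rho_add' rho_scale' rho_bracket act_single intro!: diff)
  qed
  then have "genideal (free_alg L) (UE_rels L)
      \<subseteq> {a \<in> carrier (free_alg L). \<forall>v. act a v = 0}"
    by (intro genideal_minimal ideal_annihilator) blast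
  then show ?thesis using assms by blast
qed

text \<open>A chain condition on operators instead of cosets. The closure hypotheses make the
  elements whose operator satisfies \<open>Q i\<close> the preimage of a right ideal of
  \<open>UE L\<close>: right multiplication by \<open>b\<close> is precomposition with
  \<open>act b\<close>. These right ideals increase with \<open>i\<close>.\<close>

lemma right_noetherian_UE_stabilises:
  fixes Q :: "nat \<Rightarrow> ('v \<Rightarrow> 'v) \<Rightarrow> bool"
  assumes "right_noetherian (UE L)"
    and zero: "\<And>i. Q i (\<lambda>_. 0)"
    and add: "\<And>i F G. Q i F \<Longrightarrow> Q i G \<Longrightarrow> Q i (\<lambda>v. F v + G v)"
    and minus: "\<And>i F. Q i F \<Longrightarrow> Q i (\<lambda>v. - F v)"
    and comp: "\<And>i F b. b \<in> carrier (free_alg L) \<Longrightarrow> Q i F \<Longrightarrow> Q i (\<lambda>v. F (act b v))"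
    and mono: "\<And>i F. Q i F \<Longrightarrow> Q (Suc i) F"
  shows "\<exists>N. \<forall>m\<ge>N. \<forall>a\<in>carrier (free_alg L). Q m (act a) \<longrightarrow> Q N (act a)"
proof -
  let ?R = "free_alg L :: (('k mpoly \<Rightarrow> 'k mpoly) list \<Rightarrow>\<^sub>0 'k) ring"
  let ?I = "genideal ?R (UE_rels L)"
  interpret ring ?R by (rule ring_free_alg)
  have "UE_rels L \<subseteq> carrier ?R"
  proof -
    have diff: "p - q \<in> carrier ?R" if "p \<in> carrier ?R" "q \<in> carrier ?R" for p q
      using that keys_diff[of p q] by auto
    have sg: "Poly_Mapping.single [x] c \<in> carrier ?R" if "x \<in> L" for x c
      using that by auto
    show ?thesis unfolding UE_rels_def fa_gen_def using m_closed
      by (auto simp del: free_alg_simps(1) simp: sg L_add L_scale L_bracket intro!: diff)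
  qed
  then interpret I: ideal ?I ?R by (rule genideal_ideal)
  interpret h: ring_hom_ring ?R "UE L" "(+>\<^bsub>?R\<^esub>) ?I"
    unfolding UE_def by (rule I.rcos_ring_hom_ring)
  define J where "J i = {a \<in> carrier ?R. Q i (act a)}" for i
  define C where "C i = (\<lambda>a. ?I +>\<^bsub>?R\<^esub> a) ` J i" for i
  \<comment> \<open>Membership in \<open>J i\<close> is a property of the coset alone, so passing to
    the quotient loses nothing.\<close>
  have J_I: "a \<in> J i" if "a \<in> carrier ?R" "b \<in> J i" "?I +>\<^bsub>?R\<^esub> a = ?I +>\<^bsub>?R\<^esub> b" for a b i
  proof -
    from that have b: "b \<in> carrier ?R" by (simp add: J_def)
    have "a \<in> ?I +>\<^bsub>?R\<^esub> b" using I.a_rcos_self[OF that(1)] that(3) by simp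
    then obtain x where x: "x \<in> ?I" "a = x + b"
      unfolding a_r_coset_def' by auto
    have "act a = act b"
      using x by (auto simp: act_add act_UE_ideal)
    then show ?thesis using that by (simp add: J_def)
  qed
  have ideal: "right_ideal (C i) (UE L)" for i
    unfolding right_ideal_def
  proof
    have JR: "J i \<subseteq> carrier ?R" by (auto simp: J_def)
    show "additive_subgroup (C i) (UE L)"
    proof (rule additive_subgroupI, rule h.S.add.subgroupI)
      show "C i \<subseteq> carrier (UE L)" using JR by (auto simp: C_def simp del: free_alg_simps)
      have "act 0 = (\<lambda>_. 0)" by auto
      then have "0 \<in> J i" using zero by (simp add: J_def)
      then show "C i \<noteq> {}" by (auto simp: C_def)
      fix x assume "x \<in> C i"
      then obtain a where a: "a \<in> J i" "x = ?I +>\<^bsub>?R\<^esub> a" by (auto simp: C_def)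
      have aR: "a \<in> carrier ?R" using a JR by blast
      have "- a \<in> J i" using a minus[of i "act a"] by (simp add: J_def act_uminus[abs_def])
      moreover have "\<ominus>\<^bsub>UE L\<^esub> x = ?I +>\<^bsub>?R\<^esub> (- a)"
        using h.hom_a_inv[OF aR] a uminus_free_alg[OF aR] by simp
      ultimately show "\<ominus>\<^bsub>UE L\<^esub> x \<in> C i" by (auto simp: C_def)
      fix y assume "y \<in> C i"
      then obtain b where b: "b \<in> J i" "y = ?I +>\<^bsub>?R\<^esub> b" by (auto simp: C_def)
      have bR: "b \<in> carrier ?R" using b JR by blast
      have "a + b \<in> J i"
        using a b add[of i "act a" "act b"] keys_add[of a b] by (auto simp: J_def act_add[abs_def])
      moreover have "x \<oplus>\<^bsub>UE L\<^esub> y = ?I +>\<^bsub>?R\<^esub> (a + b)"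
        using h.hom_add[OF aR bR] a b by simp
      ultimately show "x \<oplus>\<^bsub>UE L\<^esub> y \<in> C i" by (auto simp: C_def)
    qed
    show "\<forall>x\<in>C i. \<forall>y\<in>carrier (UE L). x \<otimes>\<^bsub>UE L\<^esub> y \<in> C i"
    proof (intro ballI)
      fix x y assume "x \<in> C i" and y: "y \<in> carrier (UE L)"
      then obtain a where a: "a \<in> J i" "x = ?I +>\<^bsub>?R\<^esub> a" by (auto simp: C_def)
      have aR: "a \<in> carrier ?R" using a JR by blast
      from y obtain b where b: "b \<in> carrier ?R" "y = ?I +>\<^bsub>?R\<^esub> b"
        unfolding UE_def FactRing_def A_RCOSETS_def' by auto
      have "act (fa_mult a b) = (\<lambda>v. act a (act b v))" using act_mult[OF aR b(1)] by auto
      then have "fa_mult a b \<in> J i"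
        using a comp[OF b(1), of i "act a"] m_closed[OF aR b(1)] by (simp add: J_def)
      moreover have "x \<otimes>\<^bsub>UE L\<^esub> y = ?I +>\<^bsub>?R\<^esub> (fa_mult a b)"
        using h.hom_mult[OF aR b(1)] a b by simp
      ultimately show "x \<otimes>\<^bsub>UE L\<^esub> y \<in> C i" by (auto simp: C_def)
    qed
  qed
  have "C i \<subseteq> C (Suc i)" for i
    unfolding C_def J_def using mono by blast
  with ideal assms(1) obtain N where N: "\<And>m. m \<ge> N \<Longrightarrow> C m = C N"
    unfolding right_noetherian_def by meson
  have "Q N (act a)" if "m \<ge> N" "a \<in> carrier ?R" "Q m (act a)" for m a
  proof -
    have "a \<in> J m" using that by (simp add: J_def)
    then have "?I +>\<^bsub>?R\<^esub> a \<in> C N" using N[OF that(1)] by (auto simp: C_def)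
    then obtain b where "b \<in> J N" "?I +>\<^bsub>?R\<^esub> a = ?I +>\<^bsub>?R\<^esub> b" by (auto simp: C_def)
    with J_I[OF that(2)] have "a \<in> J N" by blast
    then show ?thesis by (simp add: J_def)
  qed
  then show ?thesis by blast
qed

end

subsection \<open>Partial derivatives of polynomials\<close>

definition var :: "nat \<Rightarrow> 'k::field mpoly" where
  "var i = Poly_Mapping.single (Poly_Mapping.single i 1) 1"

definition Cst :: "'k::field \<Rightarrow> 'k mpoly" where
  "Cst c = Poly_Mapping.single 0 c"

lemma pscale_conv_mult: "pscale c p = Cst c * p"
  unfolding pscale_def Cst_def by (rule mult_map_scale_conv_mult)

lemma Cst_simps: "Cst 0 = 0" "Cst 1 = 1" "Cst (a + b) = Cst a + Cst b" "Cst (a * b) = Cst a * Cst b"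
    "Cst (- a) = - Cst a"
  by (simp_all add: Cst_def single_add mult_single single_uminus)

lemma Cst_of_nat: "Cst (of_nat k) = of_nat k"
  by (simp add: Cst_def)

lemma lookup_Cst_mult: "Poly_Mapping.lookup (Cst c * p) m = c * Poly_Mapping.lookup p m"
  by (cases "c = 0") (simp_all add: pscale_conv_mult[symmetric] pscale_def map.rep_eq when_def Cst_simps)

lemma mpoly_induct [case_names const var add mult]:
  fixes p :: "'k::field mpoly"
  assumes const: "\<And>c. P (Cst c)" and var: "\<And>i. P (var i)"
    and add: "\<And>p q. P p \<Longrightarrow> P q \<Longrightarrow> P (p + q)"
    and mult: "\<And>p q. P p \<Longrightarrow> P q \<Longrightarrow> P (p * q)"
  shows "P p"
proof (induction p rule: poly_mapping_single_induct)
  case zero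
  show ?case using const[of 0] by (simp add: Cst_simps)
next
  case (single m a)
  have 1: "P 1" using const[of 1] by (simp add: Cst_simps)
  have "P (Poly_Mapping.single m 1)"
  proof (induction m rule: poly_mapping_single_induct)
    case (single i k)
    show ?case
    proof (induction k)
      case (Suc k)
      have "Poly_Mapping.single (Poly_Mapping.single i (Suc k)) 1
          = var i * Poly_Mapping.single (Poly_Mapping.single i k) (1::'k)"
        by (simp add: var_def mult_single single_add[symmetric])
      then show ?case using mult[OF var Suc] by simp
    qed (use 1 in simp)
  next
    case (add p q)
    have "Poly_Mapping.single (p + q) 1 = Poly_Mapping.single p 1 * Poly_Mapping.single q (1::'k)"
      by (simp add: mult_single)
    then show ?case using mult[OF add] by simp
  qed (use 1 in simp)
  moreover have "Poly_Mapping.single m a = Cst a * Poly_Mapping.single m 1"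
    by (simp add: Cst_def mult_single)
  ultimately show ?case using mult[OF const] by simp
qed (rule add)

definition der :: "('k::field mpoly \<Rightarrow> 'k mpoly) \<Rightarrow> bool" where
  "der D \<longleftrightarrow> (\<forall>p q. D (p + q) = D p + D q) \<and> (\<forall>p q. D (p * q) = p * D q + D p * q) \<and> (\<forall>c. D (Cst c) = 0)"

lemma derD:
  assumes "der D"
  shows "D (p + q) = D p + D q" "D (p * q) = p * D q + D p * q" "D (Cst c) = 0"
    "D 0 = 0" "D 1 = 0" "D (Cst c * p) = Cst c * D p" "D (- p) = - D p" "D (p - q) = D p - D q"
    "D (of_nat k) = 0" "D (of_nat k * p) = of_nat k * D p" "D (numeral w) = 0"
proof -
  show *: "D (p + q) = D p + D q" "D (p * q) = p * D q + D p * q" "D (Cst c) = 0" for p q c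
    using assms by (auto simp: der_def)
  show 0: "D 0 = 0" "D 1 = 0" using *(3)[of 0] *(3)[of 1] by (simp_all add: Cst_simps)
  show "D (Cst c * p) = Cst c * D p" by (simp add: *)
  have "D (- p) + D p = 0" for p using *(1)[of "- p" p] 0 by simp
  then show m: "D (- p) = - D p" for p by (simp add: eq_neg_iff_add_eq_0)
  show "D (p - q) = D p - D q" using *(1)[of p "- q"] m by simp
  show k: "D (of_nat k) = 0" for k using *(3)[of "of_nat k"] by (simp add: Cst_of_nat)
  show "D (of_nat k * p) = of_nat k * D p" by (simp add: *(2) k)
  show "D (numeral w) = 0" using k[of "numeral w"] by simp
qed

lemma der_sum_arg: "der D \<Longrightarrow> D (\<Sum>i\<in>S. h i) = (\<Sum>i\<in>S. D (h i))"
  by (induction S rule: infinite_finite_induct) (simp_all add: derD)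

lemma der_eqI:
  assumes "der D" "der E" "\<And>i. D (var i) = E (var i)"
  shows "D p = E p"
  by (induction p rule: mpoly_induct) (use assms in \<open>simp_all add: derD\<close>)

lemma der_add: "der D \<Longrightarrow> der E \<Longrightarrow> der (\<lambda>p. D p + E p)"
  by (simp add: der_def algebra_simps)

lemma der_diff: "der D \<Longrightarrow> der E \<Longrightarrow> der (\<lambda>p. D p - E p)"
  by (simp add: der_def algebra_simps)

lemma der_mult: "der D \<Longrightarrow> der (\<lambda>p. a * D p)"
  by (simp add: der_def algebra_simps)

lemma der_zero: "der (\<lambda>p. 0)"
  by (simp add: der_def)

lemma der_sum: "(\<And>i. i \<in> S \<Longrightarrow> der (D i)) \<Longrightarrow> der (\<lambda>p. \<Sum>i\<in>S. D i p)"
  by (induction S rule: infinite_finite_induct) (simp_all add: der_zero der_add)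

lemma der_commutator: "der D \<Longrightarrow> der E \<Longrightarrow> der (\<lambda>p. D (E p) - E (D p))"
  by (simp add: der_def algebra_simps derD(4))

definition pd :: "nat \<Rightarrow> 'k::field mpoly \<Rightarrow> 'k mpoly" where
  "pd i p = (\<Sum>m\<in>Poly_Mapping.keys p. Poly_Mapping.single (m - Poly_Mapping.single i 1)
      (Poly_Mapping.lookup p m * of_nat (Poly_Mapping.lookup m i)))"

lemma pd_single: "pd i (Poly_Mapping.single m a)
    = Poly_Mapping.single (m - Poly_Mapping.single i 1) (a * of_nat (Poly_Mapping.lookup m i))"
  unfolding pd_def by (rule sum_keys_single) simp

lemma pd_add: "pd i (p + q) = pd i p + pd i q"
  unfolding pd_def by (rule sum_keys_add) (simp_all add: distrib_right single_add)

lemma pd_mult: "pd i (p * q) = p * pd i q + pd i p * q"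
proof (induction p rule: poly_mapping_single_induct)
  case zero
  show ?case by (simp add: pd_def)
next
  case (single m a)
  show ?case
  proof (induction q rule: poly_mapping_single_induct)
    case zero
    show ?case by (simp add: pd_def)
  next
    case (single m' b)
    let ?e = "Poly_Mapping.single i (1::nat)"
    \<comment> \<open>Subtraction of exponents is truncated, so it commutes with addition only if
      the exponent at \<open>i\<close> is positive. Otherwise the coefficient
      \<open>of_nat 0\<close> removes the term.\<close>
    have *: "m + m' - ?e = m + (m' - ?e)" if "Poly_Mapping.lookup m' i > 0" for m m' :: "nat \<Rightarrow>\<^sub>0 nat"
      by (rule poly_mapping_eqI) (use that in \<open>auto simp: lookup_add lookup_minus lookup_single when_def\<close>)
    have 1: "Poly_Mapping.single (m + m' - ?e) (a * b * of_nat (Poly_Mapping.lookup m' i))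
      = Poly_Mapping.single (m + (m' - ?e)) (a * b * of_nat (Poly_Mapping.lookup m' i))"
      using *[of m' m] by (cases "Poly_Mapping.lookup m' i = 0") auto
    have 2: "Poly_Mapping.single (m + m' - ?e) (a * b * of_nat (Poly_Mapping.lookup m i))
      = Poly_Mapping.single (m - ?e + m') (a * b * of_nat (Poly_Mapping.lookup m i))"
      using *[of m m'] by (cases "Poly_Mapping.lookup m i = 0") (auto simp: add.commute)
    have "pd i (Poly_Mapping.single m a * Poly_Mapping.single m' b)
      = Poly_Mapping.single (m + m' - ?e) (a * b * of_nat (Poly_Mapping.lookup m i))
      + Poly_Mapping.single (m + m' - ?e) (a * b * of_nat (Poly_Mapping.lookup m' i))"
      by (simp add: mult_single pd_single lookup_add single_add[symmetric] algebra_simps)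
    then show ?case
      unfolding 1 2 by (simp add: mult_single pd_single ac_simps)
  qed (simp add: pd_add algebra_simps)
qed (simp add: pd_add algebra_simps)

lemma pd_Cst [simp]: "pd i (Cst c) = 0"
  by (simp add: Cst_def pd_single)

lemma pd_var: "pd i (var j) = (if i = j then 1 else 0)"
  by (simp add: var_def pd_single lookup_single when_def)

lemma der_pd: "der (pd i)"
  by (simp add: der_def pd_add pd_mult)

lemmas pd_simps = derD[OF der_pd]

lemma pd_commute: "pd i (pd j p) = pd j (pd i p)"
  using der_eqI[OF der_commutator[OF der_pd[of i] der_pd[of j]] der_zero, of p]
  by (simp add: pd_var pd_simps)

subsection \<open>The prolonged Hamiltonian action\<close>

text \<open>The variables \<open>var i\<close> for \<open>i < 2n\<close> are the coordinates of the cotangent space (positions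
  for \<open>i < n\<close>, momenta for \<open>n \<le> i < 2n\<close>), and \<open>var (2n + i)\<close> is the coordinate on the tangent
  directions of the cotangent space that corresponds to \<open>var i\<close>.\<close>

definition base :: "nat \<Rightarrow> 'k::field mpoly set" where
  "base n = {p. \<forall>i\<ge>2*n. pd i p = 0}"

text \<open>The Poisson bracket, with the sign for which \<open>pb n a\<close> moves positions by
  the momentum derivatives of \<open>a\<close>. On symbols it then extends the original
  derivation.\<close>

definition pb :: "nat \<Rightarrow> 'k::field mpoly \<Rightarrow> 'k mpoly \<Rightarrow> 'k mpoly" where
  "pb n a b = (\<Sum>m<n. pd (n+m) a * pd m b - pd m a * pd (n+m) b)"

text \<open>The Hamiltonian coefficients of \<open>a\<close>, applied along the tangent coordinates
  instead of the phase space coordinates.\<close>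

definition pbw :: "nat \<Rightarrow> 'k::field mpoly \<Rightarrow> 'k mpoly \<Rightarrow> 'k mpoly" where
  "pbw n a b = (\<Sum>m<n. pd (n+m) a * pd (2*n+m) b - pd m a * pd (2*n+(n+m)) b)"

definition tang :: "nat \<Rightarrow> 'k::field mpoly \<Rightarrow> 'k mpoly" where
  "tang n a = (\<Sum>i<2*n. var (2*n+i) * pd i a)"

text \<open>The complete lift of the Hamiltonian field of \<open>f\<close> to the tangent bundle. A
  tangent vector moves by the linearised flow; its coefficients are the derivatives along w of those
  of \<open>f\<close>, that is, the Hamiltonian coefficients of \<open>tang n f\<close>.\<close>

definition hat :: "nat \<Rightarrow> 'k::field mpoly \<Rightarrow> 'k mpoly \<Rightarrow> 'k mpoly" where
  "hat n f p = pb n f p + pbw n (tang n f) p"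

definition cub :: "nat \<Rightarrow> 'k::field mpoly \<Rightarrow> 'k mpoly" where
  "cub n f = tang n (tang n (tang n f))"

lemma base_closed:
  "p \<in> base n \<Longrightarrow> q \<in> base n \<Longrightarrow> p + q \<in> base n"
  "p \<in> base n \<Longrightarrow> q \<in> base n \<Longrightarrow> p - q \<in> base n"
  "p \<in> base n \<Longrightarrow> q \<in> base n \<Longrightarrow> p * q \<in> base n"
  "p \<in> base n \<Longrightarrow> pd j p \<in> base n" "Cst c \<in> base n" "0 \<in> base n" "j < 2*n \<Longrightarrow> var j \<in> base n"
     apply (simp_all add: base_def pd_simps pd_var)
  apply (simp add: pd_commute[of _ j] pd_simps)
  done

lemma base_sum: "(\<And>i. i \<in> S \<Longrightarrow> h i \<in> base n) \<Longrightarrow> (\<Sum>i\<in>S. h i) \<in> base n"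
  by (induction S rule: infinite_finite_induct) (simp_all add: base_closed)

lemma base_pb: "f \<in> base n \<Longrightarrow> g \<in> base n \<Longrightarrow> pb n f g \<in> base n"
  unfolding pb_def by (intro base_sum base_closed)

lemma der_pb: "der (pb n a)"
  unfolding pb_def by (intro der_sum der_diff der_mult der_pd)

lemma der_pbw: "der (pbw n a)"
  unfolding pbw_def by (intro der_sum der_diff der_mult der_pd)

lemma der_tang: "der (tang n)"
  unfolding tang_def by (intro der_sum der_mult der_pd)

lemma der_hat: "der (hat n f)"
  unfolding hat_def by (intro der_add der_pb der_pbw)

lemmas tang_simps = derD[OF der_tang]
lemmas pb_simps = derD[OF der_pb]
lemmas hat_simps = derD[OF der_hat]

lemma pb_antisym: "pb n a b = - pb n b a"
  unfolding pb_def sum_negf[symmetric] by (intro sum.cong) (auto simp: algebra_simps)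

lemma pb_add_left: "pb n (a + b) c = pb n a c + pb n b c"
  unfolding pb_def sum.distrib[symmetric] by (intro sum.cong) (auto simp: algebra_simps pd_simps)

lemma pbw_add_left: "pbw n (a + b) c = pbw n a c + pbw n b c"
  unfolding pbw_def sum.distrib[symmetric] by (intro sum.cong) (auto simp: algebra_simps pd_simps)

lemma pb_Cst_left: "pb n (Cst c * a) b = Cst c * pb n a b"
  unfolding pb_def sum_distrib_left by (intro sum.cong) (auto simp: algebra_simps pd_simps)

lemma pbw_Cst_left: "pbw n (Cst c * a) b = Cst c * pbw n a b"
  unfolding pbw_def sum_distrib_left by (intro sum.cong) (auto simp: algebra_simps pd_simps)

lemma hat_add_left: "hat n (f + g) p = hat n f p + hat n g p"
  by (simp add: hat_def pb_add_left pbw_add_left tang_simps)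

lemma hat_Cst_left: "hat n (Cst c * f) p = Cst c * hat n f p"
  by (simp add: hat_def pb_Cst_left pbw_Cst_left tang_simps distrib_left)

lemma pd_pb: "pd i (pb n a b) = pb n (pd i a) b + pb n a (pd i b)"
  unfolding pb_def sum.distrib[symmetric] der_sum_arg[OF der_pd]
  by (intro sum.cong refl) (simp add: pd_simps pd_commute[of i] algebra_simps)

lemma tang_pd: "i < 2*n \<Longrightarrow> tang n (pd i a) = pd i (tang n a)"
  unfolding tang_def der_sum_arg[OF der_pd]
  by (intro sum.cong refl) (simp add: pd_simps pd_var pd_commute[of i])

lemma pdw_tang:
  assumes "i < 2*n"
  shows "pd (2*n+i) (tang n a) = pd i a + tang n (pd (2*n+i) a)"
proof -
  have "pd (2*n+i) (tang n a) = (\<Sum>j<2*n. (if j = i then pd j a else 0) + var (2*n+j) * pd j (pd (2*n+i) a))"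
    unfolding tang_def der_sum_arg[OF der_pd]
    by (intro sum.cong refl) (auto simp: pd_simps pd_var pd_commute[of "2*n+i"])
  also have "\<dots> = pd i a + tang n (pd (2*n+i) a)"
    using assms unfolding sum.distrib by (simp add: tang_def)
  finally show ?thesis .
qed

lemma tang_pb: "tang n (pb n a b) = pb n (tang n a) b + pb n a (tang n b)"
  unfolding pb_def sum.distrib[symmetric] der_sum_arg[OF der_tang]
  by (intro sum.cong refl) (simp add: tang_simps tang_pd algebra_simps)

lemma pbw_base: "b \<in> base n \<Longrightarrow> pbw n a b = 0"
  by (simp add: pbw_def base_def)

lemma hat_base: "b \<in> base n \<Longrightarrow> hat n f b = pb n f b"
  by (simp add: hat_def pbw_base)

text \<open>\<open>tang n b\<close> is linear in the tangent coordinates, and its derivative in the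
  i-th of them is \<open>pd i b\<close>.\<close>

lemma pbw_tang: "b \<in> base n \<Longrightarrow> pbw n a (tang n b) = pb n a b"
  unfolding pbw_def pb_def
proof (intro sum.cong refl)
  fix m assume b: "b \<in> base n" and "m \<in> {..<n}"
  then have "m < 2*n" "n + m < 2*n" by auto
  with pdw_tang[of m n b] pdw_tang[of "n+m" n b] b
  have "pd (2*n+m) (tang n b) = pd m b" "pd (2*n+(n+m)) (tang n b) = pd (n+m) b"
    by (simp_all add: base_def tang_simps)
  then show "pd (n+m) a * pd (2*n+m) (tang n b) - pd m a * pd (2*n+(n+m)) (tang n b)
      = pd (n+m) a * pd m b - pd m a * pd (n+m) b"
    by simp
qed

lemma hat_tang: "b \<in> base n \<Longrightarrow> hat n f (tang n b) = tang n (pb n f b)"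
  by (simp add: hat_def pbw_tang tang_pb add.commute)

lemma pdw_cub:
  assumes "i < 2*n" "g \<in> base n"
  shows "pd (2*n+i) (cub n g) = of_nat 3 * tang n (tang n (pd i g))"
  using assms by (simp add: cub_def pdw_tang base_def tang_simps tang_pd)

lemma pbw_cub:
  assumes "g \<in> base n"
  shows "pbw n a (cub n g) = of_nat 3 * pb n a (tang n (tang n g))"
  unfolding pbw_def pb_def sum_distrib_left
proof (intro sum.cong refl)
  fix m assume "m \<in> {..<n}"
  then have m: "m < 2*n" "n + m < 2*n" by auto
  have "pd (n+m) a * pd (2*n+m) (cub n g) - pd m a * pd (2*n+(n+m)) (cub n g)
      = pd (n+m) a * (of_nat 3 * tang n (tang n (pd m g))) - pd m a * (of_nat 3 * tang n (tang n (pd (n+m) g)))"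
    by (simp only: pdw_cub[OF m(1) assms] pdw_cub[OF m(2) assms])
  then show "pd (n+m) a * pd (2*n+m) (cub n g) - pd m a * pd (2*n+(n+m)) (cub n g)
      = of_nat 3 * (pd (n+m) a * pd m (tang n (tang n g)) - pd m a * pd (n+m) (tang n (tang n g)))"
    using m by (simp only: tang_pd right_diff_distrib mult.left_commute)
qed

text \<open>The cocycle identity. Since \<open>tang n\<close> is a derivation of the Poisson
  bracket, \<open>cub n (pb n f g)\<close> expands with coefficients 1, 3, 3, 1. The first two terms
  are one half of the left side and the last two are the other; the factor 3 comes from the tangent
  part of \<open>hat\<close>.\<close>

lemma hat_cub:
  assumes "f \<in> base n" "g \<in> base n"
  shows "hat n f (cub n g) - hat n g (cub n f) = cub n (pb n f g)"
proof -
  have "hat n f (cub n g) - hat n g (cub n f) = pb n f (cub n g) - pb n g (cub n f)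
     + of_nat 3 * (pb n (tang n f) (tang n (tang n g)) - pb n (tang n g) (tang n (tang n f)))"
    using assms by (simp add: hat_def pbw_cub algebra_simps)
  also have "\<dots> = cub n (pb n f g)"
    by (simp add: cub_def tang_pb tang_simps pb_antisym[of n g] pb_antisym[of n "tang n g"] algebra_simps)
  finally show ?thesis .
qed

lemma pb_var: "j < 2*n \<Longrightarrow> pb n f (var j) = (if j < n then pd (n+j) f else - pd (j-n) f)"
proof -
  assume j: "j < 2*n"
  have *: "pb n f (var j) = (\<Sum>m<n. (if m = j then pd (n+m) f else 0) - (if m = j - n \<and> n \<le> j then pd m f else 0))"
    unfolding pb_def by (intro sum.cong refl) (auto simp: pd_var)
  show ?thesis
    unfolding * sum_subtractf using j by (auto simp: sum.delta)
qed

lemma jacobi_var: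
  assumes "j < 2*n"
  shows "pb n f (pb n g (var j)) - pb n g (pb n f (var j)) = pb n (pb n f g) (var j)"
proof -
  have "pb n f (pd i g) - pb n g (pd i f) = pd i (pb n f g)" for i
    by (simp add: pd_pb pb_antisym[of n g])
  from this[of "n+j"] this[of "j-n"] show ?thesis
    using assms by (simp add: pb_var pb_simps algebra_simps)
qed

text \<open>Both sides are derivations, so it suffices to compare them on variables.\<close>

lemma hat_commutator:
  fixes f g p :: "'k::field mpoly"
  assumes fg: "f \<in> base n" "g \<in> base n"
  shows "hat n f (hat n g p) - hat n g (hat n f p) = hat n (pb n f g) p"
proof (rule der_eqI[OF der_commutator[OF der_hat der_hat] der_hat])
  fix j
  have hv: "hat n f (var j) = pb n f (var j)" if "j < 2*n" for f :: "'k mpoly" and j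
    using that by (simp add: hat_base base_closed)
  \<comment> \<open>A tangent coordinate is \<open>tang n\<close> of a phase space coordinate, and
    the complete lift commutes with \<open>tang n\<close> on base functions.\<close>
  have vw: "hat n f (var (2*n+j)) = tang n (pb n f (var j))" if "j < 2*n" for f :: "'k mpoly" and j
  proof -
    have "tang n (var j) = (\<Sum>i<2*n. if i = j then var (2*n+i) else 0)"
      unfolding tang_def by (intro sum.cong) (auto simp: pd_var)
    then have "tang n (var j) = (var (2*n+j) :: 'k mpoly)" using that by simp
    then show ?thesis using hat_tang[of "var j" n f] that by (simp add: base_closed)
  qed
  have v0: "hat n f (var j) = 0" if "j \<ge> 4*n" for f :: "'k mpoly" and j
    unfolding hat_def pb_def pbw_def using that by (simp add: pd_var sum.neutral)
  have b: "pb n f (var j) \<in> base n" "pb n g (var j) \<in> base n" if "j < 2*n" for j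
    using that fg by (simp_all add: base_pb base_closed)
  \<comment> \<open>Phase space coordinates, tangent coordinates, and the remaining variables, which
    every lift kills.\<close>
  consider "j < 2*n" | i where "j = 2*n+i" "i < 2*n" | "j \<ge> 4*n"
    by (metis add_diff_inverse_nat less_diff_conv2 mult_2 not_le numeral_Bit0 add_mult_distrib leI nat_add_left_cancel_less)
  then show "hat n f (hat n g (var j)) - hat n g (hat n f (var j)) = hat n (pb n f g) (var j)"
  proof cases
    case 1
    then show ?thesis by (simp add: hv b hat_base jacobi_var)
  next
    case 2
    then show ?thesis by (simp add: vw b hat_tang tang_simps(8)[symmetric] jacobi_var)
  next
    case 3
    then show ?thesis by (simp add: v0 hat_simps)
  qed
qed

text \<open>The triple (p, q, r) stands for p + q t + r t^2 modulo t^3, and \<open>f\<close> acts as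
  \<open>hat n f\<close> plus t times multiplication by \<open>cub n f\<close>. Second order is kept
  because the multiplier of interest, a sum of products of two values of \<open>cub n\<close>,
  appears at t^2.\<close>

definition jet_act :: "nat \<Rightarrow> 'k::field mpoly \<Rightarrow> 'k mpoly \<times> 'k mpoly \<times> 'k mpoly
    \<Rightarrow> 'k mpoly \<times> 'k mpoly \<times> 'k mpoly" where
  "jet_act n f v = (case v of (p, q, r) \<Rightarrow>
     (hat n f p, hat n f q + cub n f * p, hat n f r + cub n f * q))"

text \<open>At order t this is the cocycle identity. At order t^2 the extra terms cancel because
  multiplication operators commute.\<close>

lemma jet_act_commutator:
  assumes "f \<in> base n" "g \<in> base n"
  shows "jet_act n (pb n f g) v = jet_act n f (jet_act n g v) - jet_act n g (jet_act n f v)"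
proof (cases v)
  case (fields p q r)
  have h: "hat n (pb n f g) p = hat n f (hat n g p) - hat n g (hat n f p)" for p
    using hat_commutator[OF assms] by simp
  have c: "cub n (pb n f g) = hat n f (cub n g) - hat n g (cub n f)"
    using hat_cub[OF assms] by simp
  show ?thesis
    unfolding fields jet_act_def by (simp add: h c hat_simps algebra_simps)
qed

subsection \<open>Symbols of derivations\<close>

lemma Pn_add: "p \<in> Pn n \<Longrightarrow> q \<in> Pn n \<Longrightarrow> p + q \<in> Pn n"
  unfolding Pn_def using keys_add[of p q] by blast

lemma Pn_mult: "p \<in> Pn n \<Longrightarrow> q \<in> Pn n \<Longrightarrow> p * q \<in> Pn n"
proof -
  assume *: "p \<in> Pn n" "q \<in> Pn n"
  have "i < n" if m: "m \<in> Poly_Mapping.keys (p * q)" and i: "i \<in> Poly_Mapping.keys m" for m i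
  proof -
    obtain a b where "m = a + b" "a \<in> Poly_Mapping.keys p" "b \<in> Poly_Mapping.keys q"
      using m keys_mult[of p q] by blast
    then show ?thesis using * i keys_add[of a b] by (auto simp: Pn_def)
  qed
  then show ?thesis by (auto simp: Pn_def)
qed

lemma Pn_Cst: "Cst c \<in> Pn n"
  by (auto simp: Pn_def Cst_def split: if_splits)

lemma Pn_var: "i < n \<Longrightarrow> var i \<in> Pn n"
  by (auto simp: Pn_def var_def)

lemma Pn_induct [consumes 1, case_names const var add mult]:
  fixes p :: "'k::field mpoly"
  assumes p: "p \<in> Pn n"
    and const: "\<And>c. P (Cst c)" and var: "\<And>i. i < n \<Longrightarrow> P (var i)"
    and add: "\<And>p q. p \<in> Pn n \<Longrightarrow> q \<in> Pn n \<Longrightarrow> P p \<Longrightarrow> P q \<Longrightarrow> P (p + q)"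
    and mult: "\<And>p q. p \<in> Pn n \<Longrightarrow> q \<in> Pn n \<Longrightarrow> P p \<Longrightarrow> P q \<Longrightarrow> P (p * q)"
  shows "P p"
proof -
  define Q where "Q p \<longleftrightarrow> p \<in> Pn n \<and> P p" for p
  have Q: "Q (Cst c)" "i < n \<Longrightarrow> Q (var i)" "Q p \<Longrightarrow> Q q \<Longrightarrow> Q (p + q)" "Q p \<Longrightarrow> Q q \<Longrightarrow> Q (p * q)" for c i p q
    by (auto simp: Q_def Pn_Cst Pn_var Pn_add Pn_mult const var add mult)
  have Q01: "Q 0" "Q 1" using Q(1)[of 0] Q(1)[of 1] by (simp_all add: Cst_simps)
  have mono: "Q (Poly_Mapping.single m 1)" if "Poly_Mapping.keys m \<subseteq> {..<n}" for m
  proof -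
    have sgl: "Q (Poly_Mapping.single (Poly_Mapping.single i k) 1)" if "i < n" for i k
    proof (induction k)
      case (Suc k)
      have "Poly_Mapping.single (Poly_Mapping.single i (Suc k)) 1
          = var i * Poly_Mapping.single (Poly_Mapping.single i k) (1::'k)"
        by (simp add: var_def mult_single single_add[symmetric])
      then show ?case using Q(4)[OF Q(2)[OF that] Suc] by simp
    qed (use Q01 in simp)
    have "Q (Poly_Mapping.single (\<Sum>i\<in>S. Poly_Mapping.single i (Poly_Mapping.lookup m i)) 1)"
      if "finite S" "S \<subseteq> {..<n}" for S
      using that
    proof (induction S)
      case (insert i S)
      then have "Q (Poly_Mapping.single (Poly_Mapping.single i (Poly_Mapping.lookup m i)) 1
          * Poly_Mapping.single (\<Sum>i\<in>S. Poly_Mapping.single i (Poly_Mapping.lookup m i)) 1)"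
        by (intro Q(4) sgl) auto
      then show ?case using insert by (simp add: mult_single)
    qed (use Q01 in simp)
    from this[OF _ that] show ?thesis using poly_mapping_sum_single[of m] by simp
  qed
  have "Q (\<Sum>m\<in>S. Poly_Mapping.single m (Poly_Mapping.lookup p m))"
    if "finite S" "S \<subseteq> Poly_Mapping.keys p" for S
    using that
  proof (induction S)
    case (insert m S)
    have "Poly_Mapping.single m (Poly_Mapping.lookup p m) = Cst (Poly_Mapping.lookup p m) * Poly_Mapping.single m 1"
      by (simp add: Cst_def mult_single)
    moreover have "Poly_Mapping.keys m \<subseteq> {..<n}" using p insert by (auto simp: Pn_def)
    ultimately show ?case using insert Q(3)[OF Q(4)[OF Q(1) mono]] by simp
  qed (use Q01 in simp)
  from this[of "Poly_Mapping.keys p"] show ?thesis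
    using poly_mapping_sum_single[of p] by (simp add: Q_def)
qed

lemma pd_Pn_eq_0: "p \<in> Pn n \<Longrightarrow> i \<ge> n \<Longrightarrow> pd i p = 0"
  by (induction p rule: Pn_induct) (auto simp: pd_simps pd_var)

lemma Pn_subset_base: "p \<in> Pn n \<Longrightarrow> p \<in> base n"
  by (auto simp: base_def pd_Pn_eq_0)

lemma WnD:
  assumes "D \<in> Wn n"
  shows "p \<notin> Pn n \<Longrightarrow> D p = 0" "p \<in> Pn n \<Longrightarrow> D p \<in> Pn n"
    "p \<in> Pn n \<Longrightarrow> q \<in> Pn n \<Longrightarrow> D (p + q) = D p + D q"
    "p \<in> Pn n \<Longrightarrow> q \<in> Pn n \<Longrightarrow> D (p * q) = p * D q + D p * q" "D (Cst c) = 0"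
proof -
  show *: "p \<notin> Pn n \<Longrightarrow> D p = 0" "p \<in> Pn n \<Longrightarrow> D p \<in> Pn n"
    "p \<in> Pn n \<Longrightarrow> q \<in> Pn n \<Longrightarrow> D (p + q) = D p + D q"
    "p \<in> Pn n \<Longrightarrow> q \<in> Pn n \<Longrightarrow> D (p * q) = p * D q + D p * q" for p q
    using assms by (auto simp: Wn_def derivation_def)
  have 1: "(1 :: 'a mpoly) \<in> Pn n" using Pn_Cst[of 1 n] by (simp add: Cst_simps)
  then have "D 1 = D 1 + D 1" using *(4)[of 1 1] by (simp only: mult_1_left mult_1_right)
  then have "D 1 = 0" by (metis add_cancel_left_right)
  moreover have "D (pscale c 1) = pscale c (D 1)"
    using assms 1 by (auto simp: Wn_def derivation_def)
  ultimately show "D (Cst c) = 0" by (simp add: pscale_conv_mult)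
qed

lemma Wn_expand:
  assumes D: "D \<in> Wn n" and p: "p \<in> Pn n"
  shows "D p = (\<Sum>j<n. D (var j) * pd j p)"
  using p
proof (induction p rule: Pn_induct)
  case (var i)
  have "(\<Sum>j<n. D (var j) * pd j (var i)) = (\<Sum>j<n. if j = i then D (var j) else 0)"
    by (intro sum.cong) (auto simp: pd_var)
  then show ?case using var by simp
next
  case (mult p q)
  then show ?case
    by (simp add: WnD[OF D] pd_simps sum_distrib_left sum_distrib_right sum.distrib[symmetric] algebra_simps)
qed (use D in \<open>simp_all add: WnD pd_simps sum.distrib distrib_left\<close>)

definition symb :: "nat \<Rightarrow> ('k::field mpoly \<Rightarrow> 'k mpoly) \<Rightarrow> 'k mpoly" where
  "symb n D = (\<Sum>m<n. var (n+m) * D (var m))"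

lemma symb_base:
  assumes "D \<in> Wn n"
  shows "symb n D \<in> base n"
  unfolding symb_def
  using Pn_subset_base[OF WnD(2)[OF assms Pn_var]] by (auto intro!: base_sum base_closed)

lemma symb_add: "symb n (D + E) = symb n D + symb n E"
  by (simp add: symb_def distrib_left sum.distrib)

lemma symb_dscale: "symb n (dscale c D) = Cst c * symb n D"
  by (simp add: symb_def dscale_def pscale_conv_mult sum_distrib_left mult.left_commute)

lemma pd_symb_fibre:
  assumes D: "D \<in> Wn n" and m: "m < n"
  shows "pd (n+m) (symb n D) = D (var m)"
proof -
  have "pd (n+m) (symb n D) = (\<Sum>j<n. if j = m then D (var j) else 0)"
    unfolding symb_def der_sum_arg[OF der_pd]
    by (intro sum.cong refl) (auto simp: pd_simps pd_var pd_Pn_eq_0[OF WnD(2)[OF D Pn_var]])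
  then show ?thesis using m by simp
qed

lemma pd_symb_base: "m < n \<Longrightarrow> pd m (symb n D) = (\<Sum>j<n. var (n+j) * pd m (D (var j)))"
  unfolding symb_def der_sum_arg[OF der_pd] by (intro sum.cong refl) (auto simp: pd_simps pd_var)

text \<open>The momentum derivatives of a symbol are the coefficients of the derivation, so the
  bracket of two symbols is again linear in the momenta, with the commutator's coefficients. This
  turns \<open>jet_act\<close> into a representation of \<open>L\<close>.\<close>

lemma symb_lie_bracket:
  assumes D: "D \<in> Wn n" and E: "E \<in> Wn n"
  shows "symb n (lie_bracket D E) = pb n (symb n D) (symb n E)"
proof -
  have "pb n (symb n D) (symb n E) = (\<Sum>m<n. \<Sum>j<n. var (n+j) * (D (var m) * pd m (E (var j))))
      - (\<Sum>m<n. \<Sum>j<n. var (n+j) * (E (var m) * pd m (D (var j))))"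
    unfolding pb_def sum_subtractf
    by (simp add: pd_symb_fibre D E pd_symb_base sum_distrib_left sum_distrib_right mult_ac)
  also have "\<dots> = (\<Sum>j<n. var (n+j) * (\<Sum>m<n. D (var m) * pd m (E (var j))))
      - (\<Sum>j<n. var (n+j) * (\<Sum>m<n. E (var m) * pd m (D (var j))))"
    unfolding sum_distrib_left by (intro arg_cong2[where f = "(-)"] sum.swap)
  also have "\<dots> = symb n (lie_bracket D E)"
    unfolding symb_def lie_bracket_def sum_subtractf[symmetric] right_diff_distrib
    by (intro sum.cong refl)
       (simp add: Wn_expand[OF D WnD(2)[OF E Pn_var]] Wn_expand[OF E WnD(2)[OF D Pn_var]])
  finally show ?thesis by simp
qed

lemma symb_eq_0:
  assumes D: "D \<in> Wn n" and "symb n D = 0"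
  shows "D = 0"
proof
  fix p
  have "D (var m) = 0" if "m < n" for m
    using pd_symb_fibre[OF D that] assms(2) by (simp add: pd_simps)
  then have "D p = 0" if "p \<in> Pn n" using Wn_expand[OF D that] by simp
  then show "D p = 0 p" using WnD(1)[OF D] by (cases "p \<in> Pn n") auto
qed

interpretation dvs: vector_space "dscale :: 'k::field \<Rightarrow> ('k mpoly \<Rightarrow> 'k mpoly) \<Rightarrow> _"
  by unfold_locales
     (auto simp: dscale_def pscale_conv_mult Cst_simps algebra_simps fun_eq_iff)

subsection \<open>The noetherian condition\<close>

text \<open>Degrees are bounded in each variable separately. For \<open>b\<close> of finite support
  this is a finite-dimensional space, and the spaces \<open>Bdd (box N)\<close> exhaust all
  polynomials.\<close>

definition Bdd :: "(nat \<Rightarrow> nat) \<Rightarrow> 'k::field mpoly set" where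
  "Bdd b = {p. \<forall>m\<in>Poly_Mapping.keys p. \<forall>i. Poly_Mapping.lookup m i \<le> b i}"

abbreviation box :: "nat \<Rightarrow> nat \<Rightarrow> nat" where
  "box N \<equiv> (\<lambda>i. if i < N then N else 0)"

lemma Bdd_add: "p \<in> Bdd b \<Longrightarrow> q \<in> Bdd b \<Longrightarrow> p + q \<in> Bdd b"
  unfolding Bdd_def using keys_add[of p q] by blast

lemma Bdd_uminus: "p \<in> Bdd b \<Longrightarrow> - p \<in> Bdd b"
  by (simp add: Bdd_def)

lemma Bdd_zero: "0 \<in> Bdd b"
  by (simp add: Bdd_def)

lemma Bdd_mono: "p \<in> Bdd b \<Longrightarrow> (\<And>i. b i \<le> b' i) \<Longrightarrow> p \<in> Bdd b'"
  unfolding Bdd_def using order_trans by blast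

lemma Bdd_mult: "p \<in> Bdd b \<Longrightarrow> q \<in> Bdd b' \<Longrightarrow> p * q \<in> Bdd (\<lambda>i. b i + b' i)"
proof -
  assume *: "p \<in> Bdd b" "q \<in> Bdd b'"
  have "Poly_Mapping.lookup m i \<le> b i + b' i" if m: "m \<in> Poly_Mapping.keys (p * q)" for m i
  proof -
    obtain s t where "m = s + t" "s \<in> Poly_Mapping.keys p" "t \<in> Poly_Mapping.keys q"
      using m keys_mult[of p q] by blast
    then show ?thesis using * by (auto simp: Bdd_def lookup_add intro: add_mono)
  qed
  then show ?thesis by (auto simp: Bdd_def)
qed

lemma Bdd_Cst: "Cst c \<in> Bdd b"
  by (auto simp: Bdd_def Cst_def split: if_splits)

lemma Bdd_Cst_mult: "p \<in> Bdd b \<Longrightarrow> Cst c * p \<in> Bdd b"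
  using Bdd_mult[OF Bdd_Cst[of c "\<lambda>_. 0"]] by auto

lemma Bdd_diff: "p \<in> Bdd b \<Longrightarrow> q \<in> Bdd b \<Longrightarrow> p - q \<in> Bdd b"
  using Bdd_add[OF _ Bdd_uminus, of p b q] by simp

lemma Bdd_sum: "(\<And>i. i \<in> S \<Longrightarrow> h i \<in> Bdd b) \<Longrightarrow> (\<Sum>i\<in>S. h i) \<in> Bdd b"
  by (induction S rule: infinite_finite_induct) (simp_all add: Bdd_zero Bdd_add)

lemma Bdd_box_exists:
  fixes p :: "'k::field mpoly"
  obtains N where "p \<in> Bdd (box N)"
proof (induction p arbitrary: thesis rule: mpoly_induct)
  case (const c)
  show ?case by (rule const[of 0]) (simp add: Bdd_Cst)
next
  case (var i)
  show ?case by (rule var[of "Suc i"]) (auto simp: Bdd_def var_def lookup_single when_def)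
next
  case (add p q)
  obtain M N where "p \<in> Bdd (box M)" "q \<in> Bdd (box N)" using add.IH by metis
  then show ?case
    by (intro add.prems[of "max M N"] Bdd_add; elim Bdd_mono) auto
next
  case (mult p q)
  obtain M N where "p \<in> Bdd (box M)" "q \<in> Bdd (box N)" using mult.IH by metis
  from Bdd_mult[OF this] show ?case
    by (intro mult.prems[of "M + N"]; elim Bdd_mono) auto
qed

section \<open>Multipliers realised by the enveloping algebra\<close>

definition sc3 :: "'k::field \<Rightarrow> 'k mpoly \<times> 'k mpoly \<times> 'k mpoly \<Rightarrow> 'k mpoly \<times> 'k mpoly \<times> 'k mpoly" where
  "sc3 c v = (case v of (p, q, r) \<Rightarrow> (Cst c * p, Cst c * q, Cst c * r))"

lemma sc3_Pair [simp]: "sc3 c (p, q, r) = (Cst c * p, Cst c * q, Cst c * r)"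
  by (simp add: sc3_def)

lemma fst_sc3: "fst (sc3 c v) = Cst c * fst v" and snd_sc3: "snd (snd (sc3 c v)) = Cst c * snd (snd v)"
  by (cases v; simp)+

lemma lie_rep_jet_act:
  assumes "lie_subalgebra_Wn n L"
  shows "lie_rep sc3 L (\<lambda>D. jet_act n (symb n D))"
proof -
  have L: "D \<in> L \<Longrightarrow> D \<in> Wn n" "module.subspace dscale L" "D \<in> L \<Longrightarrow> E \<in> L \<Longrightarrow> lie_bracket D E \<in> L" for D E
    using assms by (auto simp: lie_subalgebra_Wn_def)
  have cub: "cub n (f + g) = cub n f + cub n g" "cub n (Cst c * f) = Cst c * cub n f"
    for f g :: "'a mpoly" and c
    by (simp_all add: cub_def tang_simps)
  show ?thesis
  proof
    fix x y :: "'a mpoly \<Rightarrow> 'a mpoly" and c v w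
    assume x: "x \<in> L"
    show "jet_act n (symb n x) (v + w) = jet_act n (symb n x) v + jet_act n (symb n x) w"
      by (cases v; cases w) (simp add: jet_act_def hat_simps algebra_simps)
    show "jet_act n (symb n x) (sc3 c v) = sc3 c (jet_act n (symb n x) v)"
      by (cases v) (simp add: jet_act_def sc3_def hat_simps algebra_simps)
    show "jet_act n (symb n (dscale c x)) v = sc3 c (jet_act n (symb n x) v)"
      by (cases v) (simp add: jet_act_def sc3_def symb_dscale hat_Cst_left cub algebra_simps)
    show "dscale c x \<in> L" using L x dvs.subspace_scale by blast
    assume y: "y \<in> L"
    show "x + y \<in> L" using L x y dvs.subspace_add by blast
    show "lie_bracket x y \<in> L" using L x y by blast
    show "jet_act n (symb n (x + y)) v = jet_act n (symb n x) v + jet_act n (symb n y) v"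
      by (cases v) (simp add: jet_act_def symb_add hat_add_left cub algebra_simps)
    show "jet_act n (symb n (lie_bracket x y)) v
        = jet_act n (symb n x) (jet_act n (symb n y) v) - jet_act n (symb n y) (jet_act n (symb n x) v)"
      using L(1)[OF x] L(1)[OF y] by (simp add: symb_lie_bracket jet_act_commutator symb_base)
  qed (auto simp: sc3_def Cst_simps algebra_simps split: prod.splits)
qed

text \<open>An element acting as multiplication by \<psi> at second order sends (1, 0, 0) to (0, 0,
  \<psi>). Filtering such elements by the box containing this value gives an increasing chain of
  right ideals, so a single box works for all of them.\<close>

lemma noetherian_multiplier_bound:
  fixes L :: "('k::field mpoly \<Rightarrow> 'k mpoly) set"
  assumes L: "lie_subalgebra_Wn n L" and "right_noetherian (UE L)"
  obtains N where "\<And>a \<psi>. a \<in> carrier (free_alg L) \<Longrightarrow>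
      (\<And>p q r. lie_rep.act sc3 (\<lambda>D. jet_act n (symb n D)) a (p, q, r) = (0, 0, \<psi> * p)) \<Longrightarrow> \<psi> \<in> Bdd (box N)"
proof -
  interpret lie_rep sc3 L "\<lambda>D. jet_act n (symb n D)" by (rule lie_rep_jet_act[OF L])
  \<comment> \<open>Besides the bound on the value at (1, 0, 0), the condition demands that
    \<open>F\<close> depends only on the leading component and lands in the top order. This is what
    makes it stable under precomposition.\<close>
  define Q :: "nat \<Rightarrow> ('k mpoly \<times> 'k mpoly \<times> 'k mpoly \<Rightarrow> 'k mpoly \<times> 'k mpoly \<times> 'k mpoly) \<Rightarrow> bool"
    where "Q i F \<longleftrightarrow> (\<forall>v w. F (v + w) = F v + F w) \<and> (\<forall>c v. F (sc3 c v) = sc3 c (F v))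
      \<and> (\<forall>v. \<exists>r. F v = (0, 0, r)) \<and> (\<forall>q r. F (0, q, r) = 0) \<and> snd (snd (F (1, 0, 0))) \<in> Bdd (box i)" for i F
  have fst0: "fst (act b (0, q, r)) = 0" if "b \<in> carrier (free_alg L)" for b q r
  proof -
    have "fst (foldr (\<lambda>D. jet_act n (symb n D)) u (0, q, r)) = 0" for u
      by (induction u) (auto simp: jet_act_def hat_simps split: prod.splits)
    then have "fst (sc3 c (foldr (\<lambda>D. jet_act n (symb n D)) u (0, q, r))) = 0" for c u
      by (simp add: fst_sc3)
    moreover have "fst (\<Sum>u\<in>S. h u) = (\<Sum>u\<in>S. fst (h u :: 'k mpoly \<times> 'k mpoly \<times> 'k mpoly))"
      for S :: "('k mpoly \<Rightarrow> 'k mpoly) list set" and h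
      by (induction S rule: infinite_finite_induct) auto
    ultimately show ?thesis by (simp add: act_def)
  qed
  \<comment> \<open>The undeformed action kills constants, so only the empty word contributes to the
    leading component, and that contribution is constant.\<close>
  have fst1: "\<exists>c. fst (act b (1, 0, 0)) = Cst c" for b
  proof (induction b rule: poly_mapping_single_induct)
    case (single u a)
    have "\<exists>c. fst (foldr (\<lambda>D. jet_act n (symb n D)) u (1, 0, 0)) = Cst c"
    proof (induction u)
      case Nil
      show ?case by (auto simp: Cst_simps intro!: exI[of _ 1])
    next
      case (Cons D u)
      then show ?case
        by (auto simp: jet_act_def hat_simps Cst_simps split: prod.splits intro!: exI[of _ 0])
    qed
    then show ?case
      by (auto simp: act_single fst_sc3 Cst_simps(4)[symmetric])
  next
    case zero
    show ?case by (auto simp: Cst_simps intro: exI[of _ 0])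
  next
    case (add a b)
    then show ?case by (auto simp: act_add Cst_simps(3)[symmetric])
  qed
  have "\<exists>N. \<forall>m\<ge>N. \<forall>a\<in>carrier (free_alg L). Q m (act a) \<longrightarrow> Q N (act a)"
  proof (rule right_noetherian_UE_stabilises[OF assms(2)])
    show "Q i (\<lambda>_. 0)" for i
      by (auto simp: Q_def zero_prod_def Bdd_zero)
    fix i F assume F: "Q i F"
    show "Q i (\<lambda>v. - F v)"
      unfolding Q_def
    proof (intro conjI allI)
      fix c v w
      show "- F (v + w) = - F v + - F w" "- F (sc3 c v) = sc3 c (- F v)"
        using F by (simp_all add: Q_def del: split_paired_All)
      obtain r where "F v = (0, 0, r)" using F unfolding Q_def by blast
      then show "\<exists>r. - F v = (0, 0, r)" by simp
    qed (use F in \<open>auto simp: Q_def Bdd_uminus\<close>)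
    show "Q (Suc i) F"
      using F unfolding Q_def by (auto elim!: Bdd_mono)
    show "Q i (\<lambda>v. F v + G v)" if G: "Q i G" for G
      unfolding Q_def
    proof (intro conjI allI)
      fix c v w
      show "F (v + w) + G (v + w) = F v + G v + (F w + G w)"
        using F G by (simp add: Q_def del: split_paired_All)
      show "F (sc3 c v) + G (sc3 c v) = sc3 c (F v + G v)"
        using F G scale_right_distrib by (simp add: Q_def del: split_paired_All)
      obtain r s where "F v = (0, 0, r)" "G v = (0, 0, s)" using F G unfolding Q_def by blast
      then show "\<exists>r. F v + G v = (0, 0, r)" by simp
    qed (use F G in \<open>auto simp: Q_def Bdd_add\<close>)
    show "Q i (\<lambda>v. F (act b v))" if b: "b \<in> carrier (free_alg L)" for b
    proof -
      obtain c q r where v: "act b (1, 0, 0) = (Cst c, q, r)"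
        using fst1[of b] by (metis prod.collapse)
      \<comment> \<open>Up to a part that \<open>F\<close> kills, \<open>act b\<close> sends (1, 0,
        0) to a scalar multiple of itself, hence the value stays in the same box.\<close>
      have "F (sc3 c (1, 0, 0) + (0, q, r)) = sc3 c (F (1, 0, 0))"
        using F unfolding Q_def by (metis add.right_neutral)
      then have "F (act b (1, 0, 0)) = sc3 c (F (1, 0, 0))"
        using v by simp
      then have Bd: "snd (snd (F (act b (1, 0, 0)))) \<in> Bdd (box i)"
        using F by (simp add: Q_def snd_sc3 Bdd_Cst_mult del: split_paired_All)
      have F0: "F (act b (0, q, r)) = 0" for q r
      proof -
        obtain q' r' where "act b (0, q, r) = (0, q', r')"
          using fst0[OF b, of q r] by (cases "act b (0, q, r)") auto
        then show ?thesis using F by (simp add: Q_def)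
      qed
      show ?thesis
        unfolding Q_def act_add_arg[OF b] act_scale_arg[OF b]
        using F Bd F0 unfolding Q_def by (intro conjI allI) blast+
    qed
  qed
  then obtain N where N: "\<And>m a. m \<ge> N \<Longrightarrow> a \<in> carrier (free_alg L) \<Longrightarrow> Q m (act a) \<Longrightarrow> Q N (act a)"
    by blast
  show ?thesis
  proof
    fix a \<psi>
    assume a: "a \<in> carrier (free_alg L)"
      and \<psi>: "\<And>p q r. act a (p, q, r) = (0, 0, \<psi> * p)"
    \<comment> \<open>Some box contains \<psi>; stabilisation of the chain replaces it by the
      uniform one.\<close>
    obtain M where M: "\<psi> \<in> Bdd (box M)" using Bdd_box_exists by blast
    have "Q (max M N) (act a)"
      unfolding Q_def using M a
      by (auto simp: \<psi> act_add_arg act_scale_arg zero_prod_def simp del: free_alg_simps split_paired_All elim!: Bdd_mono)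
    from N[OF _ a this] show "\<psi> \<in> Bdd (box N)"
      by (simp add: Q_def \<psi>)
  qed
qed

subsection \<open>Differential operators with polynomial coefficients\<close>

text \<open>Operators of order at most \<open>p\<close> in the phase space directions, with
  coefficients that may involve the tangent coordinates. The last rule identifies operators that
  agree on \<open>base n\<close>, the only arguments that occur.\<close>

inductive dop :: "nat \<Rightarrow> nat \<Rightarrow> ('k::field mpoly \<Rightarrow> 'k mpoly) \<Rightarrow> bool" for n where
  dop_base: "length \<alpha> \<le> p \<Longrightarrow> \<alpha> \<in> lists {..<2*n} \<Longrightarrow> dop n p (\<lambda>f. a * foldr pd \<alpha> f)"
| dop_add: "dop n p P \<Longrightarrow> dop n p Q \<Longrightarrow> dop n p (\<lambda>f. P f + Q f)"
| dop_cong: "dop n p P \<Longrightarrow> (\<And>f. f \<in> base n \<Longrightarrow> Q f = P f) \<Longrightarrow> dop n p Q"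

lemma dop_id: "dop n p (\<lambda>f. f)"
  using dop_base[of "[]" p n 1] by simp

lemma dop_zero: "dop n p (\<lambda>f. 0)"
  using dop_base[of "[]" p n 0] by simp

lemma dop_mult: "dop n p P \<Longrightarrow> dop n p (\<lambda>f. b * P f)"
proof (induction rule: dop.induct)
  case (dop_base \<alpha> p a)
  then show ?case using dop.dop_base[of \<alpha> p n "b * a"] by (simp add: mult.assoc)
next
  case (dop_add p P Q)
  then show ?case using dop.dop_add by (fastforce simp: distrib_left)
next
  case (dop_cong p P Q)
  then show ?case using dop.dop_cong[of n p "\<lambda>f. b * P f" "\<lambda>f. b * Q f"] by simp
qed

lemma dop_mult_right: "dop n p P \<Longrightarrow> dop n p (\<lambda>f. P f * b)"
  using dop_mult[of n p P b] by (simp add: mult.commute)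

lemma dop_diff: "dop n p P \<Longrightarrow> dop n p Q \<Longrightarrow> dop n p (\<lambda>f. P f - Q f)"
  using dop_add[OF _ dop_mult[of n p Q "-1"]] by fastforce

lemma dop_sum: "(\<And>i. i \<in> S \<Longrightarrow> dop n p (P i)) \<Longrightarrow> dop n p (\<lambda>f. \<Sum>i\<in>S. P i f)"
  by (induction S rule: infinite_finite_induct) (simp_all add: dop_zero dop_add)

lemma dop_mono: "dop n p P \<Longrightarrow> p \<le> q \<Longrightarrow> dop n q P"
proof (induction rule: dop.induct)
  case (dop_cong p P Q)
  then show ?case using dop.dop_cong[of n q P Q] by simp
qed (auto intro: dop.intros)

lemma foldr_pd_base: "f \<in> base n \<Longrightarrow> foldr pd \<alpha> f \<in> base n"
  by (induction \<alpha>) (simp_all add: base_closed)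

lemma foldr_pd_commute: "foldr pd \<alpha> (pd i f) = pd i (foldr pd \<alpha> f)"
  by (induction \<alpha>) (simp_all add: pd_commute[of i])

lemma dop_pd:
  assumes "dop n p P" "i < 2*n"
  shows "dop n (Suc p) (\<lambda>f. pd i (P f))"
  using assms
proof (induction rule: dop.induct)
  case (dop_base \<alpha> p a)
  then have "dop n (Suc p) (\<lambda>f. a * foldr pd (i # \<alpha>) f + pd i a * foldr pd \<alpha> f)"
    by (intro dop.dop_add dop.dop_base) auto
  then show ?case by (simp add: pd_simps)
next
  case (dop_add p P Q)
  then show ?case by (auto simp: pd_simps intro: dop.dop_add)
next
  case (dop_cong p P Q)
  then show ?case using dop.dop_cong[of n "Suc p" "\<lambda>f. pd i (P f)" "\<lambda>f. pd i (Q f)"] by simp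
qed

text \<open>A tangent derivative hits only the coefficients, because base functions do not depend on
  tangent coordinates. Hence it does not raise the order.\<close>

lemma dop_pd_fibre:
  assumes "dop n p P" "i \<ge> 2*n"
  shows "dop n p (\<lambda>f. pd i (P f))"
  using assms
proof (induction rule: dop.induct)
  case (dop_base \<alpha> p a)
  have "dop n p (\<lambda>f. pd i a * foldr pd \<alpha> f)"
    using dop_base by (intro dop.dop_base)
  then show ?case
    by (rule dop.dop_cong) (use dop_base foldr_pd_base[of _ n \<alpha>] in \<open>auto simp: pd_simps base_def\<close>)
next
  case (dop_add p P Q)
  then show ?case by (auto simp: pd_simps intro: dop.dop_add)
next
  case (dop_cong p P Q)
  then show ?case using dop.dop_cong[of n p "\<lambda>f. pd i (P f)" "\<lambda>f. pd i (Q f)"] by simp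
qed

lemma dop_tang: "dop n p P \<Longrightarrow> dop n (Suc p) (\<lambda>f. tang n (P f))"
  unfolding tang_def by (intro dop_sum dop_mult dop_pd) auto

lemma dop_foldr_pd: "dop n p P \<Longrightarrow> \<alpha> \<in> lists {..<2*n} \<Longrightarrow> dop n (p + length \<alpha>) (\<lambda>f. foldr pd \<alpha> (P f))"
  by (induction \<alpha>) (auto intro: dop_pd)

lemma dop_pb: "dop n p P \<Longrightarrow> dop n (Suc p) (\<lambda>f. pb n h (P f))"
  unfolding pb_def by (intro dop_sum dop_diff dop_mult dop_pd) auto

text \<open>Here \<open>hat n f q\<close> is regarded as a function of \<open>f\<close>: the Poisson
  part takes one derivative of \<open>f\<close>, and the tangent part takes two.\<close>

lemma dop_hat_left: "dop n 2 (\<lambda>f. hat n f q)"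
proof -
  have 1: "dop n (Suc p) (\<lambda>f. pb n (P f) q)" "dop n (Suc p) (\<lambda>f. pbw n (P f) q)"
    if "dop n p P" for p and P :: "'a mpoly \<Rightarrow> 'a mpoly"
    unfolding pb_def pbw_def using that by (intro dop_sum dop_diff dop_mult_right dop_pd; simp)+
  have "dop n 1 (\<lambda>f. pb n f q)" using 1(1)[OF dop_id[of n 0]] by simp
  moreover have "dop n 2 (\<lambda>f. pbw n (tang n f) q)"
    using 1(2)[OF dop_tang[OF dop_id[of n 0]]] by (simp add: numeral_2_eq_2)
  ultimately show ?thesis
    unfolding hat_def by (intro dop_add) (auto elim: dop_mono)
qed

lemma dop_cub: "dop n 3 (cub n)"
  using dop_tang[OF dop_tang[OF dop_tang[OF dop_id[of n 0]]]]
  unfolding cub_def[abs_def] by (simp add: numeral_3_eq_3)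

subsection \<open>Symmetric tensors and their order along the diagonal\<close>

text \<open>A symmetric tensor \<open>\<Sum>\<^sub>i c\<^sub>i (u\<^sub>i \<otimes> v\<^sub>i + v\<^sub>i \<otimes> u\<^sub>i)\<close> is represented by the values of
  all bilinear maps on it.\<close>

definition sform :: "'i set \<Rightarrow> ('i \<Rightarrow> 'k::field) \<Rightarrow> ('i \<Rightarrow> 'k mpoly) \<Rightarrow> ('i \<Rightarrow> 'k mpoly)
    \<Rightarrow> ('k mpoly \<Rightarrow> 'k mpoly \<Rightarrow> 'k mpoly) \<Rightarrow> 'k mpoly" where
  "sform S c u v \<beta> = (\<Sum>i\<in>S. Cst (c i) * (\<beta> (u i) (v i) + \<beta> (v i) (u i)))"

text \<open>Vanishing to order \<open>j\<close> along the diagonal, tested only with all derivatives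
  on the second factor. That this controls all bidifferential operators of total order below
  \<open>j\<close> is shown by integration by parts.\<close>

definition vanish :: "nat \<Rightarrow> nat \<Rightarrow> 'i set \<Rightarrow> ('i \<Rightarrow> 'k::field) \<Rightarrow> ('i \<Rightarrow> 'k mpoly) \<Rightarrow> ('i \<Rightarrow> 'k mpoly) \<Rightarrow> bool" where
  "vanish n j S c u v \<longleftrightarrow>
    (\<forall>\<alpha>\<in>lists {..<2*n}. length \<alpha> < j \<longrightarrow> sform S c u v (\<lambda>f g. f * foldr pd \<alpha> g) = 0)"

lemma sform_add: "sform S c u v (\<lambda>f g. \<beta> f g + \<gamma> f g) = sform S c u v \<beta> + sform S c u v \<gamma>"
  unfolding sform_def sum.distrib[symmetric] by (intro sum.cong refl) (simp add: algebra_simps)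

lemma sform_mult: "sform S c u v (\<lambda>f g. a * \<beta> f g) = a * sform S c u v \<beta>"
  unfolding sform_def sum_distrib_left by (intro sum.cong refl) (simp add: algebra_simps)

lemma sform_zero: "sform S c u v (\<lambda>f g. 0) = 0"
  by (simp add: sform_def)

lemma sform_sum: "sform S c u v (\<lambda>f g. \<Sum>j\<in>J. \<beta> j f g) = (\<Sum>j\<in>J. sform S c u v (\<beta> j))"
  by (induction J rule: infinite_finite_induct) (simp_all add: sform_add sform_zero)

lemma sform_diff: "sform S c u v (\<lambda>f g. \<beta> f g - \<gamma> f g) = sform S c u v \<beta> - sform S c u v \<gamma>"
  unfolding sform_def sum_subtractf[symmetric] by (intro sum.cong refl) (simp add: algebra_simps)

lemma sform_der: "der D \<Longrightarrow> D (sform S c u v \<beta>) = sform S c u v (\<lambda>f g. D (\<beta> f g))"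
  unfolding sform_def by (simp add: der_sum_arg derD)

lemma sform_swap: "sform S c u v (\<lambda>f g. \<beta> g f) = sform S c u v \<beta>"
  unfolding sform_def by (simp add: add.commute)

lemma sform_map: "sform S c (\<lambda>i. X (u i)) (\<lambda>i. X (v i)) \<beta> = sform S c u v (\<lambda>f g. \<beta> (X f) (X g))"
  by (simp add: sform_def)

lemma sform_cong:
  assumes "\<And>i. i \<in> S \<Longrightarrow> u i \<in> A \<and> v i \<in> A" "\<And>f g. f \<in> A \<Longrightarrow> g \<in> A \<Longrightarrow> \<beta> f g = \<gamma> f g"
  shows "sform S c u v \<beta> = sform S c u v \<gamma>"
  unfolding sform_def by (intro sum.cong refl) (use assms in auto)

text \<open>Integration by parts: differentiating an identity of order below \<open>j\<close> moves
  one derivative to the other factor with a sign. The result therefore reaches total order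
  \<open>j\<close> itself.\<close>

lemma vanish_shift:
  assumes "vanish n j S c u v" "\<alpha> \<in> lists {..<2*n}" "\<beta> \<in> lists {..<2*n}" "length \<alpha> + length \<beta> \<le> j"
  shows "sform S c u v (\<lambda>f g. foldr pd \<beta> f * foldr pd \<alpha> g)
    = (-1) ^ length \<beta> * sform S c u v (\<lambda>f g. f * foldr pd \<beta> (foldr pd \<alpha> g))"
  using assms(2-)
proof (induction \<beta> arbitrary: \<alpha>)
  case (Cons i \<beta>)
  have "sform S c u v (\<lambda>f g. foldr pd \<beta> f * foldr pd \<alpha> g) = 0"
    using Cons.IH[of \<alpha>] Cons.prems assms(1)
    by (auto simp: vanish_def foldr_append[symmetric] simp del: foldr_append)
  from arg_cong[OF this, of "pd i"]
  have "sform S c u v (\<lambda>f g. pd i (foldr pd \<beta> f) * foldr pd \<alpha> g)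
      = - sform S c u v (\<lambda>f g. foldr pd \<beta> f * foldr pd (i # \<alpha>) g)"
    by (simp add: sform_der[OF der_pd] pd_simps sform_add add_eq_0_iff)
  also have "\<dots> = - ((-1) ^ length \<beta> * sform S c u v (\<lambda>f g. f * foldr pd \<beta> (foldr pd (i # \<alpha>) g)))"
    using Cons by (subst Cons.IH) auto
  finally show ?case
    by (simp add: foldr_pd_commute)
qed simp

text \<open>Coefficients factor out of the tensor, and integration by parts brings each remaining
  term into the form tested by \<open>vanish\<close>.\<close>

lemma vanish_dop:
  assumes v: "vanish n j S c u v" and b: "\<And>i. i \<in> S \<Longrightarrow> u i \<in> base n \<and> v i \<in> base n"
    and P: "dop n p P" and Q: "dop n q Q" and "p + q < j"
  shows "sform S c u v (\<lambda>f g. P f * Q g) = 0"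
  using P \<open>p + q < j\<close>
proof (induction rule: dop.induct)
  case (dop_base \<alpha> p a)
  from Q show ?case using dop_base(3)
  proof (induction rule: dop.induct)
    case (dop_base \<beta> q b)
    have "sform S c u v (\<lambda>f g. a * foldr pd \<alpha> f * (b * foldr pd \<beta> g))
        = (a * b) * sform S c u v (\<lambda>f g. foldr pd \<alpha> f * foldr pd \<beta> g)"
      unfolding sform_mult[symmetric] by (simp add: mult_ac)
    also have "sform S c u v (\<lambda>f g. foldr pd \<alpha> f * foldr pd \<beta> g)
        = (-1) ^ length \<alpha> * sform S c u v (\<lambda>f g. f * foldr pd (\<alpha> @ \<beta>) g)"
      using dop_base \<open>length \<alpha> \<le> p\<close> \<open>\<alpha> \<in> _\<close> by (subst vanish_shift[OF v]) auto
    also have "sform S c u v (\<lambda>f g. f * foldr pd (\<alpha> @ \<beta>) g) = 0"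
      using v dop_base \<open>length \<alpha> \<le> p\<close> \<open>\<alpha> \<in> _\<close> unfolding vanish_def by (auto simp del: foldr_append)
    finally show ?case by simp
  next
    case (dop_cong q P Q)
    have "sform S c u v (\<lambda>f g. a * foldr pd \<alpha> f * Q g) = sform S c u v (\<lambda>f g. a * foldr pd \<alpha> f * P g)"
      by (rule sform_cong[of _ _ "base n"]) (use b dop_cong in auto)
    then show ?case using dop_cong by simp
  qed (simp add: distrib_left sform_add)
next
  case (dop_cong p P Q')
  have "sform S c u v (\<lambda>f g. Q' f * Q g) = sform S c u v (\<lambda>f g. P f * Q g)"
    by (rule sform_cong[of _ _ "base n"]) (use b dop_cong in auto)
  then show ?case using dop_cong by simp
qed (simp add: distrib_right sform_add)

text \<open>At odd order, moving all derivatives across changes the sign while symmetry of the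
  tensor does not, so twice the leading term is zero.\<close>

lemma vanish_odd:
  fixes c :: "'i \<Rightarrow> 'k::field_char_0"
  assumes v: "vanish n j S c u v" and "odd j"
  shows "vanish n (Suc j) S c u v"
  unfolding vanish_def
proof (intro ballI impI)
  fix \<alpha> assume \<alpha>: "\<alpha> \<in> lists {..<2*n}" "length \<alpha> < Suc j"
  let ?s = "sform S c u v (\<lambda>f g. f * foldr pd \<alpha> g)"
  show "?s = 0"
  proof (cases "length \<alpha> < j")
    case False
    then have len: "length \<alpha> = j" using \<alpha> by simp
    have "?s = sform S c u v (\<lambda>f g. foldr pd \<alpha> f * g)"
      by (subst sform_swap[symmetric]) (simp add: mult.commute)
    also have "\<dots> = (-1) ^ length \<alpha> * ?s"
      using vanish_shift[OF v, of "[]" \<alpha>] \<alpha> len by simp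
    also have "\<dots> = - ?s" using len \<open>odd j\<close> by simp
    finally have "?s + ?s = 0" by (simp only: eq_neg_iff_add_eq_0)
    then have "2 * ?s = 0" by (simp only: mult_2)
    then show ?thesis by simp
  qed (use v \<alpha> in \<open>auto simp: vanish_def\<close>)
qed

lemma pdw_tang_pow:
  assumes "i < 2*n" "g \<in> base n"
  shows "pd (2*n+i) ((tang n ^^ Suc k) g) = of_nat (Suc k) * (tang n ^^ k) (pd i g)"
proof (induction k)
  case 0
  then show ?case using assms by (simp add: pdw_tang base_def tang_simps)
next
  case (Suc k)
  have comm: "pd i ((tang n ^^ k) g) = (tang n ^^ k) (pd i g)" for k
    using assms(1) by (induction k) (simp_all add: tang_pd[symmetric])
  have "pd (2*n+i) ((tang n ^^ Suc (Suc k)) g)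
      = pd i ((tang n ^^ Suc k) g) + tang n (pd (2*n+i) ((tang n ^^ Suc k) g))"
    using assms(1) by (simp add: pdw_tang)
  also have "\<dots> = of_nat (Suc (Suc k)) * (tang n ^^ Suc k) (pd i g)"
    unfolding Suc comm tang_simps by (simp add: algebra_simps)
  finally show ?case .
qed

text \<open>Polarisation: the derivatives of a power of the directional derivative with respect to
  the direction recover each mixed partial derivative, up to a factorial.\<close>

lemma foldr_pdw_tang_pow:
  assumes "\<alpha> \<in> lists {..<2*n}" "g \<in> base n"
  shows "foldr (\<lambda>i. pd (2*n+i)) \<alpha> ((tang n ^^ length \<alpha>) g) = of_nat (fact (length \<alpha>)) * foldr pd \<alpha> g"
  using assms
proof (induction \<alpha> arbitrary: g rule: rev_induct)
  case (snoc i \<alpha>)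
  have lin: "foldr (\<lambda>i. pd (2*n+i)) \<alpha> (of_nat k * p) = of_nat k * foldr (\<lambda>i. pd (2*n+i)) \<alpha> p" for k p
    by (induction \<alpha>) (simp_all add: pd_simps)
  have "foldr (\<lambda>i. pd (2*n+i)) (\<alpha> @ [i]) ((tang n ^^ length (\<alpha> @ [i])) g)
      = of_nat (Suc (length \<alpha>)) * foldr (\<lambda>i. pd (2*n+i)) \<alpha> ((tang n ^^ length \<alpha>) (pd i g))"
    using pdw_tang_pow[of i n g "length \<alpha>"] snoc.prems by (simp add: lin del: of_nat_Suc funpow.simps)
  also have "\<dots> = of_nat (Suc (length \<alpha>)) * (of_nat (fact (length \<alpha>)) * foldr pd \<alpha> (pd i g))"
    using snoc.prems by (subst snoc.IH) (auto simp: base_closed)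
  finally show ?case by (simp add: algebra_simps)
qed simp

text \<open>Modulo lower orders the quantity in the last hypothesis is, up to sign, the sixth
  derivative along w of one factor. Its polarisation gives all partial derivatives of order 6, since
  6! is invertible.\<close>

lemma vanish_cub:
  fixes c :: "'i \<Rightarrow> 'k::field_char_0"
  assumes v: "vanish n 6 S c u v" and b: "\<And>i. i \<in> S \<Longrightarrow> u i \<in> base n \<and> v i \<in> base n"
    and q: "sform S c u v (\<lambda>f g. cub n f * cub n g) = 0"
  shows "vanish n 7 S c u v"
proof -
  let ?T = "\<lambda>k. tang n ^^ k"
  have dT: "dop n k (?T k)" for k
    by (induction k) (auto simp: dop_id intro: dop_tang)
  have shift: "sform S c u v (\<lambda>f g. ?T (Suc k) f * ?T l g) = - sform S c u v (\<lambda>f g. ?T k f * ?T (Suc l) g)"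
    if "k + l < 6" for k l
  proof -
    have "sform S c u v (\<lambda>f g. ?T k f * ?T l g) = 0"
      using that by (intro vanish_dop[OF v b dT dT]) auto
    from arg_cong[OF this, of "tang n"] show ?thesis
      by (simp add: sform_der[OF der_tang] tang_simps sform_add add_eq_0_iff)
  qed
  \<comment> \<open>Three integrations by parts, from three derivatives on each side to none and
    six.\<close>
  have q6: "sform S c u v (\<lambda>f g. f * ?T 6 g) = 0"
    using q shift[of 2 3] shift[of 1 4] shift[of 0 5]
    by (simp add: numeral_eq_Suc cub_def)
  have pdw: "foldr (\<lambda>i. pd (2*n+i)) \<alpha> (sform S c u v \<beta>) = sform S c u v (\<lambda>f g. foldr (\<lambda>i. pd (2*n+i)) \<alpha> (\<beta> f g))" for \<alpha> \<beta>
    by (induction \<alpha>) (simp_all add: sform_der[OF der_pd])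
  have base: "foldr (\<lambda>i. pd (2*n+i)) \<alpha> (f * p) = f * foldr (\<lambda>i. pd (2*n+i)) \<alpha> p" if "f \<in> base n" for \<alpha> f p
    using that by (induction \<alpha>) (simp_all add: pd_simps base_def)
  show ?thesis
    unfolding vanish_def
  proof (intro ballI impI)
    fix \<alpha> assume \<alpha>: "\<alpha> \<in> lists {..<2*n}" "length \<alpha> < 7"
    show "sform S c u v (\<lambda>f g. f * foldr pd \<alpha> g) = 0"
    proof (cases "length \<alpha> < 6")
      case False
      then have len: "length \<alpha> = 6" using \<alpha> by simp
      have "of_nat (fact 6) * sform S c u v (\<lambda>f g. f * foldr pd \<alpha> g)
          = sform S c u v (\<lambda>f g. foldr (\<lambda>i. pd (2*n+i)) \<alpha> (f * ?T 6 g))"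
        unfolding sform_mult[symmetric]
      proof (rule sform_cong[of _ _ "base n"])
        fix f g :: "'k mpoly" assume fg: "f \<in> base n" "g \<in> base n"
        show "of_nat (fact 6) * (f * foldr pd \<alpha> g) = foldr (\<lambda>i. pd (2*n+i)) \<alpha> (f * ?T 6 g)"
          using foldr_pdw_tang_pow[OF \<alpha>(1) fg(2)] unfolding base[OF fg(1)] len
          by (simp only: mult.left_commute)
      qed (use b in auto)
      also have "\<dots> = foldr (\<lambda>i. pd (2*n+i)) \<alpha> 0"
        unfolding pdw[symmetric] q6 ..
      also have "\<dots> = 0" by (induction \<alpha>) (simp_all add: pd_simps)
      finally show ?thesis by (simp add: fact_numeral)
    qed (use v \<alpha> in \<open>auto simp: vanish_def\<close>)
  qed
qed

text \<open>A first-order operator on each of the two factors costs two orders of vanishing.\<close>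

lemma vanish_pb:
  assumes v: "vanish n 8 S c u v" and b: "\<And>i. i \<in> S \<Longrightarrow> u i \<in> base n \<and> v i \<in> base n"
  shows "vanish n 6 S c (\<lambda>i. pb n h (u i)) (\<lambda>i. pb n h (v i))"
  unfolding vanish_def sform_map
proof (intro ballI impI)
  fix \<alpha> assume \<alpha>: "\<alpha> \<in> lists {..<2*n}" "length \<alpha> < 6"
  have X: "dop n 1 (pb n h)" using dop_pb[OF dop_id[of n 0]] by simp
  show "sform S c u v (\<lambda>f g. pb n h f * foldr pd \<alpha> (pb n h g)) = 0"
    using \<alpha> by (intro vanish_dop[OF v b X dop_foldr_pd[OF X]]) auto
qed

text \<open>Vanishing of all tensors obtained by applying the field equally often to both factors
  already yields vanishing when it is applied to one factor only.\<close>

lemma sform_pb_pow_eq_0: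
  assumes v: "\<And>k. k \<le> K \<Longrightarrow> vanish n 6 S c (\<lambda>i. (pb n h ^^ k) (u i)) (\<lambda>i. (pb n h ^^ k) (v i))"
    and b: "\<And>i. i \<in> S \<Longrightarrow> u i \<in> base n \<and> v i \<in> base n" and h: "h \<in> base n" and "s \<le> K"
  shows "sform S c u v (\<lambda>f g. f * (pb n h ^^ s) g) = 0"
proof -
  let ?X = "pb n h"
  define F where "F k = sform S c (\<lambda>i. (?X ^^ k) (u i)) (\<lambda>i. (?X ^^ k) (v i))" for k
  have X_base: "(?X ^^ k) f \<in> base n" if "f \<in> base n" for k f
    using that h by (induction k) (simp_all add: base_pb)
  have X: "dop n 1 (pb n h)" using dop_pb[OF dop_id[of n 0]] by simp
  have F0: "F k (\<lambda>f g. f * g) = 0" if "k \<le> K" for k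
    using v[OF that] unfolding vanish_def F_def by (force dest: bspec[of _ _ "[]"])
  have F1: "F k (\<lambda>f g. f * ?X g) = 0" if "k \<le> K" for k
    unfolding F_def by (rule vanish_dop[OF v[OF that] _ dop_id[of n 0] X]) (use b X_base in auto)
  \<comment> \<open>By Leibniz, exponent s + 2 at level k reduces to exponent s at level k + 1.
    Exponents thus drop by two, and the induction carries two consecutive ones.\<close>
  have "F k (\<lambda>f g. f * (?X ^^ s) g) = 0 \<and> F k (\<lambda>f g. f * (?X ^^ Suc s) g) = 0" if "k + s \<le> K" for k s
    using that
  proof (induction s arbitrary: k)
    case 0
    then show ?case using F0 F1 by simp
  next
    case (Suc s)
    have 1: "F k (\<lambda>f g. f * (?X ^^ Suc s) g) = 0" using Suc by simp
    from arg_cong[OF this, of ?X]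
    have "F k (\<lambda>f g. f * (?X ^^ Suc (Suc s)) g) = - F k (\<lambda>f g. ?X f * (?X ^^ Suc s) g)"
      unfolding F_def sform_der[OF der_pb] by (simp add: pb_simps sform_add add_eq_0_iff add.commute)
    also have "F k (\<lambda>f g. ?X f * (?X ^^ Suc s) g) = F (Suc k) (\<lambda>f g. f * (?X ^^ s) g)"
      unfolding F_def sform_map[of S c "?X" "\<lambda>i. (?X ^^ k) (u i)" "\<lambda>i. (?X ^^ k) (v i)", symmetric]
      by (simp add: sform_def funpow_swap1)
    also have "\<dots> = 0" using Suc.IH[of "Suc k"] Suc.prems by simp
    finally show ?case using 1 by simp
  qed
  from this[of 0 s] \<open>s \<le> K\<close> show ?thesis by (simp add: F_def)
qed

text \<open>An order count: all terms of the product except the product of the two values of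
  \<open>cub\<close> have total order at most 5 in the two factors, so they vanish; that product has
  order exactly 6 and survives.\<close>

lemma jet_act_sform:
  fixes c :: "'i \<Rightarrow> 'k::field"
  assumes v: "vanish n 6 S c u v" and b: "\<And>i. i \<in> S \<Longrightarrow> u i \<in> base n \<and> v i \<in> base n"
  shows "(\<Sum>i\<in>S. sc3 (c i) (jet_act n (u i) (jet_act n (v i) (p, q, r)) + jet_act n (v i) (jet_act n (u i) (p, q, r))))
    = (0, 0, sform S c u v (\<lambda>f g. cub n f * cub n g) * p)"
proof -
  \<comment> \<open>The Poisson part uses one derivative of f and k + 1 of g; the tangent part uses
    two of f and k of g. Both total k + 2, so k below 4 suffices.\<close>
  have hat: "sform S c u v (\<lambda>f g. hat n f (Q g)) = 0" if Q: "dop n k Q" "k < 4" for Q k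
  proof -
    have *: "sform S c u v (\<lambda>f g. pd i f * pd j (Q g)) = 0"
      "sform S c u v (\<lambda>f g. pd i (tang n f) * pd (2*n+j) (Q g)) = 0" if "i < 2*n" "j < 2*n" for i j
    proof -
      have "dop n 1 (pd i)" "dop n 2 (\<lambda>f. pd i (tang n f))"
        using dop_pd[OF dop_id[of n 0] that(1)] dop_pd[OF dop_tang[OF dop_id[of n 0]] that(1)]
        by (simp_all add: numeral_2_eq_2)
      from vanish_dop[OF v b this(1) dop_pd[OF Q(1) that(2)]]
        vanish_dop[OF v b this(2) dop_pd_fibre[OF Q(1), of "2*n+j"]] Q(2)
      show "sform S c u v (\<lambda>f g. pd i f * pd j (Q g)) = 0"
        "sform S c u v (\<lambda>f g. pd i (tang n f) * pd (2*n+j) (Q g)) = 0" by simp_all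
    qed
    have "sform S c u v (\<lambda>f g. pb n f (Q g)) = 0" "sform S c u v (\<lambda>f g. pbw n (tang n f) (Q g)) = 0"
      unfolding pb_def pbw_def sform_sum sform_diff by (intro sum.neutral ballI; subst *; simp add: *)+
    then show ?thesis unfolding hat_def sform_add by simp
  qed
  have dc: "dop n 3 (\<lambda>g. cub n g * p)" for p by (rule dop_mult_right[OF dop_cub])
  have h2: "sform S c u v (\<lambda>f g. hat n f (hat n g p)) = 0" for p
    by (rule hat[OF dop_hat_left]) simp
  have h3: "sform S c u v (\<lambda>f g. hat n f (cub n g * p)) = 0" for p
    by (rule hat[OF dc]) simp
  have h4: "sform S c u v (\<lambda>f g. cub n f * hat n g p) = 0" for p
    by (rule vanish_dop[OF v b dop_cub dop_hat_left]) auto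
  have sum3: "(\<Sum>i\<in>S. (a i, b i, d i)) = (\<Sum>i\<in>S. a i, \<Sum>i\<in>S. b i, \<Sum>i\<in>S. d i)"
    for a b d :: "'i \<Rightarrow> 'k mpoly"
    by (induction S rule: infinite_finite_induct) (auto simp: zero_prod_def)
  have "(\<Sum>i\<in>S. sc3 (c i) (jet_act n (u i) (jet_act n (v i) (p, q, r)) + jet_act n (v i) (jet_act n (u i) (p, q, r))))
    = (sform S c u v (\<lambda>f g. hat n f (hat n g p)),
       sform S c u v (\<lambda>f g. hat n f (hat n g q) + hat n f (cub n g * p) + cub n f * hat n g p),
       sform S c u v (\<lambda>f g. hat n f (hat n g r) + hat n f (cub n g * q) + cub n f * hat n g q + cub n f * cub n g * p))"
    unfolding sform_def sum3[symmetric]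
    by (intro sum.cong refl) (simp add: jet_act_def hat_simps(1) algebra_simps)
  also have "\<dots> = (0, 0, sform S c u v (\<lambda>f g. p * (cub n f * cub n g)))"
    unfolding sform_add h2 h3 h4 by (simp add: mult_ac)
  finally show ?thesis unfolding sform_mult by (simp add: mult.commute)
qed

lemma lie_subalgebraD:
  assumes "lie_subalgebra_Wn n L"
  shows "D \<in> L \<Longrightarrow> D \<in> Wn n" "D \<in> L \<Longrightarrow> symb n D \<in> base n" "D \<in> L \<Longrightarrow> E \<in> L \<Longrightarrow> lie_bracket D E \<in> L"
    "dvs.subspace L"
  using assms symb_base by (auto simp: lie_subalgebra_Wn_def)

lemma noetherian_sform_bound:
  fixes L :: "('k::field mpoly \<Rightarrow> 'k mpoly) set"
  assumes L: "lie_subalgebra_Wn n L" and "right_noetherian (UE L)"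
  obtains N where "\<And>(S :: 'i set) c D E. finite S \<Longrightarrow> (\<And>i. i \<in> S \<Longrightarrow> D i \<in> L \<and> E i \<in> L) \<Longrightarrow>
      vanish n 6 S c (\<lambda>i. symb n (D i)) (\<lambda>i. symb n (E i)) \<Longrightarrow>
      sform S c (\<lambda>i. symb n (D i)) (\<lambda>i. symb n (E i)) (\<lambda>f g. cub n f * cub n g) \<in> Bdd (box N)"
proof -
  interpret lie_rep sc3 L "\<lambda>D. jet_act n (symb n D)" by (rule lie_rep_jet_act[OF L])
  obtain N where N: "\<And>a \<psi>. a \<in> carrier (free_alg L) \<Longrightarrow>
      (\<And>p q r. act a (p, q, r) = (0, 0, \<psi> * p)) \<Longrightarrow> \<psi> \<in> Bdd (box N)"
    using noetherian_multiplier_bound[OF assms] by blast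
  show ?thesis
  proof
    fix S :: "'i set" and c :: "'i \<Rightarrow> 'k" and D E
    assume S: "finite S" and DE: "\<And>i. i \<in> S \<Longrightarrow> D i \<in> L \<and> E i \<in> L"
      and v: "vanish n 6 S c (\<lambda>i. symb n (D i)) (\<lambda>i. symb n (E i))"
    \<comment> \<open>A lift of the symmetric tensor to the free algebra: words of length two in
      both orders.\<close>
    define a where "a = (\<Sum>i\<in>S. Poly_Mapping.single [D i, E i] (c i) + Poly_Mapping.single [E i, D i] (c i))"
    have a: "a \<in> carrier (free_alg L)"
    proof -
      have "Poly_Mapping.keys a \<subseteq> (\<Union>i\<in>S. Poly_Mapping.keys
          (Poly_Mapping.single [D i, E i] (c i) + Poly_Mapping.single [E i, D i] (c i)))"
        unfolding a_def by (rule keys_sum)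
      also have "\<dots> \<subseteq> (\<Union>i\<in>S. {[D i, E i], [E i, D i]})"
        by (intro UN_mono order_refl order_trans[OF keys_add]) auto
      also have "\<dots> \<subseteq> lists L" using DE by auto
      finally show ?thesis by simp
    qed
    have "act a w = (\<Sum>i\<in>S. sc3 (c i) (jet_act n (symb n (D i)) (jet_act n (symb n (E i)) w)
        + jet_act n (symb n (E i)) (jet_act n (symb n (D i)) w)))" for w
    proof -
      have "act (\<Sum>i\<in>T. h i) w = (\<Sum>i\<in>T. act (h i) w)" for T :: "'i set" and h
        by (induction T rule: infinite_finite_induct) (simp_all add: act_add)
      then show ?thesis unfolding a_def by (simp add: act_add act_single scale_right_distrib)
    qed
    then show "sform S c (\<lambda>i. symb n (D i)) (\<lambda>i. symb n (E i)) (\<lambda>f g. cub n f * cub n g) \<in> Bdd (box N)"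
      using DE lie_subalgebraD(2)[OF L] by (intro N[OF a]) (simp add: jet_act_sform[OF v])
  qed
qed

section \<open>Propagation along the flow of a derivation in L\<close>

lemma symb_bracket_pow:
  assumes L: "lie_subalgebra_Wn n L" and "X \<in> L" "D \<in> L"
  shows "(lie_bracket X ^^ k) D \<in> L \<and> symb n ((lie_bracket X ^^ k) D) = (pb n (symb n X) ^^ k) (symb n D)"
proof (induction k)
  case (Suc k)
  then show ?case
    using assms lie_subalgebraD[OF L] symb_lie_bracket[of X n "(lie_bracket X ^^ k) D"] by simp
qed (use assms in simp)

text \<open>The order goes from 6 to 7 when the multiplier is zero, to 8 by symmetry, and back to 6
  after applying the field to both factors. The noetherian bound confines each multiplier to one
  fixed box, so finitely many linear conditions per step force it to be zero.\<close>

lemma vanish_propagates: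
  fixes L :: "('k::field_char_0 mpoly \<Rightarrow> 'k mpoly) set"
  assumes L: "lie_subalgebra_Wn n L" and X: "X \<in> L"
    and N: "\<And>(S :: 'i set) c D E. finite S \<Longrightarrow> (\<And>i. i \<in> S \<Longrightarrow> D i \<in> L \<and> E i \<in> L) \<Longrightarrow>
      vanish n 6 S c (\<lambda>i. symb n (D i)) (\<lambda>i. symb n (E i)) \<Longrightarrow>
      sform S c (\<lambda>i. symb n (D i)) (\<lambda>i. symb n (E i)) (\<lambda>f g. cub n f * cub n g) \<in> Bdd (box N)"
    and S: "finite (S :: 'i set)" and DE: "\<And>i. i \<in> S \<Longrightarrow> D i \<in> L \<and> E i \<in> L"
    and v: "vanish n 6 S c (\<lambda>i. symb n (D i)) (\<lambda>i. symb n (E i))"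
    and q: "\<And>k m. k < K \<Longrightarrow> (\<And>i. Poly_Mapping.lookup m i \<le> box N i) \<Longrightarrow>
      Poly_Mapping.lookup (sform S c (\<lambda>i. symb n (D i)) (\<lambda>i. symb n (E i))
        (\<lambda>f g. cub n ((pb n (symb n X) ^^ k) f) * cub n ((pb n (symb n X) ^^ k) g))) m = 0"
    and "s \<le> K"
  shows "sform S c (\<lambda>i. symb n (D i)) (\<lambda>i. symb n (E i)) (\<lambda>f g. f * (pb n (symb n X) ^^ s) g) = 0"
proof (rule sform_pb_pow_eq_0[OF _ _ _ \<open>s \<le> K\<close>])
  let ?X = "pb n (symb n X)"
  have b: "(?X ^^ k) (symb n (D i)) \<in> base n \<and> (?X ^^ k) (symb n (E i)) \<in> base n" if "i \<in> S" for i k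
    using symb_bracket_pow[OF L X, of "D i" k] symb_bracket_pow[OF L X, of "E i" k]
      DE[OF that] lie_subalgebraD(2)[OF L] by metis
  show "symb n X \<in> base n" using lie_subalgebraD[OF L] X by blast
  show "symb n (D i) \<in> base n \<and> symb n (E i) \<in> base n" if "i \<in> S" for i
    using b[OF that, of 0] by simp
  fix k assume "k \<le> K"
  then show "vanish n 6 S c (\<lambda>i. (?X ^^ k) (symb n (D i))) (\<lambda>i. (?X ^^ k) (symb n (E i)))"
  proof (induction k)
    case (Suc k)
    let ?u = "\<lambda>i. (?X ^^ k) (symb n (D i))" and ?v = "\<lambda>i. (?X ^^ k) (symb n (E i))"
    let ?q = "sform S c ?u ?v (\<lambda>f g. cub n f * cub n g)"
    have IH: "vanish n 6 S c ?u ?v" using Suc by simp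
    have "?q = sform S c (\<lambda>i. symb n ((lie_bracket X ^^ k) (D i))) (\<lambda>i. symb n ((lie_bracket X ^^ k) (E i)))
        (\<lambda>f g. cub n f * cub n g)"
      unfolding sform_def using symb_bracket_pow[OF L X] DE by (intro sum.cong) auto
    also have "\<dots> \<in> Bdd (box N)"
    proof (rule N[OF S])
      show "(lie_bracket X ^^ k) (D i) \<in> L \<and> (lie_bracket X ^^ k) (E i) \<in> L" if "i \<in> S" for i
        using symb_bracket_pow[OF L X] DE[OF that] by blast
      have "sform S c (\<lambda>i. symb n ((lie_bracket X ^^ k) (D i))) (\<lambda>i. symb n ((lie_bracket X ^^ k) (E i))) \<beta>
          = sform S c ?u ?v \<beta>" for \<beta>
        unfolding sform_def using symb_bracket_pow[OF L X] DE by (intro sum.cong) auto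
      then show "vanish n 6 S c (\<lambda>i. symb n ((lie_bracket X ^^ k) (D i))) (\<lambda>i. symb n ((lie_bracket X ^^ k) (E i)))"
        using IH by (simp add: vanish_def)
    qed
    finally have "?q \<in> Bdd (box N)" .
    \<comment> \<open>Coefficients inside the box vanish by assumption, and those outside by the
      noetherian bound.\<close>
    then have "?q = 0"
      using q[of k] Suc.prems unfolding sform_map[of S c "?X ^^ k"] 
      by (intro poly_mapping_eqI) (metis (no_types, lifting) Bdd_def Suc_le_eq in_keys_iff lookup_zero mem_Collect_eq)
    then have "vanish n 7 S c ?u ?v" using IH b by (intro vanish_cub) auto
    then have "vanish n 8 S c ?u ?v" using vanish_odd[of n 7 S c ?u ?v] by simp
    from vanish_pb[OF this, of "symb n X"] show ?case using b by simp
  qed (use v in simp)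
qed

subsection \<open>Orders along a hyperplane\<close>

definition drop_var :: "nat \<Rightarrow> (nat \<Rightarrow>\<^sub>0 nat) \<Rightarrow> (nat \<Rightarrow>\<^sub>0 nat)" where
  "drop_var i m = m - Poly_Mapping.single i (Poly_Mapping.lookup m i)"

lemma lookup_drop_var: "Poly_Mapping.lookup (drop_var i m) j = (if j = i then 0 else Poly_Mapping.lookup m j)"
  by (simp add: drop_var_def lookup_minus lookup_single when_def)

lemma drop_var_add: "drop_var i (m + m') = drop_var i m + drop_var i m'"
  by (rule poly_mapping_eqI) (simp add: lookup_drop_var lookup_add)

lemma drop_var_idem: "drop_var i (drop_var i m) = drop_var i m"
  by (rule poly_mapping_eqI) (simp add: lookup_drop_var)

text \<open>The coefficient of the j-th power of \<open>var i - Cst a\<close> in the Taylor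
  expansion, a polynomial free of \<open>var i\<close>. Binomial coefficients replace divided
  derivatives. For \<open>j = 0\<close> it is restriction to the hyperplane.\<close>

definition tay :: "nat \<Rightarrow> 'k::field \<Rightarrow> nat \<Rightarrow> 'k mpoly \<Rightarrow> 'k mpoly" where
  "tay i a j p = (\<Sum>m\<in>Poly_Mapping.keys p. Poly_Mapping.single (drop_var i m)
     (Poly_Mapping.lookup p m * (of_nat (Poly_Mapping.lookup m i choose j) * a ^ (Poly_Mapping.lookup m i - j))))"

lemma tay_single: "tay i a j (Poly_Mapping.single m c) = Poly_Mapping.single (drop_var i m)
     (c * (of_nat (Poly_Mapping.lookup m i choose j) * a ^ (Poly_Mapping.lookup m i - j)))"
  unfolding tay_def by (rule sum_keys_single) simp

lemma tay_add: "tay i a j (p + q) = tay i a j p + tay i a j q"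
  unfolding tay_def by (rule sum_keys_add) (simp_all add: distrib_right single_add)

lemma tay_zero [simp]: "tay i a j 0 = 0"
  by (simp add: tay_def)

lemma tay_sum: "tay i a j (\<Sum>s\<in>S. h s) = (\<Sum>s\<in>S. tay i a j (h s))"
  by (induction S rule: infinite_finite_induct) (simp_all add: tay_add)

lemma tay_Cst_mult: "tay i a j (Cst c * p) = Cst c * tay i a j p"
  by (induction p rule: poly_mapping_single_induct)
     (simp_all add: tay_single tay_add distrib_left Cst_def mult_single mult.assoc)

lemma tay0_mult: "tay i a 0 (p * q) = tay i a 0 p * tay i a 0 q"
proof (induction p rule: poly_mapping_single_induct)
  case (single m c)
  show ?case
    by (induction q rule: poly_mapping_single_induct)
       (simp_all add: tay_single tay_add distrib_left mult_single drop_var_add lookup_add power_add mult_ac distrib_right)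
qed (simp_all add: tay_add distrib_right)

lemma tay0_tay: "tay i a 0 (tay i a j p) = tay i a j p"
  by (induction p rule: poly_mapping_single_induct)
     (simp_all add: tay_single tay_add lookup_drop_var drop_var_idem)

lemma tay_Bdd: "p \<in> Bdd b \<Longrightarrow> tay i a j p \<in> Bdd (b(i := 0))"
  unfolding tay_def by (rule Bdd_sum) (auto simp: Bdd_def lookup_drop_var split: if_splits)

lemma taylor:
  assumes "p \<in> Bdd b" "b i \<le> d"
  shows "p = (\<Sum>j\<le>d. (var i - Cst a) ^ j * tay i a j p)"
proof -
  have sgl: "Poly_Mapping.single m c = (\<Sum>j\<le>d. (var i - Cst a) ^ j * tay i a j (Poly_Mapping.single m c))"
    if "Poly_Mapping.lookup m i \<le> d" for m and c :: 'a
  proof -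
    let ?e = "Poly_Mapping.lookup m i"
    have var_pow: "var i ^ k = Poly_Mapping.single (Poly_Mapping.single i k) (1::'a)" for k
      by (induction k) (simp_all add: var_def mult_single single_add[symmetric])
    have Cst_pow: "Cst a ^ k = Cst (a ^ k)" for k
      by (induction k) (simp_all add: Cst_simps)
    have m: "drop_var i m + Poly_Mapping.single i ?e = m"
      by (rule poly_mapping_eqI) (simp add: lookup_drop_var lookup_add lookup_single when_def)
    have "Poly_Mapping.single m c = Poly_Mapping.single (drop_var i m) c * var i ^ ?e"
      by (simp add: var_pow mult_single m)
    also have "var i ^ ?e = ((var i - Cst a) + Cst a) ^ ?e" by simp
    also have "\<dots> = (\<Sum>j\<le>?e. of_nat (?e choose j) * (var i - Cst a) ^ j * Cst a ^ (?e - j))"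
      by (rule binomial_ring)
    also have "\<dots> = (\<Sum>j\<le>d. of_nat (?e choose j) * (var i - Cst a) ^ j * Cst a ^ (?e - j))"
      by (rule sum.mono_neutral_left) (use that in \<open>simp_all add: binomial_eq_0\<close>)
    also have "Poly_Mapping.single (drop_var i m) c * \<dots>
        = (\<Sum>j\<le>d. (var i - Cst a) ^ j * tay i a j (Poly_Mapping.single m c))"
      unfolding sum_distrib_left
    proof (intro sum.cong refl)
      fix j
      have "tay i a j (Poly_Mapping.single m c)
          = Poly_Mapping.single (drop_var i m) c * (of_nat (?e choose j) * Cst a ^ (?e - j))"
        unfolding Cst_pow Cst_of_nat[symmetric]
        by (simp add: tay_single Cst_def mult_single del: single_of_nat)
      then show "Poly_Mapping.single (drop_var i m) c * (of_nat (?e choose j) * (var i - Cst a) ^ j * Cst a ^ (?e - j))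
          = (var i - Cst a) ^ j * tay i a j (Poly_Mapping.single m c)"
        by (simp add: mult_ac)
    qed
    finally show ?thesis .
  qed
  have le: "Poly_Mapping.lookup m i \<le> d" if "m \<in> Poly_Mapping.keys p" for m
    using assms that by (auto simp: Bdd_def intro: le_trans[of _ "b i"])
  have "p = (\<Sum>m\<in>Poly_Mapping.keys p. Poly_Mapping.single m (Poly_Mapping.lookup p m))"
    by (rule poly_mapping_sum_single)
  also have "\<dots> = (\<Sum>m\<in>Poly_Mapping.keys p. \<Sum>j\<le>d. (var i - Cst a) ^ j
      * tay i a j (Poly_Mapping.single m (Poly_Mapping.lookup p m)))"
    using sgl le by (intro sum.cong refl) blast
  also have "\<dots> = (\<Sum>j\<le>d. (var i - Cst a) ^ j
      * tay i a j (\<Sum>m\<in>Poly_Mapping.keys p. Poly_Mapping.single m (Poly_Mapping.lookup p m)))"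
    unfolding tay_sum sum_distrib_left by (rule sum.swap)
  also have "\<dots> = (\<Sum>j\<le>d. (var i - Cst a) ^ j * tay i a j p)"
    using poly_mapping_sum_single[of p] by simp
  finally show ?thesis .
qed

lemma tay0_hyperplane: "tay i a 0 (var i - Cst a) = 0"
proof -
  have "tay i a 0 (var i) + Cst (-1) * tay i a 0 (Cst a) = 0"
    by (simp add: var_def tay_single Cst_def mult_single drop_var_def single_add[symmetric])
  then show ?thesis
    unfolding tay_Cst_mult[symmetric] tay_add[symmetric] by (simp add: Cst_simps)
qed

text \<open>Restriction to the hyperplane is multiplicative and kills its equation; conversely, the
  Taylor expansion without its constant term is divisible by that equation.\<close>

lemma hyperplane_dvd_iff: "(var i - Cst a) dvd p \<longleftrightarrow> tay i a 0 p = 0"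
proof
  assume "(var i - Cst a) dvd p"
  then show "tay i a 0 p = 0" by (auto simp: tay0_mult tay0_hyperplane)
next
  assume 0: "tay i a 0 p = 0"
  obtain N where "p \<in> Bdd (box N)" using Bdd_box_exists by blast
  from taylor[OF this order_refl, of i a]
  have "p = (\<Sum>j\<le>box N i. (var i - Cst a) ^ j * tay i a j p)" .
  moreover have "(var i - Cst a) dvd (var i - Cst a) ^ j * tay i a j p" for j
    using 0 by (cases j) auto
  ultimately show "(var i - Cst a) dvd p" by (metis (no_types, lifting) dvd_sum)
qed

text \<open>Divisibility is the vanishing of a multiplicative map into a domain.\<close>

lemma prime_elem_hyperplane: "prime_elem (var i - Cst a)"
proof (rule prime_elemI)
  show "var i - Cst a \<noteq> 0"
  proof
    assume "var i - Cst a = 0"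
    then have "pd i (var i) = pd i (Cst a)" by simp
    then show False by (simp add: pd_var)
  qed
  show "\<not> (var i - Cst a) dvd 1"
    using tay_single[of i a 0 0 1] by (auto simp: hyperplane_dvd_iff drop_var_def)
  show "(var i - Cst a) dvd p \<or> (var i - Cst a) dvd q" if "(var i - Cst a) dvd p * q" for p q
    using that by (simp add: hyperplane_dvd_iff tay0_mult)
qed

text \<open>Only finitely many parallel hyperplanes can lie in the zero set of a nonzero polynomial,
  and the field is infinite.\<close>

lemma exists_transversal_hyperplane:
  fixes p :: "'k::field_char_0 mpoly"
  assumes "p \<noteq> 0"
  obtains a where "\<not> (var i - Cst a) dvd p"
proof -
  obtain m0 where m0: "m0 \<in> Poly_Mapping.keys p" using assms by (meson keys_eq_empty all_not_in_conv)
  \<comment> \<open>The monomials that agree with \<open>m0\<close> outside \<open>var i\<close>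
    form a nonzero univariate polynomial. Its value at a is one coefficient of the
    restriction.\<close>
  define M where "M = {m \<in> Poly_Mapping.keys p. drop_var i m = drop_var i m0}"
  define P where "P = (\<Sum>m\<in>M. monom (Poly_Mapping.lookup p m) (Poly_Mapping.lookup m i))"
  have fin: "finite M" by (simp add: M_def)
  have "coeff P (Poly_Mapping.lookup m0 i) = (\<Sum>m\<in>M. if m = m0 then Poly_Mapping.lookup p m else 0)"
    unfolding P_def coeff_sum
  proof (intro sum.cong refl)
    fix m assume m: "m \<in> M"
    have "m = m0" if "Poly_Mapping.lookup m i = Poly_Mapping.lookup m0 i"
    proof (rule poly_mapping_eqI)
      fix j
      have "Poly_Mapping.lookup (drop_var i m) j = Poly_Mapping.lookup (drop_var i m0) j"
        using m by (simp add: M_def)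
      then show "Poly_Mapping.lookup m j = Poly_Mapping.lookup m0 j"
        using that by (cases "j = i") (simp_all add: lookup_drop_var)
    qed
    then show "coeff (monom (Poly_Mapping.lookup p m) (Poly_Mapping.lookup m i)) (Poly_Mapping.lookup m0 i)
        = (if m = m0 then Poly_Mapping.lookup p m else 0)"
      by auto
  qed
  also have "\<dots> = Poly_Mapping.lookup p m0"
    using fin m0 by (simp add: M_def)
  finally have "P \<noteq> 0" using m0 by (auto simp: in_keys_iff)
  then have "finite {a. poly P a = 0}" by (rule poly_roots_finite)
  then obtain a where a: "poly P a \<noteq> 0"
    using infinite_UNIV_char_0[where 'a = 'k] by (metis (mono_tags, lifting) UNIV_I finite_subset mem_Collect_eq subsetI)
  have "Poly_Mapping.lookup (tay i a 0 p) (drop_var i m0)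
      = (\<Sum>m\<in>Poly_Mapping.keys p. if drop_var i m = drop_var i m0 then Poly_Mapping.lookup p m * a ^ Poly_Mapping.lookup m i else 0)"
    unfolding tay_def lookup_sum by (intro sum.cong refl) (auto simp: lookup_single when_def)
  also have "\<dots> = poly P a"
    unfolding P_def M_def by (simp add: poly_sum poly_monom sum.inter_filter if_distrib[of "\<lambda>q. poly q a"] cong: if_cong)
  finally have "tay i a 0 p \<noteq> 0" using a by auto
  then show ?thesis by (intro that[of a]) (simp add: hyperplane_dvd_iff)
qed

section \<open>Exact orders and transversal derivations\<close>

definition exact :: "'a::comm_semiring_1 \<Rightarrow> nat \<Rightarrow> 'a \<Rightarrow> bool" where
  "exact l k p \<longleftrightarrow> l ^ k dvd p \<and> \<not> l ^ Suc k dvd p"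

lemma tay_dvd:
  assumes "\<And>j. j < k \<Longrightarrow> tay i a j p = 0"
  shows "(var i - Cst a) ^ k dvd p"
proof -
  obtain N where "p \<in> Bdd (box N)" using Bdd_box_exists by blast
  from taylor[OF this order_refl, of i a]
  have "p = (\<Sum>j\<le>box N i. (var i - Cst a) ^ j * tay i a j p)" .
  moreover have "(var i - Cst a) ^ k dvd (var i - Cst a) ^ j * tay i a j p" for j
    using assms[of j] by (cases "j < k") (auto simp: le_imp_power_dvd)
  ultimately show ?thesis by (metis (no_types, lifting) dvd_sum)
qed

lemma tay_exact:
  assumes "\<And>j. j < k \<Longrightarrow> tay i a j p = 0" "tay i a k p \<noteq> 0"
  shows "exact (var i - Cst a) k p"
  unfolding exact_def
proof
  let ?l = "var i - Cst a"
  show "?l ^ k dvd p" by (rule tay_dvd[OF assms(1)])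
  show "\<not> ?l ^ Suc k dvd p"
  proof
    assume dvd: "?l ^ Suc k dvd p"
    obtain N where "p \<in> Bdd (box N)" using Bdd_box_exists by blast
    moreover define d where "d = max k (box N i)"
    ultimately have "p = (\<Sum>j\<le>d. ?l ^ j * tay i a j p)"
      by (intro taylor[where b = "box N"]) auto
    also have "\<dots> = ?l ^ k * tay i a k p + (\<Sum>j\<in>{..d} - {k}. ?l ^ j * tay i a j p)"
      by (rule sum.remove) (auto simp: d_def)
    finally have "?l ^ k * tay i a k p = p - (\<Sum>j\<in>{..d} - {k}. ?l ^ j * tay i a j p)"
      by (simp add: algebra_simps)
    moreover have "?l ^ Suc k dvd ?l ^ j * tay i a j p" if "j \<noteq> k" for j
    proof (cases "j < k")
      case False
      then have "?l ^ Suc k dvd ?l ^ j" using that by (intro le_imp_power_dvd) simp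
      then show ?thesis by (rule dvd_mult2)
    qed (use assms in simp)
    ultimately have "?l ^ Suc k dvd ?l ^ k * tay i a k p"
      using dvd by (metis (no_types, lifting) DiffD2 dvd_diff dvd_sum singletonI)
    moreover have "?l \<noteq> 0" using prime_elem_hyperplane by (rule prime_elem_not_zeroI)
    ultimately have "?l dvd tay i a k p" by (simp add: mult.commute[of _ "?l"])
    then show False using assms(2) by (simp add: hyperplane_dvd_iff tay0_tay)
  qed
qed

text \<open>The degree bound in \<open>var i\<close> also bounds the order of vanishing. This later
  limits how often the field has to be applied.\<close>

lemma tay_order_exists:
  assumes "p \<noteq> 0" "p \<in> Bdd b"
  obtains k where "k \<le> b i" "\<And>j. j < k \<Longrightarrow> tay i a j p = 0" "tay i a k p \<noteq> 0"
proof -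
  have "\<exists>j\<le>b i. tay i a j p \<noteq> 0"
    using taylor[OF assms(2) order_refl, of i a] assms(1) by (metis (no_types, lifting) atMost_iff mult_zero_right sum.neutral)
  then obtain j where j: "j \<le> b i" "tay i a j p \<noteq> 0" by blast
  define k where "k = (LEAST k. tay i a k p \<noteq> 0)"
  have "tay i a k p \<noteq> 0" unfolding k_def by (rule LeastI[of _ j]) (rule j)
  moreover have "k \<le> j" unfolding k_def by (rule Least_le) (rule j)
  moreover have "tay i a j p = 0" if "j < k" for j
    using not_less_Least that unfolding k_def by blast
  ultimately show ?thesis using that[of k] j(1) by simp
qed

context
  fixes l :: "'k::field_char_0 mpoly" and X :: "'k mpoly \<Rightarrow> 'k mpoly"
  assumes prime: "prime_elem l" and X: "der X" and trans: "\<not> l dvd X l"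
begin

lemma der_power: "X (l ^ Suc k) = of_nat (Suc k) * (l ^ k * X l)"
  by (induction k) (simp_all add: derD[OF X] algebra_simps)

text \<open>Modulo a higher power of \<open>l\<close>, the derivative of l^(k+1) r is (k+1) l^k (X
  l) r. Transversality, primality and characteristic zero keep it from gaining a factor.\<close>

lemma exact_der:
  assumes "exact l (Suc k) p"
  shows "exact l k (X p)"
proof -
  have l0: "l \<noteq> 0" using prime by (rule prime_elem_not_zeroI)
  obtain r where r: "p = l ^ Suc k * r" using assms by (auto simp: exact_def)
  then have "\<not> l dvd r" using assms l0 by (auto simp: exact_def mult.commute[of l])
  have "X p = l ^ k * (l * X r + of_nat (Suc k) * (X l * r))"
    unfolding r derD(2)[OF X] der_power by (simp add: algebra_simps)
  moreover have "\<not> l dvd l * X r + of_nat (Suc k) * (X l * r)"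
  proof
    assume "l dvd l * X r + of_nat (Suc k) * (X l * r)"
    then have "l dvd of_nat (Suc k) * (X l * r)" by (simp add: dvd_add_right_iff)
    then have "l dvd Cst (inverse (of_nat (Suc k))) * (of_nat (Suc k) * (X l * r))" by (rule dvd_mult)
    also have "\<dots> = Cst (inverse (of_nat (Suc k)) * of_nat (Suc k)) * (X l * r)"
      unfolding Cst_of_nat[symmetric] Cst_simps by (simp only: mult.assoc)
    also have "\<dots> = X l * r" by (simp add: Cst_simps del: of_nat_Suc)
    finally show False
      using prime_elem_dvd_multD[OF prime] trans \<open>\<not> l dvd r\<close> by blast
  qed
  ultimately show ?thesis
    using l0 by (simp add: exact_def mult.commute[of l])
qed

lemma exact_der_pow: "exact l k p \<Longrightarrow> s \<le> k \<Longrightarrow> exact l (k - s) ((X ^^ s) p)"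
proof (induction s)
  case (Suc s)
  then have "exact l (Suc (k - Suc s)) ((X ^^ s) p)" by (simp add: Suc_diff_Suc)
  from exact_der[OF this] show ?case by simp
qed simp

text \<open>Each differentiation loses at most one factor of \<open>l\<close>; the subtraction is
  truncated at zero.\<close>

lemma dvd_der_pow:
  assumes "l ^ k dvd p"
  shows "l ^ (k - s) dvd (X ^^ s) p"
proof (induction s)
  case (Suc s)
  show ?case
  proof (cases "k - s")
    case (Suc r)
    from \<open>l ^ (k - s) dvd (X ^^ s) p\<close> obtain t where t: "(X ^^ s) p = l ^ Suc r * t"
      unfolding Suc by auto
    have "(X ^^ Suc s) p = l ^ r * (l * X t + of_nat (Suc r) * (X l * t))"
      unfolding funpow.simps o_apply t derD(2)[OF X] der_power by (simp add: algebra_simps)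
    moreover have "k - Suc s = r" using Suc by simp
    ultimately show ?thesis by simp
  qed simp
qed (use assms in simp)

text \<open>The first summand with the smallest total order, and among those the one with the largest
  index, cannot be cancelled once it is differentiated as often as its second factor vanishes.\<close>

lemma leading_term_nonzero:
  assumes f: "exact l k f" and "M \<le> k"
    and g: "\<And>a. a < M \<Longrightarrow> l ^ Suc k dvd g a"
    and ord: "\<And>a. a < M \<Longrightarrow> g a \<noteq> 0 \<Longrightarrow> \<exists>\<kappa>\<le>K. exact l \<kappa> (g a)"
    and "b < M" "g b \<noteq> 0"
  shows "\<exists>s\<le>K. (\<Sum>a<M. (X ^^ a) f * (X ^^ s) (g a) + g a * (X ^^ s) ((X ^^ a) f)) \<noteq> 0"
proof -
  define A where "A = {a. a < M \<and> g a \<noteq> 0}"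
  have A: "finite A" "A \<noteq> {}" using assms by (auto simp: A_def)
  have "\<forall>a\<in>A. \<exists>\<kappa>\<le>K. exact l \<kappa> (g a)" using ord by (auto simp: A_def)
  then obtain \<kappa> where \<kappa>: "\<And>a. a \<in> A \<Longrightarrow> \<kappa> a \<le> K \<and> exact l (\<kappa> a) (g a)" by metis
  define m where "m = Min ((\<lambda>a. (k - a) + \<kappa> a) ` A)"
  define A' where "A' = {a \<in> A. (k - a) + \<kappa> a = m}"
  have m_le: "m \<le> (k - a) + \<kappa> a" if "a \<in> A" for a
    unfolding m_def using A that by simp
  have "m \<in> (\<lambda>a. (k - a) + \<kappa> a) ` A" unfolding m_def using A by (intro Min_in) auto
  then have A': "finite A'" "A' \<noteq> {}" using A by (auto simp: A'_def)
  define z where "z = Max A'"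
  have zA': "z \<in> A'" unfolding z_def using A' by simp
  have z_max: "a \<le> z" if "a \<in> A'" for a unfolding z_def using A' that by simp
  have zA: "z \<in> A" and zm: "(k - z) + \<kappa> z = m" and zM: "z < M"
    using zA' by (auto simp: A'_def A_def)
  define s where "s = \<kappa> z"
  define e where "e = k - z"
  have dvd_f: "l ^ (k - a) dvd (X ^^ a) f" for a
    using f by (intro dvd_der_pow) (simp add: exact_def)
  have main: "exact l e ((X ^^ z) f * (X ^^ s) (g z))"
  proof -
    have 1: "exact l e ((X ^^ z) f)"
      unfolding e_def using zM \<open>M \<le> k\<close> by (intro exact_der_pow[OF f]) simp
    have 2: "exact l 0 ((X ^^ s) (g z))"
      using exact_der_pow[of "\<kappa> z" "g z" s] \<kappa>[OF zA] by (simp add: s_def)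
    have l0: "l \<noteq> 0" using prime by (rule prime_elem_not_zeroI)
    obtain r where r: "(X ^^ z) f = l ^ e * r" using 1 by (auto simp: exact_def)
    then have "\<not> l dvd r" using 1 l0 by (auto simp: exact_def mult.commute[of l])
    then have "\<not> l dvd r * (X ^^ s) (g z)"
      using 2 prime_elem_dvd_multD[OF prime] by (auto simp: exact_def)
    then show ?thesis
      unfolding exact_def r using l0 by (simp add: mult.commute[of l] mult.assoc)
  qed
  have rest1: "l ^ Suc e dvd (X ^^ a) f * (X ^^ s) (g a)" if "a < M" "a \<noteq> z" for a
  proof (cases "a \<in> A")
    case True
    have "l ^ ((k - a) + (\<kappa> a - s)) dvd (X ^^ a) f * (X ^^ s) (g a)"
      unfolding power_add using \<kappa>[OF True] by (intro mult_dvd_mono dvd_f dvd_der_pow) (simp add: exact_def)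
    moreover have "Suc e \<le> (k - a) + (\<kappa> a - s)"
    proof (cases "a \<in> A'")
      case True
      \<comment> \<open>With equal totals, a smaller index means that \<open>g a\<close> vanishes to
        order below \<open>s\<close>. Then the factor (X ^^ a) f alone has order k - a, which
        exceeds \<open>e\<close>.\<close>
      then have "a < z" using z_max that by fastforce
      then show ?thesis using True zm zM \<open>M \<le> k\<close> that by (simp add: A'_def e_def s_def)
    next
      case False
      then have "m < (k - a) + \<kappa> a" using m_le[OF True] True by (auto simp: A'_def)
      then show ?thesis using zm by (simp add: e_def s_def)
    qed
    ultimately show ?thesis using power_le_dvd by blast
  next
    case False
    then have "g a = 0" using that by (simp add: A_def)
    moreover have "(X ^^ s) 0 = 0" by (induction s) (simp_all add: derD[OF X])
    ultimately show ?thesis by simp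
  qed
  \<comment> \<open>The factor \<open>g a\<close> is left undifferentiated here, and its order
    exceeds \<open>k\<close>, hence \<open>e\<close>.\<close>
  have rest2: "l ^ Suc e dvd g a * (X ^^ s) ((X ^^ a) f)" if "a < M" for a
    using power_le_dvd[OF g[OF that], of "Suc e"] by (intro dvd_mult2) (simp add: e_def)
  let ?t = "\<lambda>a. (X ^^ a) f * (X ^^ s) (g a) + g a * (X ^^ s) ((X ^^ a) f)"
  have eq: "(\<Sum>a<M. ?t a) = (X ^^ z) f * (X ^^ s) (g z) + (g z * (X ^^ s) ((X ^^ z) f) + (\<Sum>a\<in>{..<M} - {z}. ?t a))"
    using zM by (subst sum.remove[of _ z]) (auto simp: add.assoc)
  have dvd: "l ^ Suc e dvd g z * (X ^^ s) ((X ^^ z) f) + (\<Sum>a\<in>{..<M} - {z}. ?t a)"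
    using zM by (intro dvd_add rest2 dvd_sum rest1) auto
  have "\<not> l ^ Suc e dvd (\<Sum>a<M. ?t a)"
    unfolding eq dvd_add_left_iff[OF dvd] using main by (simp only: exact_def simp_thms)
  then have "(\<Sum>a<M. ?t a) \<noteq> 0" by (intro notI) (simp only: dvd_0_right simp_thms)
  then show ?thesis using \<kappa>[OF zA] by (auto simp: s_def)
qed

end

subsection \<open>Counting\<close>

text \<open>Gaussian elimination on the set of equations: one pivot removes an equation and an
  unknown.\<close>

lemma homogeneous_system_solvable:
  fixes R :: "('i \<Rightarrow> 'k::field) set"
  assumes "finite I" "finite R" "card R < card I"
  shows "\<exists>c. (\<exists>i\<in>I. c i \<noteq> 0) \<and> (\<forall>r\<in>R. (\<Sum>i\<in>I. c i * r i) = 0)"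
  using assms
proof (induction "card R" arbitrary: R I rule: less_induct)
  case less
  show ?case
  proof (cases "\<forall>r\<in>R. \<forall>i\<in>I. r i = 0")
    case True
    obtain i where "i \<in> I" using less.prems by fastforce
    with True show ?thesis by (intro exI[of _ "\<lambda>_. 1"]) auto
  next
    case False
    then obtain r0 j where r0: "r0 \<in> R" and j: "j \<in> I" "r0 j \<noteq> 0" by blast
    \<comment> \<open>The other rows with their entry in column \<open>j\<close> cleared by the
      pivot row; rows that become equal only lower the cardinality.\<close>
    define R' where "R' = (\<lambda>r i. r i - r j / r0 j * r0 i) ` (R - {r0})"
    have cR: "card (R - {r0}) < card R" using r0 less.prems by (intro psubset_card_mono) auto
    have "card R' \<le> card (R - {r0})" unfolding R'_def using less.prems by (intro card_image_le) auto
    then have cR': "card R' < card R" using cR by simp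
    moreover have "card R' < card (I - {j})"
      using cR' less.prems j by (simp add: card_Diff_singleton)
    ultimately obtain c where c: "\<exists>i\<in>I - {j}. c i \<noteq> 0" "\<forall>r\<in>R'. (\<Sum>i\<in>I - {j}. c i * r i) = 0"
      using less.hyps[of R' "I - {j}"] less.prems by (auto simp: R'_def)
    define t where "t = - (\<Sum>i\<in>I - {j}. c i * r0 i) / r0 j"
    define c' where "c' = c(j := t)"
    have sum: "(\<Sum>i\<in>I. c' i * r i) = t * r j + (\<Sum>i\<in>I - {j}. c i * r i)" for r :: "'i \<Rightarrow> 'k"
    proof -
      have "(\<Sum>i\<in>I. c' i * r i) = c' j * r j + (\<Sum>i\<in>I - {j}. c' i * r i)"
        using j less.prems by (intro sum.remove) auto
      also have "(\<Sum>i\<in>I - {j}. c' i * r i) = (\<Sum>i\<in>I - {j}. c i * r i)"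
        by (intro sum.cong) (auto simp: c'_def)
      finally show ?thesis by (simp add: c'_def)
    qed
    have 0: "(\<Sum>i\<in>I. c' i * r0 i) = 0" unfolding sum t_def using j by simp
    have "(\<Sum>i\<in>I. c' i * r i) = 0" if "r \<in> R" for r
    proof (cases "r = r0")
      case False
      then have "(\<Sum>i\<in>I - {j}. c i * (r i - r j / r0 j * r0 i)) = 0"
        using c(2) that by (auto simp: R'_def)
      then have "(\<Sum>i\<in>I - {j}. c i * r i) = r j / r0 j * (\<Sum>i\<in>I - {j}. c i * r0 i)"
        by (simp add: right_diff_distrib sum_subtractf sum_distrib_left mult_ac)
      then show ?thesis unfolding sum t_def by simp
    qed (use 0 in simp)
    moreover have "\<exists>i\<in>I. c' i \<noteq> 0" using c(1) by (auto simp: c'_def)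
    ultimately show ?thesis by blast
  qed
qed

definition mons :: "(nat \<Rightarrow> nat) \<Rightarrow> (nat \<Rightarrow>\<^sub>0 nat) set" where
  "mons b = {m. \<forall>i. Poly_Mapping.lookup m i \<le> b i}"

lemma card_mons:
  assumes "\<And>i. i \<ge> k \<Longrightarrow> b i = 0"
  shows "finite (mons b)" "card (mons b) \<le> (\<Prod>i<k. Suc (b i))"
proof -
  let ?F = "PiE {..<k} (\<lambda>i. {..b i})"
  let ?r = "\<lambda>m. restrict (Poly_Mapping.lookup m) {..<k}"
  have sub: "?r ` mons b \<subseteq> ?F" by (intro image_subsetI restrict_PiE_iff[THEN iffD2]) (auto simp: mons_def)
  have inj: "inj_on ?r (mons b)"
  proof (rule inj_onI)
    fix m m' assume m: "m \<in> mons b" "m' \<in> mons b" and eq: "?r m = ?r m'"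
    show "m = m'"
    proof (rule poly_mapping_eqI)
      fix i
      show "Poly_Mapping.lookup m i = Poly_Mapping.lookup m' i"
      proof (cases "i < k")
        case True
        then show ?thesis using fun_cong[OF eq, of i] by simp
      next
        case False
        then have "Poly_Mapping.lookup m i \<le> 0" "Poly_Mapping.lookup m' i \<le> 0"
          using m assms[of i] by (auto simp: mons_def) (metis le_zero_eq)+
        then show ?thesis by simp
      qed
    qed
  qed
  have fin: "finite ?F" by (intro finite_PiE) auto
  show "finite (mons b)" using inj sub fin by (rule inj_on_finite)
  have "card (mons b) \<le> card ?F" using inj sub fin by (rule card_inj_on_le)
  also have "card ?F = (\<Prod>i<k. Suc (b i))" by (simp add: card_PiE)
  finally show "card (mons b) \<le> (\<Prod>i<k. Suc (b i))" .
qed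

lemma Bdd_eq_0:
  assumes "p \<in> Bdd b" "\<And>m. m \<in> mons b \<Longrightarrow> Poly_Mapping.lookup p m = 0"
  shows "p = 0"
proof (rule poly_mapping_eqI)
  fix m
  show "Poly_Mapping.lookup p m = Poly_Mapping.lookup 0 m"
  proof (cases "m \<in> Poly_Mapping.keys p")
    case True
    then have "m \<in> mons b" using assms(1) unfolding Bdd_def mons_def by blast
    then show ?thesis using assms(2) by simp
  qed (simp add: in_keys_iff)
qed

section \<open>Degree bounds for derivations and their symbols\<close>

lemma Bdd_pd: "p \<in> Bdd b \<Longrightarrow> pd i p \<in> Bdd b"
  unfolding pd_def
  by (rule Bdd_sum) (auto simp: Bdd_def lookup_minus lookup_single when_def split: if_splits intro: le_trans[OF diff_le_self])

lemma Bdd_foldr_pd: "p \<in> Bdd b \<Longrightarrow> foldr pd \<alpha> p \<in> Bdd b"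
  by (induction \<alpha>) (simp_all add: Bdd_pd)

lemma Bdd_var: "b i \<ge> 1 \<Longrightarrow> var i \<in> Bdd b"
  by (auto simp: Bdd_def var_def lookup_single when_def)

abbreviation xbox :: "nat \<Rightarrow> nat \<Rightarrow> nat \<Rightarrow> nat" where
  "xbox n d \<equiv> (\<lambda>i. if i < n then d else 0)"

text \<open>Symbols have degree at most d in each position and at most 1 in each momentum, so the
  momenta contribute only a constant factor to the counts.\<close>

abbreviation zbox :: "nat \<Rightarrow> nat \<Rightarrow> nat \<Rightarrow> nat" where
  "zbox n d \<equiv> (\<lambda>i. if i < n then d else if i < 2*n then 1 else 0)"

definition Ldeg :: "nat \<Rightarrow> ('k::field mpoly \<Rightarrow> 'k mpoly) set \<Rightarrow> nat \<Rightarrow> ('k mpoly \<Rightarrow> 'k mpoly) set" where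
  "Ldeg n L d = {D \<in> L. \<forall>m<n. D (var m) \<in> Bdd (xbox n d)}"

lemma Ldeg_subset: "Ldeg n L d \<subseteq> L"
  by (auto simp: Ldeg_def)

lemma Ldeg_mono: "D \<in> Ldeg n L d \<Longrightarrow> d \<le> e \<Longrightarrow> D \<in> Ldeg n L e"
  by (auto simp: Ldeg_def elim!: Bdd_mono)

lemma subspace_Ldeg:
  assumes "lie_subalgebra_Wn n L"
  shows "dvs.subspace (Ldeg n L d)"
  using lie_subalgebraD(4)[OF assms]
  by (auto simp: dvs.subspace_def Ldeg_def Bdd_zero Bdd_add dscale_def pscale_conv_mult Bdd_Cst_mult)

text \<open>Degrees of coefficients add under the bracket; the loss of one degree by differentiation
  is ignored.\<close>

lemma Ldeg_bracket:
  assumes L: "lie_subalgebra_Wn n L" and D: "D \<in> Ldeg n L d" and E: "E \<in> Ldeg n L e"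
  shows "lie_bracket D E \<in> Ldeg n L (d + e)"
proof -
  have W: "D \<in> Wn n" "E \<in> Wn n" and DE: "D \<in> L" "E \<in> L"
    using D E lie_subalgebraD(1)[OF L] by (auto simp: Ldeg_def)
  have *: "D (E (var m)) \<in> Bdd (xbox n (d + e))"
    if "D \<in> Wn n" "E \<in> Wn n" "D \<in> Ldeg n L d" "E \<in> Ldeg n L e" "m < n" for D E d e m
  proof -
    have "D (E (var m)) = (\<Sum>j<n. D (var j) * pd j (E (var m)))"
      by (rule Wn_expand[OF that(1) WnD(2)[OF that(2) Pn_var[OF that(5)]]])
    also have "\<dots> \<in> Bdd (xbox n (d + e))"
    proof (rule Bdd_sum)
      fix j assume "j \<in> {..<n}"
      then have "D (var j) * pd j (E (var m)) \<in> Bdd (\<lambda>i. xbox n d i + xbox n e i)"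
        using that by (intro Bdd_mult Bdd_pd) (auto simp: Ldeg_def)
      then show "D (var j) * pd j (E (var m)) \<in> Bdd (xbox n (d + e))"
        by (rule Bdd_mono) auto
    qed
    finally show ?thesis .
  qed
  have "D (E (var m)) - E (D (var m)) \<in> Bdd (xbox n (d + e))" if "m < n" for m
    using *[OF W D E that] *[OF W(2,1) E D that, unfolded add.commute[of e d]] by (rule Bdd_diff)
  then show ?thesis
    using lie_subalgebraD(3)[OF L DE] by (simp add: Ldeg_def lie_bracket_def)
qed

lemma Ldeg_bracket_pow:
  assumes L: "lie_subalgebra_Wn n L" and X: "X \<in> Ldeg n L e" and D: "D \<in> Ldeg n L d"
  shows "(lie_bracket X ^^ k) D \<in> Ldeg n L (d + k * e)"
proof (induction k)
  case (Suc k)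
  from Ldeg_bracket[OF L X this] show ?case by (simp add: ac_simps)
qed (use D in simp)

lemma symb_Bdd:
  assumes "D \<in> Ldeg n L d"
  shows "symb n D \<in> Bdd (zbox n d)"
  unfolding symb_def
proof (rule Bdd_sum)
  fix m assume m: "m \<in> {..<n}"
  have "var (n+m) \<in> Bdd (\<lambda>i. if i = n+m then 1 else 0)" by (rule Bdd_var) simp
  moreover have "D (var m) \<in> Bdd (xbox n d)" using assms m by (auto simp: Ldeg_def)
  ultimately have "var (n+m) * D (var m) \<in> Bdd (\<lambda>i. (if i = n+m then 1 else 0) + xbox n d i)"
    by (rule Bdd_mult)
  then show "var (n+m) * D (var m) \<in> Bdd (zbox n d)"
    by (rule Bdd_mono) (use m in auto)
qed

lemma lookup_sform: "Poly_Mapping.lookup (sform S c u v \<beta>) m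
    = (\<Sum>i\<in>S. c i * Poly_Mapping.lookup (\<beta> (u i) (v i) + \<beta> (v i) (u i)) m)"
  unfolding sform_def lookup_sum lookup_Cst_mult ..

section \<open>The dimension inequality\<close>

definition lin_comb :: "('k::field mpoly \<Rightarrow> 'k mpoly) set \<Rightarrow> (('k mpoly \<Rightarrow> 'k mpoly) \<Rightarrow> 'k) \<Rightarrow> ('k mpoly \<Rightarrow> 'k mpoly)" where
  "lin_comb B c = (\<Sum>D\<in>B. dscale (c D) D)"

lemma symb_lin_comb:
  fixes c :: "('k::field mpoly \<Rightarrow> 'k mpoly) \<Rightarrow> 'k"
  shows "symb n (lin_comb B c) = (\<Sum>D\<in>B. Cst (c D) * symb n D)"
proof -
  have "symb n (0 :: 'k mpoly \<Rightarrow> 'k mpoly) = 0" by (simp add: symb_def)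
  then have "symb n (\<Sum>D\<in>B. h D) = (\<Sum>D\<in>B. symb n (h D))" for h :: "_ \<Rightarrow> 'k mpoly \<Rightarrow> 'k mpoly"
    by (induction B rule: infinite_finite_induct) (simp_all add: symb_add)
  then show ?thesis by (simp add: lin_comb_def symb_dscale)
qed

text \<open>If it fails, there are more unknown coefficients than linear conditions. This yields a
  nonzero tensor that must vanish along the flow of \<open>X\<close>, while its leading term along
  the hyperplane shows that it does not. The three summands count conditions on orders along the
  hyperplane, on the diagonal, and on the multipliers.\<close>

lemma dimension_bound:
  fixes L :: "('k::field_char_0 mpoly \<Rightarrow> 'k mpoly) set"
  assumes L: "lie_subalgebra_Wn n L" and X: "X \<in> Ldeg n L e"
    and i: "i < n" and tr: "\<not> (var i - Cst a) dvd X (var i)"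
    and N: "\<And>(S :: (nat \<times> ('k mpoly \<Rightarrow> 'k mpoly)) set) c D E. finite S \<Longrightarrow> (\<And>i. i \<in> S \<Longrightarrow> D i \<in> L \<and> E i \<in> L) \<Longrightarrow>
      vanish n 6 S c (\<lambda>i. symb n (D i)) (\<lambda>i. symb n (E i)) \<Longrightarrow>
      sform S c (\<lambda>i. symb n (D i)) (\<lambda>i. symb n (E i)) (\<lambda>f g. cub n f * cub n g) \<in> Bdd (box N)"
    and B: "finite B" "B \<subseteq> Ldeg n L d" "dvs.independent B" and "M > 0"
  shows "M * card B \<le> M * (Suc M * card (mons ((zbox n d)(i := 0))))
     + card {\<alpha> \<in> lists {..<2*n}. length \<alpha> < 6} * card (mons (\<lambda>j. zbox n (d + M * e) j + zbox n d j))
     + d * card (mons (box N))"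
proof (rule ccontr)
  let ?X = "pb n (symb n X)" and ?l = "var i - Cst a :: 'k mpoly"
  let ?T = "mons ((zbox n d)(i := 0))" and ?Wd = "{\<alpha> \<in> lists {..<2*n}. length \<alpha> < 6}"
  let ?b2 = "\<lambda>j. zbox n (d + M * e) j + zbox n d j"
  assume "\<not> ?thesis"
  then have big: "M * (Suc M * card ?T) + card ?Wd * card (mons ?b2) + d * card (mons (box N)) < M * card B"
    by simp
  have finT: "finite ?T" by (rule card_mons(1)[of "2*n"]) (use i in auto)
  have finB2: "finite (mons ?b2)" by (rule card_mons(1)[of "2*n"]) auto
  have finN: "finite (mons (box N))" by (rule card_mons(1)[of N]) auto
  have "{\<alpha> \<in> lists {..<2*n}. length \<alpha> < 6} \<subseteq> {\<alpha>. set \<alpha> \<subseteq> {..<2*n} \<and> length \<alpha> \<le> 6}" by auto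
  then have finW: "finite ?Wd" by (rule finite_subset) (rule finite_lists_length_le, simp)
  have XL: "X \<in> L" using X Ldeg_subset by blast
  have BL: "lin_comb B c \<in> Ldeg n L d" for c
    unfolding lin_comb_def using B subspace_Ldeg[OF L, of d]
    by (intro dvs.subspace_sum dvs.subspace_scale) auto
  \<comment> \<open>A nontrivial combination of an independent set is nonzero, and a derivation is
    determined by its symbol.\<close>
  have lc0: "symb n (lin_comb B c) \<noteq> 0" if "D \<in> B" "c D \<noteq> 0" for c D
  proof
    assume "symb n (lin_comb B c) = 0"
    moreover have "lin_comb B c \<in> Wn n"
      using BL[of c] Ldeg_subset lie_subalgebraD(1)[OF L] by blast
    ultimately have "(\<Sum>D\<in>B. dscale (c D) D) = 0"
      using symb_eq_0 unfolding lin_comb_def by blast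
    then have "\<forall>D\<in>B. c D = 0"
      using B(1,3) unfolding dvs.dependent_finite[OF B(1)] by blast
    then show False using that by blast
  qed
  \<comment> \<open>Nonzero symbols from the span of \<open>B\<close> that vanish to order at least
    \<open>M\<close> along the hyperplane. The space of Taylor coefficients is too small for this
    set to be empty.\<close>
  define \<F> where "\<F> = {f. \<exists>c. f = symb n (lin_comb B c) \<and> f \<noteq> 0 \<and> (\<forall>j<M. tay i a j f = 0)}"
  have tayB: "tay i a j (symb n D) \<in> Bdd ((zbox n d)(i := 0))" if "D \<in> Ldeg n L d" for D j
    using symb_Bdd[OF that] by (rule tay_Bdd)
  have tay_lc: "Poly_Mapping.lookup (tay i a j (symb n (lin_comb B c))) m
      = (\<Sum>D\<in>B. c D * Poly_Mapping.lookup (tay i a j (symb n D)) m)" for j c m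
    by (simp add: symb_lin_comb tay_sum tay_Cst_mult lookup_sum lookup_Cst_mult)
  have tay_lc0: "tay i a j (symb n (lin_comb B c)) = 0"
    if "\<And>m. m \<in> ?T \<Longrightarrow> (\<Sum>D\<in>B. c D * Poly_Mapping.lookup (tay i a j (symb n D)) m) = 0" for j c
    using that by (intro Bdd_eq_0[OF tayB[OF BL]]) (simp add: tay_lc)
  have "\<F> \<noteq> {}"
  proof -
    define R where "R = (\<lambda>(j, m) D. Poly_Mapping.lookup (tay i a j (symb n D)) m) ` ({..<M} \<times> ?T)"
    have "card R \<le> card ({..<M} \<times> ?T)" unfolding R_def using finT by (intro card_image_le) auto
    also have "\<dots> = M * card ?T" by (simp add: card_cartesian_product)
    also have "\<dots> < card B"
    proof -
      have "M * (Suc M * card ?T) < M * card B" using big by linarith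
      then show ?thesis by simp
    qed
    finally have "card R < card B" .
    moreover have "finite R" unfolding R_def using finT by simp
    ultimately obtain c where c: "\<exists>D\<in>B. c D \<noteq> 0" "\<And>r. r \<in> R \<Longrightarrow> (\<Sum>D\<in>B. c D * r D) = 0"
      using homogeneous_system_solvable[OF B(1), of R] by blast
    have "tay i a j (symb n (lin_comb B c)) = 0" if "j < M" for j
      using that by (intro tay_lc0 c(2)) (force simp: R_def)
    then have "symb n (lin_comb B c) \<in> \<F>" using c(1) lc0 by (auto simp: \<F>_def)
    then show ?thesis by blast
  qed
  \<comment> \<open>The smallest order attained in \<open>\<F>\<close>. Every other element then has
    at least this order.\<close>
  define k where "k = (LEAST k. \<exists>f\<in>\<F>. tay i a k f \<noteq> 0)"
  have ord: "\<exists>\<kappa>\<le>d. (\<forall>j<\<kappa>. tay i a j f = 0) \<and> tay i a \<kappa> f \<noteq> 0"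
    if "f = symb n (lin_comb B c)" "f \<noteq> 0" for f c
  proof -
    have "f \<in> Bdd (zbox n d)" using symb_Bdd[OF BL] that by simp
    from tay_order_exists[OF that(2) this, of i a] show ?thesis using i by auto
  qed
  have "\<exists>k. \<exists>f\<in>\<F>. tay i a k f \<noteq> 0"
  proof -
    obtain f c where fc: "f \<in> \<F>" "f = symb n (lin_comb B c)" "f \<noteq> 0"
      using \<open>\<F> \<noteq> {}\<close> unfolding \<F>_def by blast
    from ord[OF fc(2,3)] fc(1) show ?thesis by blast
  qed
  then have "\<exists>f\<in>\<F>. tay i a k f \<noteq> 0" unfolding k_def by (rule LeastI_ex)
  then obtain f where f: "f \<in> \<F>" "tay i a k f \<noteq> 0" by blast
  have k_min: "tay i a j g = 0" if "g \<in> \<F>" "j < k" for g j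
    using not_less_Least[of j "\<lambda>k. \<exists>f\<in>\<F>. tay i a k f \<noteq> 0"] that unfolding k_def by blast
  have "M \<le> k"
  proof (rule ccontr)
    assume "\<not> M \<le> k"
    then show False using f by (auto simp: \<F>_def)
  qed
  obtain cf where cf: "f = symb n (lin_comb B cf)" using f by (auto simp: \<F>_def)
  define Df where "Df = lin_comb B cf"
  \<comment> \<open>The tensor sought is the symmetrisation of the sum over b below \<open>M\<close>
    of X^b f \<otimes> g_b, with g_b in the span of \<open>B\<close>. The unknowns are the
    coefficients of all g_b.\<close>
  define I where "I = {..<M} \<times> B"
  define D E where "D = (\<lambda>p :: nat \<times> ('k mpoly \<Rightarrow> 'k mpoly). (lie_bracket X ^^ fst p) Df)"
    and "E = (snd :: nat \<times> ('k mpoly \<Rightarrow> 'k mpoly) \<Rightarrow> _)"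
  define u v where "u = (\<lambda>p. symb n (D p))" and "v = (\<lambda>p. symb n (E p))"
  have finI: "finite I" using B by (simp add: I_def)
  have DfL: "Df \<in> Ldeg n L d" unfolding Df_def by (rule BL)
  have Df: "Df \<in> L" using DfL Ldeg_subset by blast
  have DE: "D p \<in> L \<and> E p \<in> L" if "p \<in> I" for p
  proof
    show "D p \<in> L" unfolding D_def using symb_bracket_pow[OF L XL Df] by blast
    have "snd p \<in> B" using that by (auto simp: I_def)
    then show "E p \<in> L" unfolding E_def using B(2) Ldeg_subset by blast
  qed
  have u: "u (a', D') = (?X ^^ a') f" for a' D'
    using symb_bracket_pow[OF L XL Df, of a'] by (simp add: u_def D_def cf Df_def)
  have uB: "u p \<in> Bdd (zbox n (d + M * e))" if "p \<in> I" for p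
  proof -
    have "D p \<in> Ldeg n L (d + fst p * e)" unfolding D_def by (rule Ldeg_bracket_pow[OF L X DfL])
    then have "D p \<in> Ldeg n L (d + M * e)"
      by (rule Ldeg_mono) (use that in \<open>auto simp: I_def\<close>)
    then show ?thesis unfolding u_def by (rule symb_Bdd)
  qed
  have vB: "v p \<in> Bdd (zbox n d)" if "p \<in> I" for p
    unfolding v_def using that B by (intro symb_Bdd) (auto simp: E_def I_def)
  \<comment> \<open>Conditions for vanishing to order 6 on the diagonal.\<close>
  define R1 where "R1 = (\<lambda>(\<alpha>, m) p. Poly_Mapping.lookup (u p * foldr pd \<alpha> (v p) + v p * foldr pd \<alpha> (u p)) m) ` (?Wd \<times> mons ?b2)"
  \<comment> \<open>Conditions killing the coefficients in the noetherian box of the multipliers for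
    the first \<open>d\<close> powers of the field.\<close>
  define R2 where "R2 = (\<lambda>(s, m) p. Poly_Mapping.lookup (cub n ((?X ^^ s) (u p)) * cub n ((?X ^^ s) (v p))
      + cub n ((?X ^^ s) (v p)) * cub n ((?X ^^ s) (u p))) m) ` ({..<d} \<times> mons (box N))"
  \<comment> \<open>Conditions making each g_b vanish to order \<open>M\<close>, so that it lies in
    \<open>\<F>\<close> or is zero, together with its Taylor coefficient of index \<open>k\<close>.
    Minimality of \<open>k\<close> then pushes the order above \<open>k\<close>.\<close>
  define R3 where "R3 = (\<lambda>(a', j, m) (b, D'). if b = a' then Poly_Mapping.lookup (tay i a j (symb n D')) m else 0)
      ` ({..<M} \<times> insert k {..<M} \<times> ?T)"
  have "card R1 \<le> card ?Wd * card (mons ?b2)"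
    unfolding R1_def using card_image_le[of "?Wd \<times> mons ?b2"] finW finB2 by (simp add: card_cartesian_product)
  moreover have "card R2 \<le> d * card (mons (box N))"
    unfolding R2_def using card_image_le[of "{..<d} \<times> mons (box N)"] finN by (simp add: card_cartesian_product)
  moreover have "card R3 \<le> M * (Suc M * card ?T)"
  proof -
    have "card R3 \<le> card ({..<M} \<times> insert k {..<M} \<times> ?T)"
      unfolding R3_def using finT by (intro card_image_le) auto
    also have "\<dots> = M * (card (insert k {..<M}) * card ?T)" by (simp only: card_cartesian_product card_lessThan)
    also have "\<dots> \<le> M * (Suc M * card ?T)"
      by (intro mult_le_mono order_refl) (simp add: card_insert_if)
    finally show ?thesis .
  qed
  ultimately have cardR: "card (R1 \<union> R2 \<union> R3) < card I"
    using big card_Un_le[of "R1 \<union> R2" R3] card_Un_le[of R1 R2] by (simp add: I_def card_cartesian_product)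
  have finR: "finite (R1 \<union> R2 \<union> R3)"
    unfolding R1_def R2_def R3_def using finW finB2 finN finT by auto
  from homogeneous_system_solvable[OF finI finR cardR]
  obtain c where "(\<exists>p\<in>I. c p \<noteq> 0) \<and> (\<forall>r\<in>R1 \<union> R2 \<union> R3. (\<Sum>p\<in>I. c p * r p) = 0)"
    by (rule exE)
  then have c: "\<exists>p\<in>I. c p \<noteq> 0" "\<And>r. r \<in> R1 \<union> R2 \<union> R3 \<Longrightarrow> (\<Sum>p\<in>I. c p * r p) = 0"
    by (simp_all only: Ball_def)
  have vanish: "vanish n 6 I c u v"
    unfolding vanish_def
  proof (intro ballI impI)
    fix \<alpha> assume \<alpha>: "\<alpha> \<in> lists {..<2*n}" "length \<alpha> < 6"
    have "sform I c u v (\<lambda>f g. f * foldr pd \<alpha> g) \<in> Bdd ?b2"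
      unfolding sform_def
    proof (intro Bdd_sum Bdd_Cst_mult Bdd_add)
      fix p assume p: "p \<in> I"
      show "u p * foldr pd \<alpha> (v p) \<in> Bdd ?b2"
        by (rule Bdd_mult[OF uB[OF p] Bdd_foldr_pd[OF vB[OF p]]])
      have "v p * foldr pd \<alpha> (u p) \<in> Bdd (\<lambda>j. zbox n d j + zbox n (d + M * e) j)"
        by (rule Bdd_mult[OF vB[OF p] Bdd_foldr_pd[OF uB[OF p]]])
      then show "v p * foldr pd \<alpha> (u p) \<in> Bdd ?b2" by (simp add: add.commute)
    qed
    moreover have "Poly_Mapping.lookup (sform I c u v (\<lambda>f g. f * foldr pd \<alpha> g)) m = 0" if "m \<in> mons ?b2" for m
      unfolding lookup_sform using \<alpha> that by (intro c(2)) (force simp: R1_def)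
    ultimately show "sform I c u v (\<lambda>f g. f * foldr pd \<alpha> g) = 0" by (rule Bdd_eq_0)
  qed
  have zero: "sform I c u v (\<lambda>f g. f * (?X ^^ s) g) = 0" if "s \<le> d" for s
    unfolding u_def v_def
  proof (rule vanish_propagates[OF L XL N finI DE _ _ that])
    show "vanish n 6 I c (\<lambda>p. symb n (D p)) (\<lambda>p. symb n (E p))" using vanish by (simp add: u_def v_def)
    fix s m assume s: "s < d" and m: "\<And>j. Poly_Mapping.lookup m j \<le> box N j"
    have "m \<in> mons (box N)" using m by (auto simp: mons_def)
    then show "Poly_Mapping.lookup (sform I c (\<lambda>p. symb n (D p)) (\<lambda>p. symb n (E p))
        (\<lambda>f g. cub n ((?X ^^ s) f) * cub n ((?X ^^ s) g))) m = 0"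
      unfolding lookup_sform using s by (intro c(2)) (force simp: R2_def u_def v_def)
  qed auto
  define g where "g b = symb n (lin_comb B (\<lambda>D'. c (b, D')))" for b
  have g_tay: "tay i a j (g b) = 0" if "b < M" "j \<in> insert k {..<M}" for b j
    unfolding g_def
  proof (rule tay_lc0)
    fix m assume m: "m \<in> ?T"
    have "(\<Sum>p\<in>I. c p * (case p of (b', D') \<Rightarrow> if b' = b then Poly_Mapping.lookup (tay i a j (symb n D')) m else 0)) = 0"
      using that m by (intro c(2)) (force simp: R3_def)
    also have "(\<Sum>p\<in>I. c p * (case p of (b', D') \<Rightarrow> if b' = b then Poly_Mapping.lookup (tay i a j (symb n D')) m else 0))
      = (\<Sum>b'<M. \<Sum>D'\<in>B. if b' = b then c (b', D') * Poly_Mapping.lookup (tay i a j (symb n D')) m else 0)"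
      unfolding I_def sum.cartesian_product by (intro sum.cong) auto
    also have "\<dots> = (\<Sum>b'<M. if b' = b then (\<Sum>D'\<in>B. c (b', D') * Poly_Mapping.lookup (tay i a j (symb n D')) m) else 0)"
      by (intro sum.cong) auto
    also have "\<dots> = (\<Sum>D'\<in>B. c (b, D') * Poly_Mapping.lookup (tay i a j (symb n D')) m)"
      using that by simp
    finally show "(\<Sum>D'\<in>B. c (b, D') * Poly_Mapping.lookup (tay i a j (symb n D')) m) = 0" .
  qed
  have sf: "sform I c u v (\<lambda>f g. f * (?X ^^ s) g)
      = (\<Sum>b<M. (?X ^^ b) f * (?X ^^ s) (g b) + g b * (?X ^^ s) ((?X ^^ b) f))" for s
  proof -
    have lin: "(?X ^^ s) (\<Sum>D'\<in>B. Cst (h D') * w D') = (\<Sum>D'\<in>B. Cst (h D') * (?X ^^ s) (w D'))" for h w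
      by (induction s) (simp_all add: der_sum_arg[OF der_pb] pb_simps(6))
    have "sform I c u v (\<lambda>f g. f * (?X ^^ s) g)
      = (\<Sum>b<M. \<Sum>D'\<in>B. Cst (c (b, D')) * ((?X ^^ b) f * (?X ^^ s) (symb n D') + symb n D' * (?X ^^ s) ((?X ^^ b) f)))"
      unfolding sform_def I_def sum.cartesian_product
      by (intro sum.cong) (auto simp: u v_def E_def)
    also have "\<dots> = (\<Sum>b<M. (?X ^^ b) f * (?X ^^ s) (g b) + g b * (?X ^^ s) ((?X ^^ b) f))"
      unfolding g_def symb_lin_comb lin
      by (intro sum.cong refl) (simp add: sum_distrib_left sum_distrib_right sum.distrib[symmetric] algebra_simps)
    finally show ?thesis .
  qed
  have "\<exists>s\<le>d. (\<Sum>b<M. (?X ^^ b) f * (?X ^^ s) (g b) + g b * (?X ^^ s) ((?X ^^ b) f)) \<noteq> 0"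
  proof -
    obtain b D' where bD: "b < M" "D' \<in> B" "c (b, D') \<noteq> 0" using c(1) by (auto simp: I_def)
    \<comment> \<open>On the equation of the hyperplane the Hamiltonian field of the symbol agrees
      with \<open>X\<close>, so transversality carries over.\<close>
    have Xl: "?X ?l = X (var i)"
      using pd_symb_fibre[of X n i] lie_subalgebraD(1)[OF L XL] i by (simp add: pb_simps pb_var)
    have gF: "g b \<in> \<F>" if "b < M" "g b \<noteq> 0" for b
      using g_tay[OF that(1)] that(2) unfolding \<F>_def g_def by auto
    show ?thesis
    proof (rule leading_term_nonzero[OF prime_elem_hyperplane der_pb _ _ \<open>M \<le> k\<close> _ _ bD(1)])
      show "\<not> ?l dvd ?X ?l" unfolding Xl by (rule tr)
      show "exact ?l k f" by (rule tay_exact[OF k_min f(2)]) (use f in auto)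
      show "g b \<noteq> 0" unfolding g_def by (rule lc0[OF bD(2)]) (rule bD(3))
      fix b assume b: "b < M"
      show "?l ^ Suc k dvd g b"
      proof (cases "g b = 0")
        case False
        show ?thesis
        proof (rule tay_dvd)
          fix j assume "j < Suc k"
          then show "tay i a j (g b) = 0"
            using k_min[OF gF[OF b False]] g_tay[OF b, of k] by (cases "j = k") auto
        qed
      qed simp
      assume "g b \<noteq> 0"
      then show "\<exists>\<kappa>\<le>d. exact ?l \<kappa> (g b)"
        using ord[OF g_def[of b]] tay_exact by metis
    qed
  qed
  then show False using zero sf by auto
qed

subsection \<open>Growth\<close>

lemma Pn_Bdd: "p \<in> Pn n \<Longrightarrow> p \<in> Bdd (box N) \<Longrightarrow> p \<in> Bdd (xbox n N)"
  unfolding Pn_def Bdd_def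
proof (intro CollectI ballI allI)
  fix m i
  assume p: "p \<in> {p. \<forall>m\<in>Poly_Mapping.keys p. \<forall>i\<in>Poly_Mapping.keys m. i < n}"
    "p \<in> {p. \<forall>m\<in>Poly_Mapping.keys p. \<forall>i. Poly_Mapping.lookup m i \<le> box N i}"
    and m: "m \<in> Poly_Mapping.keys p"
  from p m have "Poly_Mapping.lookup m i \<le> box N i" by blast
  then have "Poly_Mapping.lookup m i \<le> N" by (rule order_trans) simp
  moreover have "Poly_Mapping.lookup m i = 0" if "\<not> i < n"
  proof -
    have "i \<notin> Poly_Mapping.keys m" using p(1) m that by blast
    then show ?thesis by (simp add: in_keys_iff)
  qed
  ultimately show "Poly_Mapping.lookup m i \<le> xbox n N i" by simp
qed

lemma finite_subset_Ldeg:
  assumes L: "lie_subalgebra_Wn n L" and "finite B" "B \<subseteq> L"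
  obtains d where "B \<subseteq> Ldeg n L d"
proof -
  have "\<exists>d. B \<subseteq> Ldeg n L d"
    using assms(2,3)
  proof (induction B)
    case (insert D B)
    then obtain d where d: "B \<subseteq> Ldeg n L d" by auto
    have DW: "D \<in> Wn n" using insert lie_subalgebraD(1)[OF L] by simp
    have "\<forall>m. \<exists>N. D (var m) \<in> Bdd (box N)" using Bdd_box_exists by metis
    then obtain N where N: "\<And>m. D (var m) \<in> Bdd (box (N m))" by metis
    define e where "e = max d (\<Sum>m<n. N m)"
    have "D (var m) \<in> Bdd (xbox n e)" if "m < n" for m
    proof -
      have "D (var m) \<in> Bdd (xbox n (N m))" by (rule Pn_Bdd[OF WnD(2)[OF DW Pn_var[OF that]] N])
      moreover have "N m \<le> (\<Sum>m<n. N m)" using that by (intro member_le_sum) auto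
      ultimately show ?thesis by (elim Bdd_mono) (auto simp: e_def)
    qed
    then have "D \<in> Ldeg n L e" using insert by (simp add: Ldeg_def)
    moreover have "B \<subseteq> Ldeg n L e" using d Ldeg_mono[of _ n L d e] by (auto simp: e_def)
    ultimately show ?case by blast
  qed simp
  then show ?thesis using that by blast
qed

text \<open>An element of \<open>Cseq\<close> at index j is a combination of brackets of j + 1
  generators, hence the factor \<open>Suc k\<close>.\<close>

lemma growth_space_Ldeg:
  assumes L: "lie_subalgebra_Wn n L" and B: "B \<subseteq> Ldeg n L d"
  shows "growth_space (dspan B) k \<subseteq> Ldeg n L (Suc k * d)"
proof -
  have V: "dspan B \<subseteq> Ldeg n L d"
    using B subspace_Ldeg[OF L] by (rule dvs.span_minimal)
  have C: "Cseq (dspan B) j \<subseteq> Ldeg n L (Suc j * d)" for j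
  proof (induction j)
    case (Suc j)
    have "brackets (Cseq (dspan B) j) (dspan B) \<subseteq> Ldeg n L (Suc (Suc j) * d)"
    proof
      fix D assume "D \<in> brackets (Cseq (dspan B) j) (dspan B)"
      then obtain x y where "x \<in> Cseq (dspan B) j" "y \<in> dspan B" "D = lie_bracket x y"
        by (auto simp: brackets_def)
      then show "D \<in> Ldeg n L (Suc (Suc j) * d)"
        using Ldeg_bracket[OF L subsetD[OF Suc] subsetD[OF V], of x y] by (simp add: ac_simps)
    qed
    then show ?case using subspace_Ldeg[OF L] by (simp add: dvs.span_minimal)
  qed (use V in simp)
  have "(\<Union>j\<le>k. Cseq (dspan B) j) \<subseteq> Ldeg n L (Suc k * d)"
  proof (intro UN_least subsetI)
    fix j D assume "j \<in> {..k}" "D \<in> Cseq (dspan B) j"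
    then have "D \<in> Ldeg n L (Suc j * d)" "Suc j * d \<le> Suc k * d" using C[of j] by auto
    then show "D \<in> Ldeg n L (Suc k * d)" by (rule Ldeg_mono)
  qed
  then show ?thesis unfolding growth_space_def using subspace_Ldeg[OF L] by (rule dvs.span_minimal)
qed

text \<open>A limit superior above y exceeds y for arbitrarily large k, and a basis of the growth
  space supplies the independent set.\<close>

lemma GKdim_large_independent:
  assumes L: "lie_subalgebra_Wn n L" and gk: "GKdim L > ereal y" and "y > 0"
  obtains d where "\<And>k0. \<exists>k\<ge>k0. \<exists>B. finite B \<and> B \<subseteq> Ldeg n L (Suc k * d) \<and> dvs.independent B
     \<and> real k powr y \<le> real (card B)"
proof -
  obtain S where S: "finite S" "S \<subseteq> L" "ereal y < gk_growth (dspan S)"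
    using gk unfolding GKdim_def less_SUP_iff by auto
  obtain d where d: "S \<subseteq> Ldeg n L d" using finite_subset_Ldeg[OF L S(1,2)] .
  show ?thesis
  proof (rule that[of d])
    fix k0
    let ?r = "\<lambda>k. ddim (growth_space (dspan S) k)"
    \<comment> \<open>Starting from 2 makes the logarithm of k positive, so that it can be
      multiplied out.\<close>
    have "\<exists>k\<ge>max k0 2. ln (real (?r k)) / ln (real k) > y"
    proof (rule ccontr)
      assume "\<not> ?thesis"
      then have "eventually (\<lambda>k. ereal (ln (real (?r k)) / ln (real k)) \<le> ereal y) sequentially"
        unfolding eventually_sequentially by (intro exI[of _ "max k0 2"]) (auto simp: not_less)
      then have "gk_growth (dspan S) \<le> ereal y" unfolding gk_growth_def by (rule Limsup_bounded)
      with S(3) show False by simp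
    qed
    then obtain k where k: "k \<ge> k0" "k \<ge> 2" "ln (real (?r k)) / ln (real k) > y" by auto
    obtain B where B: "B \<subseteq> growth_space (dspan S) k" "dvs.independent B" "card B = ?r k"
      using dvs.basis_exists by metis
    have lnk: "ln (real k) > 0" using k by simp
    then have ln: "ln (real (?r k)) > y * ln (real k)" using k by (simp add: field_simps)
    moreover have "y * ln (real k) > 0" using lnk \<open>y > 0\<close> by simp
    \<comment> \<open>Since \<open>ln 0 = 0\<close>, a positive logarithm excludes dimension 0. A
      nonzero cardinality in turn excludes an infinite basis.\<close>
    ultimately have r: "?r k \<noteq> 0" by (intro notI) simp
    then have "finite B" using B(3) by (metis card.infinite)
    moreover have "real k powr y \<le> real (card B)"
    proof -
      have "real k powr y = exp (y * ln (real k))" using k by (simp add: powr_def)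
      also have "\<dots> \<le> exp (ln (real (?r k)))" using ln by simp
      also have "\<dots> = real (card B)" using r B(3) by simp
      finally show ?thesis .
    qed
    ultimately show "\<exists>k\<ge>k0. \<exists>B. finite B \<and> B \<subseteq> Ldeg n L (Suc k * d) \<and> dvs.independent B
       \<and> real k powr y \<le> real (card B)"
      using B k(1) growth_space_Ldeg[OF L d, of k] by (intro exI[of _ k] conjI exI[of _ B]) auto
  qed
qed

section \<open>Counts of monomials\<close>

lemma card_mons_zbox:
  "card (mons (\<lambda>j. zbox n d j + zbox n e j)) \<le> 3 ^ n * Suc (d + e) ^ n"
proof -
  have "card (mons (\<lambda>j. zbox n d j + zbox n e j)) \<le> (\<Prod>j<2*n. Suc (zbox n d j + zbox n e j))"
    by (rule card_mons(2)) auto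
  also have "{..<2*n} = {..<n} \<union> {n..<2*n}" by auto
  also have "(\<Prod>j\<in>\<dots>. Suc (zbox n d j + zbox n e j))
      = (\<Prod>j\<in>{..<n}. Suc (zbox n d j + zbox n e j)) * (\<Prod>j\<in>{n..<2*n}. Suc (zbox n d j + zbox n e j))"
    by (rule prod.union_disjoint) auto
  also have "(\<Prod>j\<in>{..<n}. Suc (zbox n d j + zbox n e j)) = Suc (d + e) ^ n" by simp
  also have "(\<Prod>j\<in>{n..<2*n}. Suc (zbox n d j + zbox n e j)) = (\<Prod>j\<in>{n..<2*n}. 3)"
    by (intro prod.cong) auto
  also have "\<dots> = 3 ^ n" by simp
  finally show ?thesis by (simp add: mult.commute)
qed

text \<open>Restriction to a hyperplane in position space saves one factor of the degree. This
  saving pays for the quadratic number of conditions in \<open>M\<close>.\<close>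

lemma card_mons_zbox_hyperplane:
  assumes "i < n"
  shows "Suc d * card (mons ((zbox n d)(i := 0))) \<le> 2 ^ n * Suc d ^ n"
proof -
  have "card (mons ((zbox n d)(i := 0))) \<le> (\<Prod>j<2*n. Suc (((zbox n d)(i := 0)) j))"
    by (rule card_mons(2)) (use assms in auto)
  also have "\<dots> = (\<Prod>j\<in>{..<2*n} - {i}. Suc (zbox n d j))"
    by (rule prod.mono_neutral_cong_right) (auto split: if_splits)
  finally have "Suc d * card (mons ((zbox n d)(i := 0))) \<le> Suc (zbox n d i) * (\<Prod>j\<in>{..<2*n} - {i}. Suc (zbox n d j))"
    using assms by (intro mult_le_mono) simp_all
  also have "\<dots> = (\<Prod>j<2*n. Suc (zbox n d j))"
    using assms by (intro prod.remove[symmetric]) auto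
  also have "{..<2*n} = {..<n} \<union> {n..<2*n}" by auto
  also have "(\<Prod>j\<in>\<dots>. Suc (zbox n d j)) = (\<Prod>j\<in>{..<n}. Suc (zbox n d j)) * (\<Prod>j\<in>{n..<2*n}. Suc (zbox n d j))"
    by (rule prod.union_disjoint) auto
  also have "(\<Prod>j\<in>{..<n}. Suc (zbox n d j)) = Suc d ^ n" by simp
  also have "(\<Prod>j\<in>{n..<2*n}. Suc (zbox n d j)) = (\<Prod>j\<in>{n..<2*n}. 2)"
    by (intro prod.cong) auto
  also have "\<dots> = 2 ^ n" by simp
  finally show ?thesis by (simp only: mult.commute)
qed

section \<open>Comparison of growth rates\<close>

theorem mainTheorem13:
  fixes n :: nat and L :: "('k::field_char_0 mpoly \<Rightarrow> 'k mpoly) set"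
  assumes "n \<ge> 1"
    and "lie_subalgebra_Wn n L"
    and "GKdim L = ereal (real n)"
  shows "\<not> noetherian (UE L)"
proof
  note L = assms(2)
  assume "noetherian (UE L)"
  then have "right_noetherian (UE L)" by (simp add: noetherian_def)
  from noetherian_sform_bound[OF L this]
  obtain N where N: "\<And>(S :: (nat \<times> ('k mpoly \<Rightarrow> 'k mpoly)) set) c D E. finite S \<Longrightarrow>
      (\<And>i. i \<in> S \<Longrightarrow> D i \<in> L \<and> E i \<in> L) \<Longrightarrow>
      vanish n 6 S c (\<lambda>i. symb n (D i)) (\<lambda>i. symb n (E i)) \<Longrightarrow>
      sform S c (\<lambda>i. symb n (D i)) (\<lambda>i. symb n (E i)) (\<lambda>f g. cub n f * cub n g) \<in> Bdd (box N)"
    by blast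
  \<comment> \<open>Any defect below 1/2 works: the factor \<open>M\<close> of size about sqrt k on
    the left gains k^(1/2).\<close>
  define y where "y = real n - 1/4"
  have y: "y > 0" "GKdim L > ereal y" using assms by (auto simp: y_def)
  obtain d where d: "\<And>k0. \<exists>k\<ge>k0. \<exists>B. finite B \<and> B \<subseteq> Ldeg n L (Suc k * d) \<and> dvs.independent B
     \<and> real k powr y \<le> real (card B)"
    using GKdim_large_independent[OF L y(2,1)] by blast
  \<comment> \<open>Positive growth supplies a nonempty independent set, hence a nonzero derivation
    to flow along.\<close>
  obtain X where X: "X \<in> L" "X \<noteq> 0"
  proof -
    obtain k B where kB: "k \<ge> 1" "finite B" "B \<subseteq> Ldeg n L (Suc k * d)" "dvs.independent B"
        "real k powr y \<le> real (card B)"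
      using d[of 1] by blast
    have "0 < real k powr y" using kB(1) by simp
    also have "\<dots> \<le> real (card B)" by (rule kB(5))
    finally obtain D where "D \<in> B" by fastforce
    moreover have "D \<noteq> 0" using \<open>D \<in> B\<close> kB(4) dvs.dependent_zero by blast
    ultimately show ?thesis using that kB(3) Ldeg_subset by blast
  qed
  have XW: "X \<in> Wn n" using X lie_subalgebraD(1)[OF L] by blast
  have "symb n X \<noteq> 0" using symb_eq_0[OF XW] X(2) by blast
  then obtain i where i: "i < n" "X (var i) \<noteq> 0"
    unfolding symb_def by (metis (no_types, lifting) lessThan_iff mult_zero_right sum.neutral)
  obtain a where a: "\<not> (var i - Cst a) dvd X (var i)"
    using exists_transversal_hyperplane[OF i(2)] by blast
  obtain d0 where d0: "{X} \<subseteq> Ldeg n L d0" using finite_subset_Ldeg[OF L, of "{X}"] X by blast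
  \<comment> \<open>A common degree bound for \<open>X\<close> and the generators. Being at least 1,
    it makes \<open>b\<close> at least as large as k.\<close>
  define e where "e = max 1 (max d d0)"
  have e: "e \<ge> 1" "d \<le> e" "d0 \<le> e" by (auto simp: e_def)
  have Xe: "X \<in> Ldeg n L e" using d0 Ldeg_mono[of X n L d0 e] e by blast
  define W where "W = card {\<alpha> \<in> lists {..<2*n}. length \<alpha> < 6}"
  define \<omega> where "\<omega> = card (mons (box N))"
  \<comment> \<open>The three summands come from the three kinds of conditions, and the last factor
    from bounding \<open>Suc b\<close> by 3 e k.\<close>
  define C where "C = (2 * 2 ^ n + W * (3 ^ n * 3 ^ n) + \<omega>) * (3 * e) ^ n"
  obtain k0 :: nat where k0: "real k0 > (2 * real C) ^ 4" using reals_Archimedean2 by blast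
  obtain k B where kB: "k \<ge> max 1 k0" "finite B" "B \<subseteq> Ldeg n L (Suc k * d)" "dvs.independent B"
      "real k powr y \<le> real (card B)"
    using d[of "max 1 k0"] by blast
  have k1: "k \<ge> 1" using kB by simp
  define b where "b = Suc k * e"
  \<comment> \<open>With \<open>M\<close> squared at most k, the hyperplane conditions number about
    k times b^(n-1), thus of order k^n. On the left \<open>M\<close> still contributes
    k^(1/2).\<close>
  define M where "M = nat \<lfloor>sqrt (real k)\<rfloor>"
  have sq1: "sqrt (real k) \<ge> 1" using k1 by simp
  have Mle: "real M \<le> sqrt (real k)" unfolding M_def using sq1 by simp
  have Mge: "real M \<ge> sqrt (real k) / 2"
  proof -
    have "\<lfloor>sqrt (real k)\<rfloor> \<ge> 1" using sq1 by simp
    moreover have "real M = real_of_int \<lfloor>sqrt (real k)\<rfloor>" using sq1 by (simp add: M_def)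
    ultimately show ?thesis by linarith
  qed
  have M0: "M > 0" using Mge sq1 by (cases M) auto
  have MM: "M * M \<le> k"
  proof -
    have "real M * real M \<le> sqrt (real k) * sqrt (real k)" using Mle by (intro mult_mono) auto
    then have "real (M * M) \<le> real k" by simp
    then show ?thesis by (simp only: of_nat_le_iff)
  qed
  have Mk: "M \<le> k" using MM M0 by (metis le_trans le_square)
  have kb: "k \<le> Suc b" "M * e \<le> b" "Suc b \<le> 3 * e * k"
  proof -
    have "k * 1 \<le> k * e" using e by (intro mult_le_mono) auto
    then show "k \<le> Suc b" unfolding b_def mult_Suc by linarith
    have "M * e \<le> k * e" using Mk by (intro mult_le_mono) auto
    then show "M * e \<le> b" unfolding b_def mult_Suc by linarith
    have "1 * 1 \<le> e * k" "e * 1 \<le> e * k" using e k1 by (intro mult_le_mono; simp)+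
    then show "Suc b \<le> 3 * e * k" unfolding b_def mult_Suc mult.commute[of k e] mult.assoc by linarith
  qed
  have "B \<subseteq> Ldeg n L b"
  proof
    fix D assume "D \<in> B"
    moreover have "Suc k * d \<le> b" unfolding b_def using e by (intro mult_le_mono) auto
    ultimately show "D \<in> Ldeg n L b" using kB(3) Ldeg_mono by blast
  qed
  from dimension_bound[OF L Xe i(1) a N kB(2) this kB(4) M0]
  have bound: "M * card B \<le> M * (Suc M * card (mons ((zbox n b)(i := 0))))
     + W * card (mons (\<lambda>j. zbox n (b + M * e) j + zbox n b j)) + b * \<omega>"
    unfolding W_def \<omega>_def .
  have t1: "M * (Suc M * card (mons ((zbox n b)(i := 0)))) \<le> 2 * 2 ^ n * Suc b ^ n"
  proof -
    \<comment> \<open>Both M squared and M are at most k, and k is at most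
      \<open>Suc b\<close>.\<close>
    have "M * Suc M \<le> 2 * Suc b" using MM Mk kb by simp
    then have "M * Suc M * card (mons ((zbox n b)(i := 0))) \<le> 2 * Suc b * card (mons ((zbox n b)(i := 0)))"
      by (rule mult_le_mono1)
    also have "\<dots> \<le> 2 * (2 ^ n * Suc b ^ n)"
      using card_mons_zbox_hyperplane[OF i(1), of b] by (simp only: mult.assoc)
    finally show ?thesis by (simp only: mult.assoc)
  qed
  have t2: "W * card (mons (\<lambda>j. zbox n (b + M * e) j + zbox n b j)) \<le> W * (3 ^ n * 3 ^ n) * Suc b ^ n"
  proof -
    have "card (mons (\<lambda>j. zbox n (b + M * e) j + zbox n b j)) \<le> 3 ^ n * Suc (b + M * e + b) ^ n"
      by (rule card_mons_zbox)
    also have "\<dots> \<le> 3 ^ n * (3 * Suc b) ^ n"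
      using kb by (intro mult_le_mono power_mono) auto
    finally show ?thesis by (simp only: power_mult_distrib mult.assoc) (rule mult_le_mono2)
  qed
  have t3: "b * \<omega> \<le> \<omega> * Suc b ^ n"
  proof -
    have "Suc b ^ 1 \<le> Suc b ^ n" using assms(1) by (intro power_increasing) auto
    then have "b \<le> Suc b ^ n" by simp
    then show ?thesis by (simp add: mult.commute)
  qed
  have "M * card B \<le> (2 * 2 ^ n + W * (3 ^ n * 3 ^ n) + \<omega>) * Suc b ^ n"
    using bound t1 t2 t3 by (simp only: distrib_right)
  also have "\<dots> \<le> (2 * 2 ^ n + W * (3 ^ n * 3 ^ n) + \<omega>) * (3 * e * k) ^ n"
    using kb by (intro mult_le_mono power_mono) auto
  also have "\<dots> = C * k ^ n" by (simp add: C_def power_mult_distrib)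
  finally have "real (M * card B) \<le> real (C * k ^ n)" by (simp only: of_nat_le_iff)
  then have "real M * real (card B) \<le> real C * real k ^ n" by simp
  moreover have "sqrt (real k) / 2 * (real k powr y) \<le> real M * real (card B)"
    using Mge kB(5) by (intro mult_mono) auto
  \<comment> \<open>The exponents add up to 1/2 + n - 1/4 = n + 1/4, which beats k^n by k^(1/4). The
    choice of \<open>k0\<close> makes this exceed 2 C.\<close>
  moreover have "sqrt (real k) / 2 * (real k powr y) = real k powr (1/4) / 2 * real k ^ n"
  proof -
    have "sqrt (real k) * (real k powr y) = real k powr (1/2 + y)"
      using k1 by (simp add: powr_half_sqrt powr_add)
    also have "1/2 + y = 1/4 + real n" by (simp add: y_def)
    also have "real k powr (1/4 + real n) = real k powr (1/4) * real k ^ n"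
      using k1 by (simp add: powr_add powr_realpow)
    finally show ?thesis by simp
  qed
  ultimately have "real k powr (1/4) / 2 * real k ^ n \<le> real C * real k ^ n" by linarith
  then have "real k powr (1/4) \<le> 2 * real C" using k1 by simp
  then have "(real k powr (1/4)) ^ 4 \<le> (2 * real C) ^ 4" by (intro power_mono) auto
  also have "(real k powr (1/4)) ^ 4 = real k"
    using k1 by (simp add: powr_realpow[symmetric] powr_powr)
  finally show False using k0 kB(1) by simp
qed

end
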